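(* Let $r,s,t\ge 0$ and $n\in\mathbb{N}$, and let $b_{r,s}(t)$ be the free multiplicative Brownian motion of parameters $r,s$ in $(\mathscr{A},\tau)$. Then \[ \tau\left[b_{r,s}(t)^n\right]=\tau\left[b_{r,s}(t)^{\ast n}\right]=\nu_n((r-s)t), \] \[ \tau\left[(b_{r,s}(t)b_{r,s}(t)^\ast)^n\right]=\nu_n(-4st), \] \[ \tau\left[b_{r,s}(t)^2b_{r,s}(t)^{\ast 2}\right]=e^{4st}+4st(1+st)e^{(3s-r)t}. \]
   Context: For $t\in\mathbb{R}$, $\nu_0(t)=1$ and, for $n\in\mathbb{Z}\setminus\{0\}$, \[ \nu_n(t)=e^{-\frac{|n|}{2}t}\sum_{k=0}^{|n|-1}\frac{(-t)^k}{k!}|n|^{k-1}\binom{|n|}{k+1}. \] Let $(\mathscr{A},\tau)$ be a faithful, tracial $W^\ast$-probability space containing two freely independent free semicircular Brownian motions $x(t),y(t)$ (self-adjoint processes starting at $0$ with freely independent increments, the increment over $[t_1,t_2]$ being centered semicircular of variance $t_2-t_1$). Let $w_{r,s}(t)=i\sqrt r\,x(t)+\sqrt s\,y(t)$. The free multiplicative Brownian motion $b_{r,s}(t)$ of parameters $r,s\ge0$ is the unique adapted solution of the free stochastic differential equation \[ db_{r,s}(t)=b_{r,s}(t)\,dw_{r,s}(t)-\tfrac12(r-s)b_{r,s}(t)\,dt,\qquad b_{r,s}(0)=1, \] understood as an integral equation with free Itô integrals ($L^2(\tau)$-limits of left-endpoint Riemann sums). *)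

theory Defs
  imports "HOL-Analysis.Analysis"
begin

section \<open>Unital C*-algebras\<close>

class cstar_algebra = real_normed_algebra_1 + banach +
  fixes scaleC :: "complex \<Rightarrow> 'a \<Rightarrow> 'a" (infixr \<open>*\<^sub>C\<close> 75)
    and star :: "'a \<Rightarrow> 'a"
  assumes scaleC_of_real: "complex_of_real c *\<^sub>C a = c *\<^sub>R a"
    and scaleC_add_right: "z *\<^sub>C (a + b) = z *\<^sub>C a + z *\<^sub>C b"
    and scaleC_add_left: "(z + z') *\<^sub>C a = z *\<^sub>C a + z' *\<^sub>C a"
    and scaleC_scaleC: "z *\<^sub>C z' *\<^sub>C a = (z * z') *\<^sub>C a"
    and scaleC_mult_left: "(z *\<^sub>C a) * b = z *\<^sub>C (a * b)"
    and scaleC_mult_right: "a * (z *\<^sub>C b) = z *\<^sub>C (a * b)"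
    and norm_scaleC: "norm (z *\<^sub>C a) = cmod z * norm a"
    and star_star: "star (star a) = a"
    and star_add: "star (a + b) = star a + star b"
    and star_scaleC: "star (z *\<^sub>C a) = cnj z *\<^sub>C star a"
    and star_mult: "star (a * b) = star b * star a"
    and cstar_identity: "norm (star a * a) = (norm a)\<^sup>2"

definition unital_star_subalgebra :: "'a::cstar_algebra set \<Rightarrow> bool" where
  "unital_star_subalgebra B \<longleftrightarrow>
     1 \<in> B \<and>
     (\<forall>a\<in>B. \<forall>b\<in>B. a + b \<in> B \<and> a * b \<in> B) \<and>
     (\<forall>z. \<forall>a\<in>B. z *\<^sub>C a \<in> B) \<and>
     (\<forall>a\<in>B. star a \<in> B)"


section \<open>Faithful tracial W*-probability spaces\<close>

definition dual_space :: "('a::cstar_algebra \<Rightarrow> complex) set" where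
  "dual_space = {f. bounded_linear f \<and> (\<forall>z a. f (z *\<^sub>C a) = z * f a)}"

text \<open>
  W*-algebras are taken in the sense of Sakai: C*-algebras that are the dual of a Banach space.
  The predual is realised as a norm-closed subspace \<open>F\<close> of the dual space such that the
  evaluation map into the dual of \<open>F\<close> is isometric and onto.  Invariance of \<open>F\<close>
  under translation by algebra elements says that multiplication is separately weak*-continuous;
  for C*-algebras it is a consequence of the other clauses (Sakai) and is immediate for
  von Neumann algebras on a Hilbert space.
\<close>

definition is_predual :: "('a::cstar_algebra \<Rightarrow> complex) set \<Rightarrow> bool" where
  "is_predual F \<longleftrightarrow>
     F \<subseteq> dual_space \<and>
     (\<lambda>a. 0) \<in> F \<and>
     (\<forall>f\<in>F. \<forall>g\<in>F. (\<lambda>a. f a + g a) \<in> F) \<and>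
     (\<forall>z. \<forall>f\<in>F. (\<lambda>a. z * f a) \<in> F) \<and>
     (\<forall>f\<in>dual_space. (\<forall>e>0. \<exists>g\<in>F. onorm (\<lambda>a. f a - g a) < e) \<longrightarrow> f \<in> F) \<and>
     (\<forall>f\<in>F. \<forall>c. (\<lambda>a. f (c * a)) \<in> F \<and> (\<lambda>a. f (a * c)) \<in> F) \<and>
     (\<forall>a. norm a = (SUP f\<in>{f\<in>F. onorm f \<le> 1}. cmod (f a))) \<and>
     (\<forall>\<phi> :: ('a \<Rightarrow> complex) \<Rightarrow> complex.
        (\<forall>f\<in>F. \<forall>g\<in>F. \<phi> (\<lambda>a. f a + g a) = \<phi> f + \<phi> g) \<and>
        (\<forall>z. \<forall>f\<in>F. \<phi> (\<lambda>a. z * f a) = z * \<phi> f) \<and>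
        (\<exists>K. \<forall>f\<in>F. cmod (\<phi> f) \<le> K * onorm f)
        \<longrightarrow> (\<exists>a. \<forall>f\<in>F. \<phi> f = f a))"

definition weak_star_topology :: "('a::cstar_algebra \<Rightarrow> complex) set \<Rightarrow> 'a topology" where
  "weak_star_topology F =
     pullback_topology UNIV (\<lambda>a. \<lambda>f\<in>F. f a) (product_topology (\<lambda>_. euclidean) F)"

definition generated_wstar :: "('a::cstar_algebra \<Rightarrow> complex) set \<Rightarrow> 'a set \<Rightarrow> 'a set" where
  "generated_wstar F S =
     (\<lambda>B. unital_star_subalgebra B \<and> closedin (weak_star_topology F) B) hull S"

locale faithful_tracial_wstar_space =
  fixes F :: "('a::cstar_algebra \<Rightarrow> complex) set"
    and \<tau> :: "'a \<Rightarrow> complex"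
  assumes predual: "is_predual F"
    and normal: "\<tau> \<in> F"
    and unital: "\<tau> 1 = 1"
    and positive: "\<tau> (star a * a) \<in> \<real>\<^sub>\<ge>\<^sub>0"
    and faithful: "\<tau> (star a * a) = 0 \<Longrightarrow> a = 0"
    and tracial: "\<tau> (a * b) = \<tau> (b * a)"

definition L2_norm :: "('a::cstar_algebra \<Rightarrow> complex) \<Rightarrow> 'a \<Rightarrow> real" where
  "L2_norm \<tau> a = sqrt (Re (\<tau> (star a * a)))"


section \<open>Free independence and free Brownian motion\<close>

text \<open>Sets are freely independent when the unital *-algebras they generate are.\<close>

definition freely_independent ::
    "('a::cstar_algebra \<Rightarrow> complex) \<Rightarrow> 'i set \<Rightarrow> ('i \<Rightarrow> 'a set) \<Rightarrow> bool" where
  "freely_independent \<tau> I S \<longleftrightarrow>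
     (\<forall>is as. is \<noteq> [] \<and> distinct_adj is \<and>
        list_all2 (\<lambda>i a. i \<in> I \<and> a \<in> unital_star_subalgebra hull (S i) \<and> \<tau> a = 0) is as
        \<longrightarrow> \<tau> (prod_list as) = 0)"

definition semicircular :: "('a::cstar_algebra \<Rightarrow> complex) \<Rightarrow> real \<Rightarrow> 'a \<Rightarrow> bool" where
  "semicircular \<tau> v a \<longleftrightarrow>
     star a = a \<and>
     (\<forall>n. \<tau> (a ^ n) = complex_of_real
        (integral {- 2 * sqrt v .. 2 * sqrt v}
          (\<lambda>u. u ^ n * (sqrt (4 * v - u\<^sup>2) / (2 * pi * v)))))"

definition is_partition :: "real \<Rightarrow> real \<Rightarrow> nat \<Rightarrow> (nat \<Rightarrow> real) \<Rightarrow> bool" where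
  "is_partition a b m p \<longleftrightarrow> p 0 = a \<and> p m = b \<and> (\<forall>i<m. p i < p (Suc i))"

definition free_brownian_motion ::
    "('a::cstar_algebra \<Rightarrow> complex) \<Rightarrow> (real \<Rightarrow> 'a) \<Rightarrow> bool" where
  "free_brownian_motion \<tau> x \<longleftrightarrow>
     x 0 = 0 \<and>
     (\<forall>t\<ge>0. star (x t) = x t) \<and>
     (\<forall>t1 t2. 0 \<le> t1 \<and> t1 < t2 \<longrightarrow> semicircular \<tau> (t2 - t1) (x t2 - x t1)) \<and>
     (\<forall>t1 t2 m p. 0 \<le> t1 \<and> is_partition t1 t2 m p \<longrightarrow>
        freely_independent \<tau> {..<m} (\<lambda>i. {x (p (Suc i)) - x (p i)}))"


section \<open>Free multiplicative Brownian motion\<close>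

text \<open>
  \<open>has_L2_integral \<tau> \<theta> z t J\<close> means that \<open>J\<close> is the integral of \<open>\<theta> dz\<close> over \<open>[0,t]\<close>:
  the left-endpoint Riemann sums tend to \<open>J\<close> in \<open>L\<^sup>2(\<tau>)\<close> as the mesh tends to 0.  The free Ito
  integral is the case of a noise \<open>z\<close>; the choice \<open>z = of_real\<close> gives the integral of \<open>\<theta> du\<close>.
\<close>

definition has_L2_integral ::
    "('a::cstar_algebra \<Rightarrow> complex) \<Rightarrow> (real \<Rightarrow> 'a) \<Rightarrow> (real \<Rightarrow> 'a) \<Rightarrow> real \<Rightarrow> 'a \<Rightarrow> bool" where
  "has_L2_integral \<tau> \<theta> z t J \<longleftrightarrow>
     (\<forall>e>0. \<exists>d>0. \<forall>m p. is_partition 0 t m p \<and> (\<forall>i<m. p (Suc i) - p i < d) \<longrightarrow>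
        L2_norm \<tau> ((\<Sum>i<m. \<theta> (p i) * (z (p (Suc i)) - z (p i))) - J) < e)"

definition w_noise ::
    "real \<Rightarrow> real \<Rightarrow> (real \<Rightarrow> 'a::cstar_algebra) \<Rightarrow> (real \<Rightarrow> 'a) \<Rightarrow> real \<Rightarrow> 'a" where
  "w_noise r s x y t = (\<i> * complex_of_real (sqrt r)) *\<^sub>C x t + complex_of_real (sqrt s) *\<^sub>C y t"

definition filtration ::
    "('a::cstar_algebra \<Rightarrow> complex) set \<Rightarrow> (real \<Rightarrow> 'a) \<Rightarrow> (real \<Rightarrow> 'a) \<Rightarrow> real \<Rightarrow> 'a set" where
  "filtration F x y t = generated_wstar F (x ` {0..t} \<union> y ` {0..t})"

text \<open>
  \<open>b\<close> is an adapted solution of \<open>db = b dw - 1/2 (r - s) b dt\<close>, \<open>b(0) = 1\<close>.  No regularity of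
  \<open>b\<close> is imposed beyond the existence of the two integrals.
\<close>

definition free_multiplicative_brownian_motion ::
    "('a::cstar_algebra \<Rightarrow> complex) set \<Rightarrow> ('a \<Rightarrow> complex) \<Rightarrow> real \<Rightarrow> real \<Rightarrow>
     (real \<Rightarrow> 'a) \<Rightarrow> (real \<Rightarrow> 'a) \<Rightarrow> (real \<Rightarrow> 'a) \<Rightarrow> bool" where
  "free_multiplicative_brownian_motion F \<tau> r s x y b \<longleftrightarrow>
     b 0 = 1 \<and>
     (\<forall>t\<ge>0. b t \<in> filtration F x y t) \<and>
     (\<forall>t\<ge>0. \<exists>J D. has_L2_integral \<tau> b (w_noise r s x y) t J \<and>
        has_L2_integral \<tau> b of_real t D \<and>
        b t = 1 + J - ((r - s) / 2) *\<^sub>R D)"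


section \<open>The moments\<close>

definition nu :: "int \<Rightarrow> real \<Rightarrow> real" where
  "nu n t = (if n = 0 then 1 else
     exp (- (real_of_int \<bar>n\<bar> / 2) * t) *
     (\<Sum>k<nat \<bar>n\<bar>. (- t) ^ k / fact k * real_of_int \<bar>n\<bar> powi (int k - 1) *
        real (nat \<bar>n\<bar> choose (k + 1))))"

end

theory Submission
  imports Defs
begin

text \<open>
  The stochastic equation is discretised by the Euler scheme
  \<open>E (i + 1) = E i * (1 + dw i - c * h)\<close> with \<open>c = (r - s) / 2\<close>.  The Ito isometry and Gronwall's
  inequality give convergence to \<open>b t\<close> in \<open>L\<^sup>2(\<tau>)\<close>; no regularity of \<open>b\<close> is needed because the partial
  Riemann sums are uniformly close to the indefinite integral.  Since \<open>dw i\<close> is free from the past,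
  expanding a *-moment of \<open>E (i + 1)\<close> to second order in \<open>dw i\<close> expresses it by *-moments of
  \<open>E i\<close> up to an error \<open>O(h powr (3 / 2))\<close>, by noncommutative Hoelder inequalities for the exponents
  \<open>2 ^ k\<close>.  In the limit \<open>m n = \<tau>(b ^ n)\<close> (with \<open>\<kappa> = -c\<close>) and \<open>m n = \<tau>((b b*) ^ n)\<close> (with \<open>\<kappa> = 2 s\<close>) both
  solve \<open>m n' = \<kappa> * n * (m n + (\<Sum>0<p<n. m p * m (n - p)))\<close>, which by Lagrange inversion is also solved by
  \<open>\<nu>\<^sub>n(-2 \<kappa> t)\<close>; the mixed moment satisfies a linear equation of the same origin.  The uniform
  \<open>L\<^sup>p\<close> bounds upgrade \<open>L\<^sup>2\<close> convergence to convergence of all *-moments.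
\<close>

section \<open>Tracial states\<close>

text \<open>Nothing bounds \<open>b u\<close> uniformly in \<open>u\<close>, so no Ito formula is
  applied to \<open>b\<close> itself. The Euler approximants are polynomials in the increments, so
  freeness from the past applies to arbitrary words in them. For \<open>b\<close>, which only lies
  in a weak*-closed algebra, a single two-factor factorisation is used, namely in the mean-square
  comparison.

  Both moment families obey one equation because in each case the noise has covariance
  \<open>2 * \<kappa> * h\<close> when the drift is \<open>\<kappa> * h\<close>: these are
  \<open>(s - r) * h\<close> and \<open>- c * h\<close> for \<open>E\<close>, and
  \<open>4 * s * h\<close> and \<open>2 * s * h\<close> for \<open>star E * E\<close>. The second
  family is treated through \<open>star E * E\<close>, whose moments agree with those of
  \<open>E * star E\<close>: with \<open>v = 1 + \<delta>\<close>, the step from \<open>a\<close> to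
  \<open>star v * a * v\<close> has under the trace the same moments as
  \<open>a * (v * star v)\<close>, which is again multiplication on one side by a factor close to
  1.\<close>

lemma scaleC_zero_left [simp]: "0 *\<^sub>C (a::'a::cstar_algebra) = 0"
  using scaleC_of_real[of 0 a] by simp

lemma scaleC_one [simp]: "1 *\<^sub>C (a::'a::cstar_algebra) = a"
  using scaleC_of_real[of 1 a] by simp

lemma scaleC_zero_right [simp]: "z *\<^sub>C (0::'a::cstar_algebra) = 0"
  using scaleC_add_right[of z 0 "0::'a"] by simp

lemma scaleC_minus_one: "(-1) *\<^sub>C (a::'a::cstar_algebra) = - a"
  using scaleC_of_real[of "-1" a] by simp

lemma star_zero [simp]: "star (0::'a::cstar_algebra) = 0"
  using star_add[of 0 "0::'a"] by simp

lemma star_one [simp]: "star (1::'a::cstar_algebra) = 1"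
  by (metis mult.left_neutral mult.right_neutral star_mult star_star)

lemma star_minus: "star (- a) = - star (a::'a::cstar_algebra)"
  by (metis add.right_inverse add_eq_0_iff star_add star_zero)

lemma star_diff: "star (a - b) = star a - star (b::'a::cstar_algebra)"
  by (metis diff_conv_add_uminus star_add star_minus)

lemma star_scaleR: "star (c *\<^sub>R a) = c *\<^sub>R star (a::'a::cstar_algebra)"
  by (metis complex_cnj_complex_of_real scaleC_of_real star_scaleC)

lemma star_power: "star (a ^ n) = star (a::'a::cstar_algebra) ^ n"
  by (induction n) (simp_all add: star_mult power_commutes)

lemma scaleC_diff_right: "z *\<^sub>C (a - b) = z *\<^sub>C a - z *\<^sub>C (b::'a::cstar_algebra)"
  by (metis add_diff_cancel diff_add_cancel scaleC_add_right)

lemma star_mult_self_power: "star ((star a * a) ^ n) = (star a * (a::'a::cstar_algebra)) ^ n"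
  by (simp add: star_power star_mult star_star)

lemma mult_power_swap: "(a * b) ^ Suc n = a * (b * a) ^ n * (b::'a::monoid_mult)"
  by (induction n) (simp_all add: mult.assoc power_commutes)

lemma mult_cnj_norm:
  "z * cnj z = complex_of_real (cmod z) * complex_of_real (cmod z)"
  "z * (cnj z * c) = complex_of_real (cmod z) * (complex_of_real (cmod z) * c)"
  using complex_norm_square[of z] by (simp_all add: power2_eq_square flip: mult.assoc)

locale tracial_state =
  fixes \<tau> :: "'a::cstar_algebra \<Rightarrow> complex"
  assumes tau_add: "\<tau> (a + b) = \<tau> a + \<tau> b"
    and tau_scaleC: "\<tau> (z *\<^sub>C a) = z * \<tau> a"
    and tau_one: "\<tau> 1 = 1"
    and tau_positive: "\<tau> (star a * a) \<in> \<real>\<^sub>\<ge>\<^sub>0"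
    and tau_commute: "\<tau> (a * b) = \<tau> (b * a)"
begin

lemma tau_zero [simp]: "\<tau> 0 = 0"
  using tau_scaleC[of 0 0] by simp

lemma tau_minus: "\<tau> (- a) = - \<tau> a"
  by (metis scaleC_minus_one tau_scaleC mult_minus1)

lemma tau_diff: "\<tau> (a - b) = \<tau> a - \<tau> b"
  by (metis diff_conv_add_uminus tau_add tau_minus)

lemma tau_scaleR: "\<tau> (c *\<^sub>R a) = complex_of_real c * \<tau> a"
  by (metis scaleC_of_real tau_scaleC)

lemma tau_sum: "\<tau> (\<Sum>i\<in>I. f i) = (\<Sum>i\<in>I. \<tau> (f i))"
  by (induction I rule: infinite_finite_induct) (simp_all add: tau_add)

text \<open>Positivity forces hermitian symmetry by polarisation: the traces of
  \<open>star c * c\<close> for \<open>c = 1 + a\<close> and \<open>c = 1 + \<i> *\<^sub>C a\<close>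
  are real.\<close>

lemma tau_star: "\<tau> (star a) = cnj (\<tau> a)"
proof -
  have real: "Im (\<tau> (star c * c)) = 0" for c
    using tau_positive[of c] by (auto elim: nonneg_Reals_cases)
  have "Im (\<tau> a) + Im (\<tau> (star a)) = 0"
    using real[of "1 + a"] real[of a] by (simp add: star_add ring_distribs tau_add tau_one)
  moreover have "Re (\<tau> a) - Re (\<tau> (star a)) = 0"
    using real[of "1 + \<i> *\<^sub>C a"] real[of a]
    by (simp add: star_add ring_distribs tau_add tau_one star_scaleC scaleC_mult_left
        scaleC_mult_right tau_scaleC scaleC_scaleC)
  ultimately show ?thesis by (simp add: complex_eq_iff)
qed

lemma tau_power_commute: "\<tau> ((a * b) ^ n) = \<tau> ((b * a) ^ n)"
proof (cases n)
  case (Suc m)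
  then show ?thesis
    by (metis mult_power_swap mult.assoc power_Suc tau_commute)
qed simp

abbreviation L2 :: "'a \<Rightarrow> real" where "L2 \<equiv> L2_norm \<tau>"

lemma Re_tau_nonneg: "0 \<le> Re (\<tau> (star a * a))"
  using tau_positive[of a] by (auto elim: nonneg_Reals_cases)

lemma tau_star_mult_eq: "\<tau> (star a * a) = complex_of_real ((L2 a)\<^sup>2)"
  using tau_positive[of a]
  by (auto simp: L2_norm_def simp flip: of_real_power elim!: nonneg_Reals_cases)

lemma L2_sq: "(L2 a)\<^sup>2 = Re (\<tau> (star a * a))"
  by (simp add: L2_norm_def Re_tau_nonneg)

lemma L2_nonneg [simp]: "0 \<le> L2 a"
  by (simp add: L2_norm_def Re_tau_nonneg)

lemma L2_star [simp]: "L2 (star a) = L2 a"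
  by (simp add: L2_norm_def star_star tau_commute)

lemma L2_zero [simp]: "L2 0 = 0"
  by (simp add: L2_norm_def)

lemma Cauchy_Schwarz_star: "cmod (\<tau> (star a * b)) \<le> L2 a * L2 b"
proof -
  define w where "w = \<tau> (star a * b)"
  define A where "A = (L2 a)\<^sup>2"
  define B where "B = (L2 b)\<^sup>2"
  have wb: "\<tau> (star b * a) = cnj w"
    by (metis star_mult star_star tau_star w_def)
  \<comment> \<open>Positivity at \<open>u a + cnj w b\<close> with real \<open>u\<close>. The
    coefficient \<open>cnj w\<close> makes the cross terms real, so the usual discriminant argument
    applies to a complex trace.\<close>
  have ineq: "0 \<le> u\<^sup>2 * A + 2 * u * (cmod w)\<^sup>2 + (cmod w)\<^sup>2 * B" for u
  proof -
    let ?c = "complex_of_real u *\<^sub>C a + cnj w *\<^sub>C b"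
    have "\<tau> (star ?c * ?c) = complex_of_real (u\<^sup>2 * A + 2 * u * (cmod w)\<^sup>2 + (cmod w)\<^sup>2 * B)"
      using tau_star_mult_eq[of a] tau_star_mult_eq[of b] wb
      by (simp add: star_add star_scaleC ring_distribs scaleC_mult_left scaleC_mult_right
          scaleC_scaleC tau_add tau_scaleC A_def B_def flip: w_def)
        (simp add: algebra_simps power2_eq_square mult_cnj_norm)
    then show ?thesis
      using Re_tau_nonneg[of ?c] by simp
  qed
  have "(cmod w)\<^sup>2 \<le> A * B"
  proof (cases "w = 0")
    case True
    then show ?thesis by (simp add: A_def B_def)
  next
    case False
    define W where "W = (cmod w)\<^sup>2"
    have W: "W > 0" using False by (simp add: W_def)
    have A0: "A \<ge> 0" and B0: "B \<ge> 0" by (auto simp: A_def B_def)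
    have ineq: "0 \<le> u\<^sup>2 * A + 2 * u * W + W * B" for u using ineq[of u] by (simp add: W_def)
    show ?thesis
    proof (cases "A = 0")
      case True
      then have "0 \<le> 2 * (- (B + 1)) * W + W * B" using ineq[of "-(B+1)"] by simp
      also have "\<dots> = - W * (B + 2)" by (simp add: algebra_simps)
      finally show ?thesis using W B0 by (simp add: mult_le_0_iff zero_le_mult_iff)
    next
      case False
      with A0 have Ap: "A > 0" by simp
      have "0 \<le> (W/A)\<^sup>2 * A + 2 * (-(W/A)) * W + W * B" using ineq[of "-(W/A)"] by simp
      also have "\<dots> = W / A * (A * B - W)"
        using Ap by (simp add: field_simps power2_eq_square)
      finally show ?thesis using W Ap by (simp add: zero_le_mult_iff W_def zero_le_divide_iff)
    qed
  qed
  also have "\<dots> = (L2 a * L2 b)\<^sup>2" by (simp add: A_def B_def power_mult_distrib)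
  finally show ?thesis unfolding w_def by (rule power2_le_imp_le) simp
qed

lemma Cauchy_Schwarz: "cmod (\<tau> (a * b)) \<le> L2 a * L2 b"
  using Cauchy_Schwarz_star[of "star a" b] by (simp add: star_star)

lemma L2_scaleC: "L2 (z *\<^sub>C a) = cmod z * L2 a"
proof -
  have "\<tau> (star (z *\<^sub>C a) * (z *\<^sub>C a)) = complex_of_real ((cmod z * L2 a)\<^sup>2)"
    by (simp add: star_scaleC scaleC_mult_left scaleC_mult_right scaleC_scaleC tau_scaleC
        tau_star_mult_eq power_mult_distrib)
      (simp add: mult_cnj_norm power2_eq_square)
  then have "(L2 (z *\<^sub>C a))\<^sup>2 = (cmod z * L2 a)\<^sup>2"
    by (simp add: L2_sq del: of_real_mult of_real_power)
  then show ?thesis by (rule power2_eq_imp_eq) simp_all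
qed

lemma L2_scaleR: "L2 (c *\<^sub>R a) = \<bar>c\<bar> * L2 a"
  using L2_scaleC[of "complex_of_real c" a] by (simp add: scaleC_of_real)

lemma L2_triangle: "L2 (a + b) \<le> L2 a + L2 b"
proof -
  have "(L2 (a + b))\<^sup>2 = Re (\<tau> (star (a + b) * a)) + Re (\<tau> (star (a + b) * b))"
    by (simp add: L2_sq tau_add ring_distribs)
  also have "\<dots> \<le> L2 (a + b) * L2 a + L2 (a + b) * L2 b"
    by (intro add_mono order_trans[OF complex_Re_le_cmod Cauchy_Schwarz_star])
  finally have "L2 (a + b) * L2 (a + b) \<le> L2 (a + b) * (L2 a + L2 b)"
    by (simp add: power2_eq_square algebra_simps)
  then show ?thesis
    by (metis L2_nonneg add_nonneg_nonneg linorder_not_le mult_le_cancel_left_pos order_le_less_trans order.strict_iff_order)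
qed

lemma L2_minus [simp]: "L2 (- a) = L2 a"
  using L2_scaleR[of "-1" a] by simp

lemma L2_triangle_diff: "L2 (a - b) \<le> L2 a + L2 b"
  using L2_triangle[of a "- b"] by simp

end

section \<open>Dyadic $L^p$ norms\<close>

lemma list_split_pairs:
  assumes "length zs = 2 * m"
  obtains ps where "zs = concat (map (\<lambda>(a, b). [a, b]) ps)" "length ps = m"
  using assms
proof (induction m arbitrary: zs thesis)
  case (Suc m)
  then obtain a b zs' where zs: "zs = a # b # zs'" "length zs' = 2 * m"
    by (auto simp: length_Suc_conv)
  obtain ps where "zs' = concat (map (\<lambda>(a, b). [a, b]) ps)" "length ps = m"
    using Suc.IH[OF _ zs(2)] by blast
  then show ?case using Suc.prems(1)[of "(a, b) # ps"] zs by simp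
qed simp

lemma prod_list_pairs:
  "prod_list (concat (map (\<lambda>(a, b). [f a, f b]) ps)) = prod_list (map (\<lambda>(a, b). f a * f b) ps)"
  for f :: "'b \<Rightarrow> 'c::monoid_mult"
  by (induction ps) (auto simp: mult.assoc)

lemma prod_list_mono_real:
  fixes f g :: "'b \<Rightarrow> real"
  assumes "\<And>x. x \<in> set xs \<Longrightarrow> 0 \<le> f x \<and> f x \<le> g x"
  shows "prod_list (map f xs) \<le> prod_list (map g xs)" and "0 \<le> prod_list (map f xs)"
proof -
  have "prod_list (map f xs) \<le> prod_list (map g xs) \<and> 0 \<le> prod_list (map f xs)"
    using assms
  proof (induction xs)
    case (Cons x xs)
    have "0 \<le> f x" "f x \<le> g x" using Cons.prems by auto
    moreover have "prod_list (map f xs) \<le> prod_list (map g xs)" "0 \<le> prod_list (map f xs)"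
      using Cons by auto
    ultimately show ?case by (auto intro!: mult_mono)
  qed simp
  then show "prod_list (map f xs) \<le> prod_list (map g xs)" and "0 \<le> prod_list (map f xs)"
    by auto
qed

context tracial_state
begin

text \<open>The level \<open>k\<close> stands for the exponent \<open>2 ^ (k + 1)\<close>.\<close>

definition Lp :: "nat \<Rightarrow> 'a \<Rightarrow> real" where
  "Lp k z = root (2 ^ Suc k) (Re (\<tau> ((star z * z) ^ (2 ^ k))))"

lemma tau_power_nonneg: "\<tau> ((star z * z) ^ (2 ^ k)) \<in> \<real>\<^sub>\<ge>\<^sub>0"
proof (cases k)
  case 0
  then show ?thesis by (simp add: tau_positive)
next
  case (Suc j)
  have "(star z * z) ^ (2 ^ k) = star ((star z * z) ^ 2 ^ j) * (star z * z) ^ 2 ^ j"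
    by (simp add: Suc star_mult_self_power power_add[symmetric] mult_2)
  then show ?thesis by (metis tau_positive)
qed

lemma Lp_nonneg [simp]: "0 \<le> Lp k z"
  using tau_power_nonneg[of z k]
  by (auto simp: Lp_def intro!: real_root_ge_zero elim!: nonneg_Reals_cases)

lemma tau_power_eq: "\<tau> ((star z * z) ^ (2 ^ k)) = complex_of_real (Lp k z ^ (2 ^ Suc k))"
  using tau_power_nonneg[of z k]
  by (auto simp: Lp_def real_root_pow_pos2 simp flip: of_real_power elim!: nonneg_Reals_cases)

lemma Lp_eqI:
  assumes "\<tau> ((star z * z) ^ (2 ^ k)) = complex_of_real (c ^ (2 ^ Suc k))" "0 \<le> c"
  shows "Lp k z = c"
  using assms by (simp add: Lp_def real_root_power_cancel del: power_Suc of_real_power)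

lemma Lp_0: "Lp 0 z = L2 z"
  by (rule Lp_eqI) (simp_all add: tau_star_mult_eq)

lemma Lp_one [simp]: "Lp k 1 = 1"
  by (rule Lp_eqI) (simp_all add: tau_one)

lemma Lp_star [simp]: "Lp k (star z) = Lp k z"
  by (rule Lp_eqI) (simp_all add: star_star tau_power_commute[of z "star z"] tau_power_eq)

lemma Lp_zero [simp]: "Lp k 0 = 0"
  by (rule Lp_eqI) (simp_all add: power_0_left)

lemma Lp_scaleC: "Lp k (c *\<^sub>C z) = cmod c * Lp k z"
proof (rule Lp_eqI)
  have eq: "star (c *\<^sub>C z) * c *\<^sub>C z = complex_of_real ((cmod c)\<^sup>2) *\<^sub>C (star z * z)"
    by (simp add: star_scaleC scaleC_mult_left scaleC_mult_right scaleC_scaleC mult_cnj_norm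
        power2_eq_square)
  have "(u *\<^sub>C a) ^ m = u ^ m *\<^sub>C a ^ m" for u m and a :: 'a
    by (induction m) (simp_all add: scaleC_mult_left scaleC_mult_right scaleC_scaleC mult.commute)
  then show "\<tau> ((star (c *\<^sub>C z) * c *\<^sub>C z) ^ 2 ^ k) = complex_of_real ((cmod c * Lp k z) ^ 2 ^ Suc k)"
    by (simp add: eq tau_scaleC tau_power_eq power_mult_distrib power_mult)
qed simp

lemma Lp_scaleR: "Lp k (c *\<^sub>R z) = \<bar>c\<bar> * Lp k z"
  using Lp_scaleC[of k "complex_of_real c" z] by (simp add: scaleC_of_real)

lemma Lp_minus [simp]: "Lp k (- z) = Lp k z"
  using Lp_scaleR[of k "-1" z] by simp

lemma Lp_star_mult_self: "Lp k (star z * z) = (Lp (Suc k) z)\<^sup>2"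
proof (rule Lp_eqI)
  have "(star (star z * z) * (star z * z)) ^ 2 ^ k = (star z * z) ^ 2 ^ Suc k"
    by (simp add: star_mult star_star power_mult power2_eq_square)
  then show "\<tau> ((star (star z * z) * (star z * z)) ^ 2 ^ k)
      = complex_of_real (((Lp (Suc k) z)\<^sup>2) ^ 2 ^ Suc k)"
    by (metis power_mult power_Suc tau_power_eq)
qed simp

lemma Lp_mult_self_star: "Lp k (z * star z) = (Lp (Suc k) z)\<^sup>2"
  using Lp_star_mult_self[of k "star z"] by (simp add: star_star)

lemma Lp_pow_tau: "Lp k z ^ 2 ^ Suc k = cmod (\<tau> ((star z * z) ^ 2 ^ k))"
  by (simp add: tau_power_eq norm_power del: power_Suc)

lemma length_concat_replicate_pair: "length (concat (replicate n [a, b])) = 2 * n"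
  by (induction n) auto

lemma prod_list_concat_replicate_pair:
  "prod_list (map f (concat (replicate n [a, b]))) = (f a * f b) ^ n"
  for f :: "'b \<Rightarrow> 'c::monoid_mult"
  by (induction n) (auto simp: mult.assoc)

lemma le_of_Lp_pow: "a ^ 2 ^ Suc k \<le> b ^ 2 ^ Suc k \<Longrightarrow> 0 \<le> b \<Longrightarrow> a \<le> (b::real)"
  by (rule power_le_imp_le_base[where n = "2 ^ Suc k - 1"]) simp_all

text \<open>Pairing the \<open>2 ^ (k + 2)\<close> factors reduces the inequality at level \<open>k + 1\<close> to level \<open>k\<close>:
  the norm of a pair is again the trace of a product of \<open>2 ^ (k + 1)\<close> factors.\<close>

lemma Lp_mult_of_Hoelder:
  assumes "\<And>zs. length zs = 2 ^ Suc k \<Longrightarrow> cmod (\<tau> (prod_list zs)) \<le> prod_list (map (Lp k) zs)"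
  shows "Lp k (z * z') \<le> Lp (Suc k) z * Lp (Suc k) z'"
proof -
  have alternating: "cmod (\<tau> ((u * v) ^ 2 ^ k)) \<le> (Lp k u * Lp k v) ^ 2 ^ k" for u v
    using assms[of "concat (replicate (2 ^ k) [u, v])"]
      prod_list_concat_replicate_pair[of "\<lambda>x. x" "2 ^ k" u v]
    by (simp add: length_concat_replicate_pair prod_list_concat_replicate_pair del: length_concat)
  \<comment> \<open>Rotating \<open>star z'\<close> to the end turns this power into an alternating
    word in \<open>star z * z\<close> and \<open>z' * star z'\<close>, whose norms are squares of
    norms one level higher.\<close>
  have "(star (z * z') * (z * z')) ^ 2 ^ k = (star z' * (star z * z * z')) ^ 2 ^ k"
    by (simp add: star_mult mult.assoc)
  then have "\<tau> ((star (z * z') * (z * z')) ^ 2 ^ k) = \<tau> (((star z * z) * (z' * star z')) ^ 2 ^ k)"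
    by (metis tau_power_commute mult.assoc)
  then have "Lp k (z * z') ^ 2 ^ Suc k \<le> (Lp k (star z * z) * Lp k (z' * star z')) ^ 2 ^ k"
    using alternating by (simp add: Lp_pow_tau del: power_Suc)
  also have "\<dots> = (Lp (Suc k) z * Lp (Suc k) z') ^ 2 ^ Suc k"
    by (simp add: Lp_star_mult_self Lp_mult_self_star power_mult power_mult_distrib)
  finally show ?thesis by (rule le_of_Lp_pow) simp
qed

lemma Hoelder:
  "length zs = 2 ^ Suc k \<Longrightarrow> cmod (\<tau> (prod_list zs)) \<le> prod_list (map (Lp k) zs)"
proof (induction k arbitrary: zs)
  case 0
  then obtain a b where "zs = [a, b]" by (auto simp: length_Suc_conv numeral_2_eq_2)
  then show ?case using Cauchy_Schwarz[of a b] by (simp add: Lp_0)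
next
  case (Suc k)
  have pair: "Lp k (z * z') \<le> Lp (Suc k) z * Lp (Suc k) z'" for z z'
    by (rule Lp_mult_of_Hoelder) (rule Suc.IH)
  obtain ps where ps: "zs = concat (map (\<lambda>(a, b). [a, b]) ps)" "length ps = 2 ^ Suc k"
    using list_split_pairs[of zs "2 ^ Suc k"] Suc.prems by auto
  have "cmod (\<tau> (prod_list zs)) = cmod (\<tau> (prod_list (map (\<lambda>(a, b). a * b) ps)))"
    using prod_list_pairs[of "\<lambda>x. x" ps] by (simp add: ps(1))
  also have "\<dots> \<le> prod_list (map (Lp k) (map (\<lambda>(a, b). a * b) ps))"
    by (rule Suc.IH) (simp add: ps(2))
  also have "\<dots> = prod_list (map (\<lambda>p. Lp k (fst p * snd p)) ps)"
    by (simp add: case_prod_unfold o_def)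
  also have "\<dots> \<le> prod_list (map (\<lambda>p. Lp (Suc k) (fst p) * Lp (Suc k) (snd p)) ps)"
    by (rule prod_list_mono_real) (simp add: pair)
  also have "\<dots> = prod_list (map (Lp (Suc k)) zs)"
    using prod_list_pairs[of "Lp (Suc k)" ps]
    by (simp add: ps(1) map_concat case_prod_unfold o_def)
  finally show ?case .
qed

lemma Hoelder_alternating:
  "cmod (\<tau> ((u * v) ^ 2 ^ k)) \<le> (Lp k u * Lp k v) ^ 2 ^ k"
  using Hoelder[of "concat (replicate (2 ^ k) [u, v])" k]
    prod_list_concat_replicate_pair[of "\<lambda>x. x" "2 ^ k" u v]
  by (simp add: length_concat_replicate_pair prod_list_concat_replicate_pair del: length_concat)

lemma Lp_mult: "Lp k (z * z') \<le> Lp (Suc k) z * Lp (Suc k) z'"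
  by (rule Lp_mult_of_Hoelder) (rule Hoelder)

lemma Lp_mono_Suc: "Lp k z \<le> Lp (Suc k) z"
  using Lp_mult[of k z 1] by simp

lemma cmod_tau_le_Lp: "cmod (\<tau> z) \<le> Lp k z"
proof (induction k)
  case 0
  then show ?case using Cauchy_Schwarz[of 1 z] by (simp add: Lp_0[symmetric])
next
  case (Suc k)
  then show ?case using Lp_mono_Suc order_trans by blast
qed

text \<open>Minkowski by multilinearity instead of duality: each of the \<open>2 ^ (k + 1)\<close>
  letters \<open>w\<close>, \<open>star w\<close> is replaced by its two summands, Hoelder bounds
  every resulting word, and the bounds add up to a power of \<open>N\<close>. In
  \<open>multi\<close>, \<open>pre\<close> holds the letters already expanded.\<close>

lemma Lp_triangle: "Lp k (u + v) \<le> Lp k u + Lp k v"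
proof -
  define N where "N = Lp k u + Lp k v"
  define w where "w = u + v"
  have multi: "cmod (\<tau> (prod_list pre * prod_list xs))
      \<le> prod_list (map (Lp k) pre) * N ^ length xs"
    if "length pre + length xs = 2 ^ Suc k" "set xs \<subseteq> {w, star w}" for pre xs
    using that
  proof (induction xs arbitrary: pre)
    case Nil
    then show ?case using Hoelder[of pre k] by simp
  next
    case (Cons a xs)
    then obtain u' v' where uv: "a = u' + v'" "Lp k u' = Lp k u" "Lp k v' = Lp k v"
      by (auto simp: w_def star_add)
    have "cmod (\<tau> (prod_list pre * prod_list (a # xs)))
        \<le> cmod (\<tau> (prod_list (pre @ [u']) * prod_list xs))
          + cmod (\<tau> (prod_list (pre @ [v']) * prod_list xs))"
      using norm_triangle_ineq by (simp add: uv(1) ring_distribs tau_add mult.assoc)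
    also have "\<dots> \<le> prod_list (map (Lp k) (pre @ [u'])) * N ^ length xs
        + prod_list (map (Lp k) (pre @ [v'])) * N ^ length xs"
      using Cons.prems by (intro add_mono Cons.IH) auto
    also have "\<dots> = prod_list (map (Lp k) pre) * N ^ length (a # xs)"
      by (simp add: uv N_def algebra_simps)
    finally show ?case .
  qed
  let ?l = "concat (replicate (2 ^ k) [star w, w])"
  have "Lp k w ^ 2 ^ Suc k = cmod (\<tau> (prod_list ?l))"
    using prod_list_concat_replicate_pair[of "\<lambda>x. x" "2 ^ k" "star w" w] by (simp add: Lp_pow_tau del: power_Suc)
  also have "\<dots> \<le> N ^ 2 ^ Suc k"
    using multi[of "[]" ?l]
    by (simp add: length_concat_replicate_pair del: length_concat)
  finally show ?thesis unfolding w_def N_def by (rule le_of_Lp_pow) simp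
qed

lemma Lp_sum_le: "Lp k (\<Sum>i\<in>I. f i) \<le> (\<Sum>i\<in>I. Lp k (f i))"
proof (induction I rule: infinite_finite_induct)
  case (insert i I)
  then show ?case using Lp_triangle[of k "f i" "sum f I"] by simp
qed simp_all

text \<open>Splits off one factor in \<open>L2\<close>. Where all higher norms are uniformly
  bounded, the second factor is bounded too, so \<open>L2\<close> convergence gives convergence at
  every level.\<close>

lemma Lp_interpolation:
  "Lp k z ^ 2 ^ Suc k \<le> L2 z * L2 (z * (star z * z) ^ (2 ^ k - 1))"
proof -
  have "(star z * z) ^ 2 ^ k = star z * (z * (star z * z) ^ (2 ^ k - 1))"
    by (simp add: power_eq_if[of _ "2 ^ k"] mult.assoc)
  then show ?thesis
    using Cauchy_Schwarz_star[of z "z * (star z * z) ^ (2 ^ k - 1)"]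
    by (simp add: Lp_pow_tau del: power_Suc)
qed

text \<open>Boundedness of left multiplication on \<open>L\<^sup>2\<close> replaces the operator norm, which the moments of a
  semicircular element do not control directly.\<close>

definition Lb :: "real \<Rightarrow> 'a \<Rightarrow> bool" where
  "Lb R h \<longleftrightarrow> 0 \<le> R \<and> (\<forall>c. L2 (h * c) \<le> R * L2 c)"

lemma LbD: "Lb R h \<Longrightarrow> L2 (h * c) \<le> R * L2 c" and Lb_nonneg: "Lb R h \<Longrightarrow> 0 \<le> R"
  by (auto simp: Lb_def)

lemma Lb_one: "Lb 1 1"
  by (simp add: Lb_def)

lemma Lb_mono: "Lb R h \<Longrightarrow> R \<le> R' \<Longrightarrow> Lb R' h"
  unfolding Lb_def by (meson L2_nonneg mult_right_mono order_trans)

lemma Lb_add: "Lb R h \<Longrightarrow> Lb R' h' \<Longrightarrow> Lb (R + R') (h + h')"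
  unfolding Lb_def
  by (auto simp: ring_distribs intro!: order_trans[OF L2_triangle] add_mono)

lemma Lb_mult: "Lb R h \<Longrightarrow> Lb R' h' \<Longrightarrow> Lb (R * R') (h * h')"
  unfolding Lb_def by (auto simp: mult.assoc) (meson mult_left_mono order_trans)

lemma Lb_scaleC: "Lb R h \<Longrightarrow> Lb (cmod c * R) (c *\<^sub>C h)"
  unfolding Lb_def by (auto simp: scaleC_mult_left L2_scaleC mult.assoc intro!: mult_left_mono)

lemma Lb_scaleR: "Lb R h \<Longrightarrow> Lb (\<bar>c\<bar> * R) (c *\<^sub>R h)"
  using Lb_scaleC[of R h "complex_of_real c"] by (simp add: scaleC_of_real)

text \<open>The adjoint has the same bound: the square of \<open>L2 (star h * c)\<close> is the
  pairing of \<open>c\<close> with \<open>h * (star h * c)\<close>, and one factor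
  \<open>L2 (star h * c)\<close> cancels.\<close>

lemma Lb_star: assumes "Lb R h" shows "Lb R (star h)"
proof -
  have "L2 (star h * c) \<le> R * L2 c" for c
  proof -
    have "(L2 (star h * c))\<^sup>2 = Re (\<tau> (star c * (h * (star h * c))))"
      by (simp add: L2_sq star_mult star_star mult.assoc)
    also have "\<dots> \<le> L2 c * L2 (h * (star h * c))"
      by (rule order_trans[OF complex_Re_le_cmod Cauchy_Schwarz_star])
    also have "\<dots> \<le> L2 c * (R * L2 (star h * c))"
      by (intro mult_left_mono LbD assms) simp
    finally have "L2 (star h * c) * L2 (star h * c) \<le> L2 (star h * c) * (R * L2 c)"
      by (simp add: power2_eq_square algebra_simps)
    moreover have "0 \<le> R * L2 c" using Lb_nonneg[OF assms] by simp
    ultimately show ?thesis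
      by (metis L2_nonneg linorder_not_le mult_le_cancel_left_pos order_le_less_trans order.strict_iff_order)
  qed
  then show ?thesis using assms by (simp add: Lb_def)
qed

text \<open>Squaring lowers the level: the norm of \<open>h * z\<close> at level
  \<open>k + 1\<close> is the root of the norm of \<open>S\<close> at level \<open>k\<close>. Under
  the trace, powers of \<open>S\<close> rotate into powers of \<open>A\<close>, where the bounded
  factor \<open>star h * h\<close> stands on the left and the induction hypothesis applies. As
  \<open>A\<close> need not be self-adjoint, the trace of its powers is estimated by
  Hoelder.\<close>

lemma Lp_Lb_left: "Lb R h \<Longrightarrow> Lp k (h * z) \<le> R * Lp k z"
proof (induction k arbitrary: h R z)
  case 0
  then show ?case by (simp add: Lp_0 LbD)
next
  case (Suc k)
  have R: "0 \<le> R" using Suc.prems by (rule Lb_nonneg)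
  define S where "S = star (h * z) * (h * z)"
  define A where "A = star h * h * (z * star z)"
  have dbl: "(c * c) ^ 2 ^ k = c ^ 2 ^ Suc k" for c :: 'a
    by (simp only: power_mult power_Suc power2_eq_square)
  have "star S * S = S * S" by (simp add: S_def star_mult star_star mult.assoc)
  then have "Lp k S ^ 2 ^ Suc k = cmod (\<tau> (S ^ 2 ^ Suc k))"
    unfolding Lp_pow_tau by (simp only: dbl)
  also have "\<tau> (S ^ 2 ^ Suc k) = \<tau> ((star h * h * z * star z) ^ 2 ^ Suc k)"
    unfolding S_def star_mult mult.assoc
    using tau_power_commute[of "star z" "star h * (h * z)" "2 ^ Suc k", unfolded mult.assoc] .
  also have "(star h * h * z * star z) ^ 2 ^ Suc k = (A * A) ^ 2 ^ k"
    unfolding dbl by (simp only: A_def mult.assoc)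
  also have "cmod (\<tau> \<dots>) \<le> (Lp k A * Lp k A) ^ 2 ^ k"
    by (rule Hoelder_alternating)
  also have "\<dots> \<le> ((R * R) * Lp k (z * star z) * ((R * R) * Lp k (z * star z))) ^ 2 ^ k"
  proof -
    have le: "Lp k A \<le> R * R * Lp k (z * star z)"
      unfolding A_def by (rule Suc.IH) (rule Lb_mult[OF Lb_star[OF Suc.prems] Suc.prems])
    then have "0 \<le> R * R * Lp k (z * star z)"
      by (rule order_trans[OF Lp_nonneg])
    then show ?thesis
      by (rule power_mono[OF mult_mono[OF le le _ Lp_nonneg]
          mult_nonneg_nonneg[OF Lp_nonneg Lp_nonneg]])
  qed
  also have "R * R * Lp k (z * star z) * (R * R * Lp k (z * star z))
      = (R * Lp (Suc k) z)\<^sup>2 * (R * Lp (Suc k) z)\<^sup>2"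
    by (simp add: Lp_mult_self_star power2_eq_square)
  also have "\<dots> ^ 2 ^ k = ((R * Lp (Suc k) z)\<^sup>2) ^ 2 ^ Suc k"
    by (simp only: power_mult power_Suc power2_eq_square[of "_ :: real"])
  finally have "Lp k S \<le> (R * Lp (Suc k) z)\<^sup>2"
    by (rule le_of_Lp_pow) simp
  then have "(Lp (Suc k) (h * z))\<^sup>2 \<le> (R * Lp (Suc k) z)\<^sup>2"
    unfolding S_def Lp_star_mult_self .
  then show ?case by (rule power2_le_imp_le) (simp add: R)
qed

lemma Lp_Lb_right: "Lb R h \<Longrightarrow> Lp k (z * h) \<le> R * Lp k z"
  using Lp_Lb_left[OF Lb_star, of R h k "star z"] Lp_star[of k "z * h"]
  by (simp add: star_mult)

lemma Lp_Lb: "Lb R h \<Longrightarrow> Lp k h \<le> R"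
  using Lp_Lb_left[of R h k 1] by simp

end

section \<open>Free independence\<close>

abbreviation alg :: "'a::cstar_algebra set \<Rightarrow> 'a set" where
  "alg S \<equiv> unital_star_subalgebra hull S"

lemma subalgebra_alg: "unital_star_subalgebra (alg S)"
  by (rule hull_in) (simp add: unital_star_subalgebra_def)

lemma unital_star_subalgebraI:
  assumes "1 \<in> B" "\<And>a b. a \<in> B \<Longrightarrow> b \<in> B \<Longrightarrow> a + b \<in> B"
    "\<And>a b. a \<in> B \<Longrightarrow> b \<in> B \<Longrightarrow> a * b \<in> B"
    "\<And>z a. a \<in> B \<Longrightarrow> z *\<^sub>C a \<in> B" "\<And>a. a \<in> B \<Longrightarrow> star a \<in> B"
  shows "unital_star_subalgebra B"
  using assms by (simp add: unital_star_subalgebra_def)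

lemma subalgebra_zero: "unital_star_subalgebra B \<Longrightarrow> 0 \<in> B"
  unfolding unital_star_subalgebra_def by (metis scaleC_zero_left)

lemma
  assumes "unital_star_subalgebra B"
  shows subalgebra_one: "1 \<in> B"
    and subalgebra_add: "a \<in> B \<Longrightarrow> b \<in> B \<Longrightarrow> a + b \<in> B"
    and subalgebra_mult: "a \<in> B \<Longrightarrow> b \<in> B \<Longrightarrow> a * b \<in> B"
    and subalgebra_scaleC: "a \<in> B \<Longrightarrow> z *\<^sub>C a \<in> B"
    and subalgebra_star: "a \<in> B \<Longrightarrow> star a \<in> B"
  using assms unfolding unital_star_subalgebra_def by simp_all

lemma subalgebra_scaleR:
  "unital_star_subalgebra B \<Longrightarrow> a \<in> B \<Longrightarrow> c *\<^sub>R a \<in> B"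
  by (metis scaleC_of_real subalgebra_scaleC)

lemma subalgebra_diff:
  "unital_star_subalgebra B \<Longrightarrow> a \<in> B \<Longrightarrow> b \<in> B \<Longrightarrow> a - b \<in> B"
  by (metis diff_conv_add_uminus scaleC_minus_one subalgebra_add subalgebra_scaleC)

lemma subalgebra_sum:
  "unital_star_subalgebra B \<Longrightarrow> (\<And>i. i \<in> I \<Longrightarrow> f i \<in> B) \<Longrightarrow> (\<Sum>i\<in>I. f i) \<in> B"
  by (induction I rule: infinite_finite_induct)
    (simp_all add: subalgebra_add subalgebra_zero)

lemma subalgebra_prod_list:
  "unital_star_subalgebra B \<Longrightarrow> set xs \<subseteq> B \<Longrightarrow> prod_list xs \<in> B"
  by (induction xs) (simp_all add: subalgebra_mult subalgebra_one)

lemma subalgebra_power: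
  "unital_star_subalgebra B \<Longrightarrow> a \<in> B \<Longrightarrow> a ^ n \<in> B"
  by (induction n) (simp_all add: subalgebra_mult subalgebra_one)

lemma alg_subset: "S \<subseteq> alg T \<Longrightarrow> alg S \<subseteq> alg T"
  by (rule hull_minimal) (simp_all add: subalgebra_alg)

text \<open>Lets the whole past of a process be replaced by finitely many times, for which a
  partition is available.\<close>

lemma alg_finitary:
  assumes "a \<in> alg S"
  obtains T where "finite T" "T \<subseteq> S" "a \<in> alg T"
proof -
  let ?B = "{a. \<exists>T. finite T \<and> T \<subseteq> S \<and> a \<in> alg T}"
  have up: "a \<in> alg (T \<union> T')" if "a \<in> alg T \<or> a \<in> alg T'" for a T T'
    using that hull_mono[of T "T \<union> T'" unital_star_subalgebra]
      hull_mono[of T' "T \<union> T'" unital_star_subalgebra] by blast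
  have closed: "\<exists>U. finite U \<and> U \<subseteq> S \<and> c \<in> alg U"
    if "a \<in> ?B" "b \<in> ?B" "\<And>B. unital_star_subalgebra B \<Longrightarrow> a \<in> B \<Longrightarrow> b \<in> B \<Longrightarrow> c \<in> B" for a b c
  proof -
    from that(1,2) obtain T T' where T: "finite T" "T \<subseteq> S" "a \<in> alg T" "finite T'" "T' \<subseteq> S" "b \<in> alg T'"
      by blast
    have "c \<in> alg (T \<union> T')"
      by (rule that(3)[OF subalgebra_alg up up]) (simp_all add: T)
    then show ?thesis using T by blast
  qed
  have "unital_star_subalgebra ?B"
  proof (rule unital_star_subalgebraI)
    have "1 \<in> alg {}" by (intro subalgebra_one subalgebra_alg)
    then show "1 \<in> ?B" by blast
  next
    fix a b z assume a: "a \<in> ?B"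
    then show "star a \<in> ?B"
      using closed[OF a a subalgebra_star] by simp
    show "z *\<^sub>C a \<in> ?B"
      using closed[OF a a subalgebra_scaleC] by simp
    assume b: "b \<in> ?B"
    show "a + b \<in> ?B"
      using closed[OF a b subalgebra_add] by simp
    show "a * b \<in> ?B"
      using closed[OF a b subalgebra_mult] by simp
  qed
  moreover have "S \<subseteq> ?B"
  proof
    fix a assume "a \<in> S"
    then have "finite {a}" "{a} \<subseteq> S" "a \<in> alg {a}" by (simp_all add: hull_inc)
    then show "a \<in> ?B" by blast
  qed
  ultimately have "alg S \<subseteq> ?B" by (rule hull_minimal[rotated])
  then have "a \<in> ?B" using assms by (rule subsetD)
  then show thesis using that by blast
qed

inductive_set cspan :: "'a::cstar_algebra set \<Rightarrow> 'a set" for S where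
  cspan_zero: "0 \<in> cspan S"
| cspan_base: "a \<in> S \<Longrightarrow> a \<in> cspan S"
| cspan_add: "a \<in> cspan S \<Longrightarrow> b \<in> cspan S \<Longrightarrow> a + b \<in> cspan S"
| cspan_scaleC: "a \<in> cspan S \<Longrightarrow> z *\<^sub>C a \<in> cspan S"

lemma distinct_adj_concatD: "distinct_adj (concat xss) \<Longrightarrow> xs \<in> set xss \<Longrightarrow> distinct_adj xs"
  by (induction xss) (auto simp: distinct_adj_append_iff)

text \<open>Allows a word over a fine index set to be read as an alternating word over classes of
  indices, the runs becoming its letters.\<close>

lemma group_runs:
  fixes f :: "'b \<Rightarrow> 'c"
  obtains xss where "concat xss = xs" "\<And>ys. ys \<in> set xss \<Longrightarrow> ys \<noteq> []"
    "\<And>ys y. ys \<in> set xss \<Longrightarrow> y \<in> set ys \<Longrightarrow> f y = f (hd ys)"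
    "distinct_adj (map (\<lambda>ys. f (hd ys)) xss)"
proof -
  define const where "const ys \<longleftrightarrow> ys \<noteq> [] \<and> (\<forall>y\<in>set ys. f y = f (hd ys))" for ys
  have const_Cons: "const (x # ys)" if "const ys" "f x = f (hd ys)" for x ys
    using that unfolding const_def by (metis list.sel(1) list.distinct(1) set_ConsD)
  have "\<exists>xss. concat xss = xs \<and> (\<forall>ys\<in>set xss. const ys)
      \<and> distinct_adj (map (\<lambda>ys. f (hd ys)) xss)"
  proof (induction xs)
    case Nil
    show ?case by (rule exI[of _ "[]"]) simp
  next
    case (Cons x xs)
    then obtain xss where xss: "concat xss = xs" "\<forall>ys\<in>set xss. const ys"
      "distinct_adj (map (\<lambda>ys. f (hd ys)) xss)" by blast
    have single: "const [x]" by (simp add: const_def)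
    show ?case
    proof (cases xss)
      case Nil
      then show ?thesis using xss single by (intro exI[of _ "[[x]]"]) simp
    next
      case (Cons zs zss)
      show ?thesis
      proof (cases "f x = f (hd zs)")
        case True
        have "const (x # zs)" using xss(2) Cons True by (intro const_Cons) simp_all
        moreover have "distinct_adj (f x # map (\<lambda>ys. f (hd ys)) zss)"
          using xss(3) unfolding Cons True by simp
        ultimately show ?thesis using xss(1,2) Cons
          by (intro exI[of _ "(x # zs) # zss"]) simp
      next
        case False
        then show ?thesis using xss Cons single
          by (intro exI[of _ "[x] # zs # zss"]) simp
      qed
    qed
  qed
  then obtain xss where xss: "concat xss = xs" "\<forall>ys\<in>set xss. const ys"
    "distinct_adj (map (\<lambda>ys. f (hd ys)) xss)" by blast
  show thesis
  proof (rule that[OF xss(1) _ _ xss(3)])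
    fix ys assume "ys \<in> set xss"
    then have "const ys" using xss(2) by blast
    then show "ys \<noteq> []" "y \<in> set ys \<Longrightarrow> f y = f (hd ys)" for y
      unfolding const_def by blast+
  qed
qed

lemma prod_list_concat: "prod_list (concat xss) = prod_list (map prod_list xss)"
  for xss :: "'b::monoid_mult list list"
  by (induction xss) auto

section \<open>Centred words and the associativity of free independence\<close>

context tracial_state
begin

text \<open>Index and letter travel together in one list, so that words can be cut, joined and
  regrouped by ordinary list operations.\<close>

definition centred_word :: "'i set \<Rightarrow> ('i \<Rightarrow> 'a set) \<Rightarrow> ('i \<times> 'a) list \<Rightarrow> bool" where
  "centred_word I S w \<longleftrightarrow> distinct_adj (map fst w) \<and>
     (\<forall>p\<in>set w. fst p \<in> I \<and> snd p \<in> alg (S (fst p)) \<and> \<tau> (snd p) = 0)"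

abbreviation wprod :: "('i \<times> 'a) list \<Rightarrow> 'a" where
  "wprod w \<equiv> prod_list (map snd w)"

lemma freely_independent_iff:
  "freely_independent \<tau> I S \<longleftrightarrow> (\<forall>w. w \<noteq> [] \<and> centred_word I S w \<longrightarrow> \<tau> (wprod w) = 0)"
proof
  assume free: "freely_independent \<tau> I S"
  show "\<forall>w. w \<noteq> [] \<and> centred_word I S w \<longrightarrow> \<tau> (wprod w) = 0"
  proof (intro allI impI)
    fix w assume w: "w \<noteq> [] \<and> centred_word I S w"
    then have "list_all2 (\<lambda>i a. i \<in> I \<and> a \<in> alg (S i) \<and> \<tau> a = 0) (map fst w) (map snd w)"
      unfolding centred_word_def by (auto simp: list_all2_conv_all_nth)
    then show "\<tau> (wprod w) = 0"
      using free w by (auto simp: freely_independent_def centred_word_def)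
  qed
next
  assume *: "\<forall>w. w \<noteq> [] \<and> centred_word I S w \<longrightarrow> \<tau> (wprod w) = 0"
  show "freely_independent \<tau> I S"
    unfolding freely_independent_def
  proof (intro allI impI)
    fix "is" as
    assume a: "is \<noteq> [] \<and> distinct_adj is \<and> list_all2 (\<lambda>i a. i \<in> I \<and> a \<in> alg (S i) \<and> \<tau> a = 0) is as"
    then have len: "length is = length as" by (auto dest: list_all2_lengthD)
    have "centred_word I S (zip is as)"
      using a len unfolding centred_word_def
      by (auto simp: list_all2_conv_all_nth set_zip)
    moreover have "zip is as \<noteq> []" using a len by (cases "is"; cases as) auto
    ultimately show "\<tau> (prod_list as) = 0"
      using * len by (metis map_snd_zip)
  qed
qed

lemma centred_word_append:
  "centred_word I S (u @ v) \<longleftrightarrow> centred_word I S u \<and> centred_word I S v \<and>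
     (u = [] \<or> v = [] \<or> fst (last u) \<noteq> fst (hd v))"
  by (auto simp: centred_word_def distinct_adj_append_iff last_map hd_map)

lemma centred_word_Nil [simp]: "centred_word I S []"
  by (simp add: centred_word_def)

lemma freely_independent_reindex:
  assumes "freely_independent \<tau> J T" "inj_on g I" "g ` I \<subseteq> J"
    "\<And>i. i \<in> I \<Longrightarrow> S i \<subseteq> alg (T (g i))"
  shows "freely_independent \<tau> I S"
  unfolding freely_independent_iff
proof (intro allI impI)
  fix w assume w: "w \<noteq> [] \<and> centred_word I S w"
  let ?w = "map (\<lambda>p. (g (fst p), snd p)) w"
  have "distinct_adj (map g (map fst w))"
    by (rule distinct_adj_mapI)
      (use w assms(2) in \<open>auto simp: centred_word_def intro: inj_on_subset\<close>)
  moreover have "snd p \<in> alg (T (g (fst p)))" if "p \<in> set w" for p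
    using w that alg_subset[OF assms(4)] by (auto simp: centred_word_def)
  moreover have "g (fst p) \<in> J" if "p \<in> set w" for p
    using w that assms(3) by (auto simp: centred_word_def)
  ultimately have "centred_word J T ?w"
    using w by (auto simp: centred_word_def o_def)
  then show "\<tau> (wprod w) = 0"
    using assms(1) w by (auto simp: freely_independent_iff o_def dest!: spec[of _ ?w])
qed

text \<open>Freeness tests one finite word at a time, and each letter of it needs only finitely many
  generators.\<close>

lemma freely_independent_finitary:
  assumes "\<And>T. (\<And>i. finite (T i) \<and> T i \<subseteq> S i) \<Longrightarrow> freely_independent \<tau> I T"
  shows "freely_independent \<tau> I S"
  unfolding freely_independent_iff
proof (intro allI impI)
  fix w assume w: "w \<noteq> [] \<and> centred_word I S w"
  then have "\<forall>p\<in>set w. \<exists>T. finite T \<and> T \<subseteq> S (fst p) \<and> snd p \<in> alg T"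
    unfolding centred_word_def by (meson alg_finitary)
  then obtain T where T: "\<And>p. p \<in> set w \<Longrightarrow> finite (T p) \<and> T p \<subseteq> S (fst p) \<and> snd p \<in> alg (T p)"
    by metis
  define T' where "T' = (\<lambda>i. \<Union>p\<in>{p\<in>set w. fst p = i}. T p)"
  have "T p \<subseteq> T' (fst p)" if "p \<in> set w" for p
    using that by (auto simp: T'_def)
  then have "centred_word I T' w"
    using w T by (auto simp: centred_word_def) (metis hull_mono subsetD snd_conv fst_conv)
  moreover have "freely_independent \<tau> I T'"
    by (rule assms) (use T in \<open>auto simp: T'_def\<close>)
  ultimately show "\<tau> (wprod w) = 0"
    using w by (auto simp: freely_independent_iff)
qed

text \<open>Only the junction can fail to alternate. There the product of the two letters is a
  centred letter plus a scalar; the scalar deletes both letters and leaves a product of shorter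
  words.\<close>

lemma wprod_mult_in_cspan:
  assumes "centred_word I S u" "centred_word I S v"
  shows "wprod u * wprod v \<in> cspan {wprod w | w. centred_word I S w}"
  using assms
proof (induction v arbitrary: u)
  case Nil
  then show ?case by (auto intro: cspan_base)
next
  case (Cons q v)
  show ?case
  proof (cases u rule: rev_cases)
    case Nil
    then show ?thesis using Cons.prems
      by (intro cspan_base CollectI exI[of _ "q # v"]) simp
  next
    case (snoc u' p)
    have cw: "centred_word I S (u' @ [p])" "centred_word I S ([q] @ v)"
      using Cons.prems snoc by auto
    show ?thesis
    proof (cases "fst p = fst q")
      case False
      then have "centred_word I S (u @ q # v)"
        using Cons.prems snoc by (subst centred_word_append) auto
      then show ?thesis
        by (intro cspan_base CollectI exI[of _ "u @ q # v"]) simp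
    next
      case True
      define c where "c = snd p * snd q - \<tau> (snd p * snd q) *\<^sub>C 1"
      have "snd p \<in> alg (S (fst p))" "snd q \<in> alg (S (fst p))" "fst p \<in> I"
        using cw True by (auto simp: centred_word_def)
      then have "c \<in> alg (S (fst p))"
        unfolding c_def
        by (intro subalgebra_diff subalgebra_mult subalgebra_scaleC subalgebra_one)
          (auto intro: subalgebra_alg)
      moreover have "\<tau> c = 0" by (simp add: c_def tau_diff tau_scaleC tau_one)
      ultimately have "centred_word I S (u' @ (fst p, c) # v)"
        using cw True \<open>fst p \<in> I\<close>
        by (auto simp: centred_word_def distinct_adj_append_iff distinct_adj_Cons hd_map)
      then have 1: "wprod (u' @ (fst p, c) # v) \<in> cspan {wprod w | w. centred_word I S w}"
        by (blast intro: cspan_base)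
      have 2: "wprod u' * wprod v \<in> cspan {wprod w | w. centred_word I S w}"
        using cw(1) cw(2) unfolding centred_word_append by (intro Cons.IH) blast+
      have "wprod u * wprod (q # v)
          = wprod (u' @ (fst p, c) # v) + \<tau> (snd p * snd q) *\<^sub>C (wprod u' * wprod v)"
        by (simp add: snoc c_def algebra_simps scaleC_mult_left scaleC_mult_right)
      then show ?thesis using 1 2 by (auto intro: cspan_add cspan_scaleC)
    qed
  qed
qed

lemma star_wprod: "star (wprod w) = wprod (rev (map (\<lambda>p. (fst p, star (snd p))) w))"
  by (induction w) (auto simp: star_mult)

lemma centred_word_star:
  assumes "centred_word I S w"
  shows "centred_word I S (rev (map (\<lambda>p. (fst p, star (snd p))) w))"
  using assms
  by (auto simp: centred_word_def o_def rev_map[symmetric] tau_star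
      intro: subalgebra_star subalgebra_alg)

text \<open>The empty word supplies the scalars; closure under products is the preceding reduction
  at the junction.\<close>

lemma alg_Union_subset_cspan:
  "alg (\<Union>i\<in>I. S i) \<subseteq> cspan {wprod w | w. centred_word I S w}" (is "_ \<subseteq> cspan ?W")
proof (rule hull_minimal)
  show "(\<Union>i\<in>I. S i) \<subseteq> cspan ?W"
  proof
    fix a assume "a \<in> (\<Union>i\<in>I. S i)"
    then obtain i where i: "i \<in> I" "a \<in> S i" by blast
    define c where "c = a - \<tau> a *\<^sub>C 1"
    have "c \<in> alg (S i)"
      unfolding c_def using i
      by (intro subalgebra_diff subalgebra_scaleC subalgebra_one)
        (auto intro: subalgebra_alg hull_inc)
    then have "centred_word I S [(i, c)]"
      using i by (simp add: centred_word_def c_def tau_diff tau_scaleC tau_one)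
    then have "wprod [(i, c)] \<in> ?W" by blast
    moreover have "wprod [] \<in> ?W" by (intro CollectI exI[of _ "[]"]) simp
    ultimately have "wprod [(i, c)] + \<tau> a *\<^sub>C wprod [] \<in> cspan ?W"
      by (blast intro: cspan_base cspan_add cspan_scaleC)
    then show "a \<in> cspan ?W" by (simp add: c_def)
  qed
  show "unital_star_subalgebra (cspan ?W)"
  proof (rule unital_star_subalgebraI)
    have "wprod [] \<in> ?W" by (intro CollectI exI[of _ "[]"]) simp
    then have "wprod [] \<in> cspan ?W" by (rule cspan_base)
    then show "1 \<in> cspan ?W" by simp
    show "a + b \<in> cspan ?W" if "a \<in> cspan ?W" "b \<in> cspan ?W" for a b
      using that by (rule cspan_add)
    show "z *\<^sub>C a \<in> cspan ?W" if "a \<in> cspan ?W" for a z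
      using that by (rule cspan_scaleC)
    show "star a \<in> cspan ?W" if "a \<in> cspan ?W" for a
      using that
    proof induction
      case (cspan_base a)
      then show ?case
        using star_wprod centred_word_star by (blast intro: cspan.cspan_base)
    qed (auto simp: star_add star_scaleC intro: cspan.intros)
    show "a * b \<in> cspan ?W" if "a \<in> cspan ?W" "b \<in> cspan ?W" for a b
      using that(1)
    proof induction
      case (cspan_base a)
      then obtain u where u: "a = wprod u" "centred_word I S u" by blast
      show ?case using that(2)
      proof induction
        case (cspan_base b)
        then show ?case using u wprod_mult_in_cspan by blast
      qed (auto simp: ring_distribs scaleC_mult_right intro: cspan.intros)
    qed (auto simp: ring_distribs scaleC_mult_left intro: cspan.intros)
  qed
qed

text \<open>By freeness the trace of a combination of centred words is the coefficient of the empty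
  word, so a centred element needs no scalar term.\<close>

lemma centred_in_cspan:
  assumes free: "freely_independent \<tau> I S" and a: "a \<in> alg (\<Union>i\<in>I. S i)" "\<tau> a = 0"
  shows "a \<in> cspan {wprod w | w. centred_word I S w \<and> w \<noteq> []}" (is "_ \<in> cspan ?W")
proof -
  have zero: "\<tau> c = 0" if "c \<in> cspan ?W" for c
    using that
    by induction (use free in \<open>auto simp: tau_add tau_scaleC freely_independent_iff\<close>)
  have "a \<in> cspan {wprod w | w. centred_word I S w}"
    using a(1) alg_Union_subset_cspan by blast
  then have "\<exists>z c. a = z *\<^sub>C 1 + c \<and> c \<in> cspan ?W"
  proof induction
    case cspan_zero
    show ?case by (intro exI[of _ 0]) (simp add: cspan.cspan_zero)
  next
    case (cspan_base a)
    then obtain w where w: "a = wprod w" "centred_word I S w" by blast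
    show ?case
    proof (cases "w = []")
      case True
      then show ?thesis using w by (intro exI[of _ 1] exI[of _ 0]) (simp add: cspan.cspan_zero)
    next
      case False
      then show ?thesis using w
        by (intro exI[of _ 0] exI[of _ a]) (auto intro: cspan.cspan_base)
    qed
  next
    case (cspan_add a b)
    then obtain z c z' c' where "a = z *\<^sub>C 1 + c" "c \<in> cspan ?W" "b = z' *\<^sub>C 1 + c'" "c' \<in> cspan ?W"
      by blast
    then show ?case
      by (intro exI[of _ "z + z'"] exI[of _ "c + c'"])
        (auto simp: scaleC_add_left intro: cspan.cspan_add)
  next
    case (cspan_scaleC a u)
    then obtain z c where "a = z *\<^sub>C 1 + c" "c \<in> cspan ?W" by blast
    then show ?case
      by (intro exI[of _ "u * z"] exI[of _ "u *\<^sub>C c"])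
        (auto simp: scaleC_add_right scaleC_scaleC intro: cspan.cspan_scaleC)
  qed
  then obtain z c where zc: "a = z *\<^sub>C 1 + c" "c \<in> cspan ?W" by blast
  then have "z = 0" using a(2) zero by (simp add: tau_add tau_scaleC tau_one)
  then show ?thesis using zc by simp
qed

text \<open>A centred letter of a merged family is a combination of nonempty centred words inside
  that family. Replacing all letters in this way keeps indices alternating, because neighbouring
  letters come from different families.\<close>

lemma freely_independent_merge:
  assumes free: "freely_independent \<tau> I S"
  shows "freely_independent \<tau> K (\<lambda>k. \<Union>i\<in>{i\<in>I. \<pi> i = k}. S i)" (is "freely_independent \<tau> K ?T")
proof -
  have sub: "freely_independent \<tau> {i\<in>I. \<pi> i = k} S" for k
    by (rule freely_independent_reindex[OF free, of "\<lambda>i. i"]) (auto intro: hull_inc)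
  \<comment> \<open>The prefix \<open>u\<close> is already expanded into the original families and
    \<open>w\<close> still consists of merged letters. The condition at the junction is on
    \<open>\<pi>\<close>, which is stronger than different indices.\<close>
  have "\<tau> (wprod u * wprod w) = 0"
    if "centred_word I S u" "centred_word K ?T w" "u \<noteq> [] \<or> w \<noteq> []"
      "u = [] \<or> w = [] \<or> \<pi> (fst (last u)) \<noteq> fst (hd w)" for u w
    using that
  proof (induction w arbitrary: u)
    case Nil
    then show ?case using free by (simp add: freely_independent_iff)
  next
    case (Cons q w)
    obtain k c where q: "q = (k, c)" by (cases q)
    have c: "c \<in> alg (?T k)" "\<tau> c = 0" and w: "centred_word K ?T w" "w = [] \<or> k \<noteq> fst (hd w)"
      using Cons.prems(2) by (auto simp: q centred_word_def distinct_adj_Cons hd_map)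
    have "\<tau> (wprod u * (c' * wprod w)) = 0"
      if "c' \<in> cspan {wprod v | v. centred_word {i\<in>I. \<pi> i = k} S v \<and> v \<noteq> []}" for c'
      using that
    proof induction
      case (cspan_base c')
      then obtain v where v: "c' = wprod v" "centred_word {i\<in>I. \<pi> i = k} S v" "v \<noteq> []" by blast
      then have vk: "\<pi> (fst p) = k" if "p \<in> set v" for p
        using that by (auto simp: centred_word_def)
      have "centred_word I S v" using v by (auto simp: centred_word_def)
      moreover have "u = [] \<or> fst (last u) \<noteq> fst (hd v)"
        using Cons.prems(4) vk[of "hd v"] v(3) by (auto simp: q)
      ultimately have "centred_word I S (u @ v)"
        using Cons.prems(1) unfolding centred_word_append by blast
      then have "\<tau> (wprod (u @ v) * wprod w) = 0"
        using w v(3) vk[of "last v"] by (intro Cons.IH) auto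
      then show ?case by (simp add: v(1) mult.assoc)
    qed (simp_all add: ring_distribs tau_add scaleC_mult_left scaleC_mult_right tau_scaleC)
    then show ?case using centred_in_cspan[OF sub c] by (simp add: q)
  qed
  from this[of "[]"] show ?thesis by (auto simp: freely_independent_iff)
qed

text \<open>The word is cut into runs of constant \<open>\<pi>\<close>. Freeness inside one class
  makes each run centred, and then the runs form an alternating centred word for the outer
  families.\<close>

lemma freely_independent_nested:
  assumes outer: "freely_independent \<tau> K T"
    and inner: "\<And>k. k \<in> K \<Longrightarrow> freely_independent \<tau> {i\<in>I. \<pi> i = k} S"
    and sub: "\<And>i. i \<in> I \<Longrightarrow> \<pi> i \<in> K \<and> S i \<subseteq> alg (T (\<pi> i))"
  shows "freely_independent \<tau> I S"
  unfolding freely_independent_iff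
proof (intro allI impI)
  fix w assume w: "w \<noteq> [] \<and> centred_word I S w"
  obtain ws where ws: "concat ws = w" "\<And>v. v \<in> set ws \<Longrightarrow> v \<noteq> []"
    "\<And>v p. v \<in> set ws \<Longrightarrow> p \<in> set v \<Longrightarrow> \<pi> (fst p) = \<pi> (fst (hd v))"
    "distinct_adj (map (\<lambda>v. \<pi> (fst (hd v))) ws)"
    using group_runs[of w "\<lambda>p. \<pi> (fst p)"] by blast
  have run: "\<pi> (fst (hd v)) \<in> K \<and> wprod v \<in> alg (T (\<pi> (fst (hd v)))) \<and> \<tau> (wprod v) = 0"
    if v: "v \<in> set ws" for v
  proof -
    have vw: "set v \<subseteq> set w" using ws(1) v by auto
    have "distinct_adj (map fst v)"
      using w v ws(1) distinct_adj_concatD[of "map (map fst) ws" "map fst v"]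
      by (auto simp: centred_word_def map_concat[symmetric])
    then have "centred_word {i\<in>I. \<pi> i = \<pi> (fst (hd v))} S v"
      using w vw ws(3)[OF v] by (auto simp: centred_word_def)
    moreover have K: "\<pi> (fst (hd v)) \<in> K"
    proof -
      have "hd v \<in> set w" using vw ws(2)[OF v] by auto
      then show ?thesis using w sub by (auto simp: centred_word_def)
    qed
    ultimately have "\<tau> (wprod v) = 0"
      using inner ws(2)[OF v] by (auto simp: freely_independent_iff)
    moreover have "snd p \<in> alg (T (\<pi> (fst (hd v))))" if "p \<in> set v" for p
    proof -
      have "snd p \<in> alg (S (fst p))" "fst p \<in> I" using w vw that by (auto simp: centred_word_def)
      then show ?thesis using alg_subset sub ws(3)[OF v that] by (metis subsetD)
    qed
    then have "wprod v \<in> alg (T (\<pi> (fst (hd v))))"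
      by (intro subalgebra_prod_list subalgebra_alg) auto
    ultimately show ?thesis using K by blast
  qed
  let ?w = "map (\<lambda>v. (\<pi> (fst (hd v)), wprod v)) ws"
  have "centred_word K T ?w"
    using run ws(4) by (auto simp: centred_word_def o_def)
  moreover have "?w \<noteq> []" using w ws(1) by auto
  ultimately have "\<tau> (wprod ?w) = 0" using outer unfolding freely_independent_iff by blast
  also have "wprod ?w = wprod w"
    by (simp add: ws(1)[symmetric] map_concat prod_list_concat o_def)
  finally show "\<tau> (wprod w) = 0" .
qed

end

section \<open>Mixed moments, and freeness of increments from the past\<close>

context tracial_state
begin

text \<open>Both formulas come from expanding the vanishing trace of a word with centred letters. In
  the second one \<open>b\<close> and \<open>b'\<close> are centred already, so only
  \<open>a\<close> and \<open>a'\<close> have to be centred, and cyclic rotation reduces the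
  correction terms to the first formula.\<close>

lemma
  assumes free: "freely_independent \<tau> (UNIV :: bool set) (\<lambda>k. if k then S else T)"
    and a: "a \<in> alg S" "a' \<in> alg S" and b: "b \<in> alg T" "b' \<in> alg T"
  shows free_tau_mult: "\<tau> (a * b) = \<tau> a * \<tau> b"
    and free_tau_alternating:
      "\<tau> b = 0 \<Longrightarrow> \<tau> b' = 0 \<Longrightarrow> \<tau> (a * b * a' * b') = \<tau> a * \<tau> a' * \<tau> (b * b')"
proof -
  have word: "\<tau> (prod_list (map snd w)) = 0"
    if "w \<noteq> []" "distinct_adj (map fst w)"
      "\<forall>p\<in>set w. snd p \<in> alg (if fst p then S else T) \<and> \<tau> (snd p) = 0" for w
    using free that unfolding freely_independent_iff centred_word_def by blast
  have c: "c - \<tau> c *\<^sub>C 1 \<in> alg U" "\<tau> (c - \<tau> c *\<^sub>C 1) = 0" if "c \<in> alg U" for c U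
  proof -
    show "c - \<tau> c *\<^sub>C 1 \<in> alg U"
      using that by (intro subalgebra_diff subalgebra_scaleC subalgebra_one subalgebra_alg)
    show "\<tau> (c - \<tau> c *\<^sub>C 1) = 0" by (simp add: tau_diff tau_scaleC tau_one)
  qed
  have mult: "\<tau> (a * b) = \<tau> a * \<tau> b" if "a \<in> alg S" "b \<in> alg T" for a b
    using word[of "[(True, a - \<tau> a *\<^sub>C 1), (False, b - \<tau> b *\<^sub>C 1)]"] c[OF that(1)] c[OF that(2)]
    by (simp add: algebra_simps tau_add tau_diff scaleC_mult_left scaleC_mult_right tau_scaleC
        tau_one scaleC_diff_right scaleC_scaleC)
  then show "\<tau> (a * b) = \<tau> a * \<tau> b" using a b by blast
  show "\<tau> (a * b * a' * b') = \<tau> a * \<tau> a' * \<tau> (b * b')" if b0: "\<tau> b = 0" "\<tau> b' = 0"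
  proof -
    have bb: "b * b' \<in> alg T" using b by (intro subalgebra_mult subalgebra_alg)
    have "\<tau> ((a - \<tau> a *\<^sub>C 1) * b * (a' - \<tau> a' *\<^sub>C 1) * b') = 0"
      using word[of "[(True, a - \<tau> a *\<^sub>C 1), (False, b), (True, a' - \<tau> a' *\<^sub>C 1), (False, b')]"]
        c[OF a(1)] c[OF a(2)] b b0 by (simp add: mult.assoc)
    moreover have "\<tau> (b * a' * b') = \<tau> a' * \<tau> (b * b')"
    proof -
      have "\<tau> (b * a' * b') = \<tau> (a' * (b' * b))"
        using tau_commute[of b "a' * b'"] by (simp add: mult.assoc)
      also have "\<dots> = \<tau> a' * \<tau> (b' * b)"
        using a b by (intro mult subalgebra_mult subalgebra_alg)
      finally show ?thesis by (simp add: tau_commute)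
    qed
    moreover have "\<tau> (a * b * b') = \<tau> a * \<tau> (b * b')"
      using mult[OF a(1) bb] by (simp add: mult.assoc)
    ultimately show ?thesis
      by (simp add: algebra_simps tau_diff tau_add scaleC_mult_left scaleC_mult_right tau_scaleC
          scaleC_diff_right scaleC_scaleC)
  qed
qed

text \<open>Finitely many past times are completed to a partition that ends with the step from
  \<open>u\<close> to \<open>u'\<close>. Its increments are free by definition of the process;
  merging all but the last gives the claim, since values at past times are telescoping sums of
  earlier increments.\<close>

lemma past_free_increment:
  assumes bm: "free_brownian_motion \<tau> x" and u: "0 \<le> u" "u < u'"
  shows "freely_independent \<tau> (UNIV :: bool set) (\<lambda>k. if k then x ` {0..u} else {x u' - x u})"
proof (rule freely_independent_finitary)
  fix T :: "bool \<Rightarrow> 'a set"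
  assume T: "\<And>i. finite (T i) \<and> T i \<subseteq> (if i then x ` {0..u} else {x u' - x u})"
  obtain V where V: "finite V" "V \<subseteq> {0..u}" "T True = x ` V"
    using T[of True] by (auto simp: finite_subset_image dest: finite_subset_image)
  \<comment> \<open>Adding 0 lets every telescoping sum start from \<open>x 0 = 0\<close>; adding
    \<open>u\<close> makes the last increment exactly \<open>x u' - x u\<close>.\<close>
  define W where "W = insert 0 (insert u V)"
  define L where "L = sorted_list_of_set W"
  define m where "m = length L"
  define p where "p i = (if i < m then L ! i else u')" for i
  have setL: "set L = insert 0 (insert u V)" and sL: "sorted L" "distinct L"
    using V(1) sorted_list_of_set[of W] unfolding L_def W_def by auto
  have m: "0 < m" using setL by (auto simp: m_def)
  have le: "L ! i \<le> u" "0 \<le> L ! i" if "i < m" for i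
  proof -
    have "L ! i \<in> insert 0 (insert u V)" using that nth_mem setL by (metis m_def)
    then show "L ! i \<le> u" "0 \<le> L ! i" using u V(2) by auto
  qed
  have L0: "L ! 0 = 0"
  proof -
    obtain j where "j < m" "L ! j = 0" using setL by (metis in_set_conv_nth insertI1 m_def)
    then have "L ! 0 \<le> 0" using sL sorted_nth_mono by (metis m_def zero_le)
    then show ?thesis using le(2)[OF m] by simp
  qed
  have Lm: "L ! (m - 1) = u"
  proof -
    obtain j where "j < m" "L ! j = u" using setL by (metis in_set_conv_nth insertI1 insertI2 m_def)
    then have "u \<le> L ! (m - 1)" using sorted_nth_mono[OF sL(1), of j "m - 1"] m by (simp add: m_def)
    then show ?thesis using le(1)[of "m - 1"] m by simp
  qed
  have part: "is_partition 0 u' m p"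
    unfolding is_partition_def
  proof (intro conjI allI impI)
    show "p 0 = 0" using m L0 by (simp add: p_def)
    show "p m = u'" by (simp add: p_def)
    fix i assume i: "i < m"
    show "p i < p (Suc i)"
    proof (cases "Suc i < m")
      case True
      then show ?thesis using sL by (simp add: p_def m_def sorted_wrt_nth_less strict_sorted_iff)
    next
      case False
      then show ?thesis using i le(1)[OF i] u by (simp add: p_def)
    qed
  qed
  let ?D = "\<lambda>i. {x (p (Suc i)) - x (p i)}"
  let ?T = "\<lambda>k. \<Union>i\<in>{i\<in>{..<m}. (i < m - 1) = k}. ?D i"
  have "freely_independent \<tau> {..<m} ?D"
    using bm part unfolding free_brownian_motion_def by blast
  then have merged: "freely_independent \<tau> UNIV ?T" by (rule freely_independent_merge)
  have "T k \<subseteq> alg (?T k)" for k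
  proof (cases k)
    case True
    have "x v \<in> alg (?T True)" if v: "v \<in> V" for v
    proof -
      obtain j where j: "j < m" "L ! j = v" using v setL by (metis in_set_conv_nth insertI2 m_def)
      have "x (p j) - x (p 0) = (\<Sum>i<j. x (p (Suc i)) - x (p i))"
        by (rule sum_lessThan_telescope[symmetric])
      moreover have "x (p 0) = 0" "p j = v"
        using bm j m L0 by (auto simp: p_def free_brownian_motion_def)
      moreover have "(\<Sum>i<j. x (p (Suc i)) - x (p i)) \<in> alg (?T True)"
      proof (intro subalgebra_sum[OF subalgebra_alg] hull_inc)
        fix i assume "i \<in> {..<j}"
        then have "i \<in> {i\<in>{..<m}. (i < m - 1) = True}" using j(1) by auto
        then show "x (p (Suc i)) - x (p i) \<in> ?T True" by blast
      qed
      ultimately show ?thesis by simp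
    qed
    then show ?thesis using True V(3) by auto
  next
    case False
    have "x u' - x u \<in> ?T False"
      using m Lm by (auto simp: p_def intro!: bexI[of _ "m - 1"])
    then show ?thesis using False T[of False] by (auto intro: hull_inc)
  qed
  then show "freely_independent \<tau> UNIV T"
    by (intro freely_independent_reindex[OF merged, where g = "\<lambda>k. k"]) simp_all
qed

text \<open>The past and the increment of each of \<open>x\<close>, \<open>y\<close> are four jointly free families, which are then
  merged in pairs in the other direction.\<close>

lemma past_free_increments:
  assumes bm: "free_brownian_motion \<tau> x" "free_brownian_motion \<tau> y"
    and xy: "freely_independent \<tau> (UNIV :: bool set) (\<lambda>i. if i then x ` {0..} else y ` {0..})"
    and u: "0 \<le> u" "u < u'"
  shows "freely_independent \<tau> (UNIV :: bool set)
    (\<lambda>k. if k then x ` {0..u} \<union> y ` {0..u} else {x u' - x u, y u' - y u})"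
proof -
  define S where "S = (\<lambda>(i, k). if i then (if k then x ` {0..u} else {x u' - x u})
      else (if k then y ` {0..u} else {y u' - y u}))"
  have "freely_independent \<tau> UNIV S"
  proof (rule freely_independent_nested[OF xy, where \<pi> = fst])
    fix i
    show "freely_independent \<tau> {j \<in> UNIV. fst j = i} S"
    proof (rule freely_independent_reindex[where g = snd])
      show "freely_independent \<tau> UNIV (\<lambda>k. S (i, k))"
        using past_free_increment[OF bm(1) u] past_free_increment[OF bm(2) u]
        by (cases i) (simp_all add: S_def)
    qed (auto simp: inj_on_def intro: hull_inc)
  next
    fix j
    have x: "x v \<in> alg (x ` {0..})" "y v \<in> alg (y ` {0..})" if "0 \<le> v" for v
      using that by (auto intro: hull_inc)
    show "fst j \<in> UNIV \<and> S j \<subseteq> alg (if fst j then x ` {0..} else y ` {0..})"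
      using x u by (cases j) (auto simp: S_def intro!: subalgebra_diff subalgebra_alg)
  qed
  then have "freely_independent \<tau> UNIV (\<lambda>k. \<Union>j\<in>{j\<in>UNIV. snd j = k}. S j)"
    by (rule freely_independent_merge)
  then show ?thesis
  proof (rule freely_independent_reindex[where g = "\<lambda>k. k"])
    fix k :: bool
    have "S (True, k) \<subseteq> (\<Union>j\<in>{j\<in>UNIV. snd j = k}. S j)" "S (False, k) \<subseteq> (\<Union>j\<in>{j\<in>UNIV. snd j = k}. S j)"
      by auto
    then show "(if k then x ` {0..u} \<union> y ` {0..u} else {x u' - x u, y u' - y u})
        \<subseteq> alg (\<Union>j\<in>{j\<in>UNIV. snd j = k}. S j)"
      by (intro order_trans[OF _ hull_subset]) (auto simp: S_def split: if_splits)
  qed auto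
qed

section \<open>The filtration\<close>

text \<open>An algebraic substitute for the weak*-closure of \<open>B\<close>: trace functionals vanishing on \<open>B\<close> vanish
  on it by definition, and it is a weak*-closed unital *-subalgebra without any appeal to the
  weak*-continuity of \<open>star\<close>.\<close>

definition biorth :: "'a set \<Rightarrow> 'a set" where
  "biorth B = {c. \<forall>h. (\<forall>a\<in>B. \<tau> (h * a) = 0) \<longrightarrow> \<tau> (h * c) = 0}"

lemma biorthD: "c \<in> biorth B \<Longrightarrow> (\<And>a. a \<in> B \<Longrightarrow> \<tau> (h * a) = 0) \<Longrightarrow> \<tau> (h * c) = 0"
  by (simp add: biorth_def)

lemma subset_biorth: "B \<subseteq> biorth B"
  by (auto simp: biorth_def)

lemma biorth_mono: "B \<subseteq> B' \<Longrightarrow> biorth B \<subseteq> biorth B'"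
  unfolding biorth_def by blast

lemma subalgebra_biorth:
  assumes B: "unital_star_subalgebra B"
  shows "unital_star_subalgebra (biorth B)"
proof (rule unital_star_subalgebraI)
  show "1 \<in> biorth B" using subset_biorth subalgebra_one[OF B] by blast
next
  fix c z assume c: "c \<in> biorth B"
  show "z *\<^sub>C c \<in> biorth B"
    using c by (simp add: biorth_def scaleC_mult_right tau_scaleC)
  show "star c \<in> biorth B"
    unfolding biorth_def
  proof (intro CollectI allI impI)
    fix h assume h: "\<forall>a\<in>B. \<tau> (h * a) = 0"
    have "\<tau> (star h * a) = 0" if "a \<in> B" for a
    proof -
      have "\<tau> (star h * a) = cnj (\<tau> (h * star a))"
        by (simp add: tau_commute[of h] star_mult star_star flip: tau_star)
      then show ?thesis using h subalgebra_star[OF B that] by simp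
    qed
    then have "\<tau> (star h * c) = 0" by (rule biorthD[OF c])
    then have "cnj (\<tau> (star h * c)) = 0" by simp
    then show "\<tau> (h * star c) = 0"
      by (simp add: tau_commute[of h] star_mult star_star flip: tau_star)
  qed
  fix c' assume c': "c' \<in> biorth B"
  show "c + c' \<in> biorth B"
    using c c' by (simp add: biorth_def ring_distribs tau_add)
  show "c * c' \<in> biorth B"
    unfolding biorth_def
  proof (intro CollectI allI impI)
    fix h assume h: "\<forall>a\<in>B. \<tau> (h * a) = 0"
    \<comment> \<open>Traciality passes the annihilation along: \<open>a * h\<close> annihilates
      \<open>B\<close>, hence \<open>c\<close>; so \<open>h * c\<close> annihilates
      \<open>B\<close>, hence \<open>c'\<close>.\<close>
    have "\<tau> (h * c * a) = 0" if a: "a \<in> B" for a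
    proof -
      have "\<tau> (a * h * a') = 0" if "a' \<in> B" for a'
        using h subalgebra_mult[OF B that a] tau_commute[of a "h * a'"] by (simp add: mult.assoc)
      then have "\<tau> (a * h * c) = 0" by (rule biorthD[OF c])
      then show ?thesis using tau_commute[of a "h * c"] by (simp add: mult.assoc)
    qed
    then have "\<tau> (h * c * c') = 0" by (rule biorthD[OF c'])
    then show "\<tau> (h * (c * c')) = 0" by (simp add: mult.assoc)
  qed
qed

text \<open>For fixed \<open>b\<close> the factorisation says that the functional given by
  \<open>b - \<tau> b *\<^sub>C 1\<close> vanishes at \<open>c\<close>. It vanishes on
  \<open>alg S\<close>, and \<open>biorth\<close> is made to inherit exactly that.\<close>

lemma free_tau_mult_biorth:
  assumes "freely_independent \<tau> (UNIV :: bool set) (\<lambda>k. if k then S else T)"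
    and c: "c \<in> biorth (alg S)" and b: "b \<in> alg T"
  shows "\<tau> (c * b) = \<tau> c * \<tau> b"
proof -
  have "\<tau> ((b - \<tau> b *\<^sub>C 1) * c) = 0"
  proof (rule biorthD[OF c])
    fix a assume a: "a \<in> alg S"
    have "\<tau> (b * a) = \<tau> a * \<tau> b"
      using free_tau_mult[OF assms(1) a a b b] by (simp add: tau_commute)
    then show "\<tau> ((b - \<tau> b *\<^sub>C 1) * a) = 0"
      by (simp add: left_diff_distrib tau_diff scaleC_mult_left tau_scaleC)
  qed
  then show ?thesis
    by (simp add: left_diff_distrib tau_diff scaleC_mult_left tau_scaleC tau_commute mult.commute)
qed

end

sublocale faithful_tracial_wstar_space \<subseteq> tracial_state \<tau>
proof -
  have \<tau>: "bounded_linear \<tau>" "\<And>z a. \<tau> (z *\<^sub>C a) = z * \<tau> a"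
    using predual normal by (auto simp: is_predual_def dual_space_def)
  interpret bounded_linear \<tau> by (rule \<tau>(1))
  show "tracial_state \<tau>"
    by (rule tracial_state.intro) (rule add \<tau>(2) unital positive tracial)+
qed

context faithful_tracial_wstar_space
begin

text \<open>Here the invariance of the predual under translation enters: it puts the functional of
  \<open>h\<close> into \<open>F\<close>, where it is a coordinate of the weak*-topology.\<close>

lemma closedin_kernel: "closedin (weak_star_topology F) {c. \<tau> (h * c) = 0}"
proof -
  have "\<forall>f\<in>F. \<forall>c. (\<lambda>a. f (c * a)) \<in> F \<and> (\<lambda>a. f (a * c)) \<in> F"
    using predual unfolding is_predual_def by (elim conjE)
  then have f: "(\<lambda>c. \<tau> (h * c)) \<in> F" using normal by blast
  have "continuous_map (weak_star_topology F) euclidean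
      ((\<lambda>\<phi>. \<phi> (\<lambda>c. \<tau> (h * c))) \<circ> (\<lambda>a. \<lambda>f\<in>F. f a))"
    unfolding weak_star_topology_def
    by (intro continuous_map_pullback continuous_map_product_projection f)
  then have "continuous_map (weak_star_topology F) euclidean (\<lambda>c. \<tau> (h * c))"
    using f by (simp add: o_def)
  then have "closedin (weak_star_topology F)
      {c \<in> topspace (weak_star_topology F). \<tau> (h * c) \<in> {0}}"
    by (rule closedin_continuous_map_preimage) simp
  moreover have "topspace (weak_star_topology F) = UNIV"
    by (simp add: weak_star_topology_def topspace_pullback_topology PiE_def extensional_def Pi_def)
  ultimately show ?thesis by simp
qed

text \<open>\<open>biorth (alg S)\<close> is an intersection of such kernels, so it competes in the
  hull that defines the generated W*-algebra.\<close>

lemma generated_wstar_subset_biorth: "generated_wstar F S \<subseteq> biorth (alg S)"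
  unfolding generated_wstar_def
proof (rule hull_minimal)
  show "S \<subseteq> biorth (alg S)"
    by (rule order_trans[OF hull_subset subset_biorth])
  have "biorth (alg S) = \<Inter> ((\<lambda>h. {c. \<tau> (h * c) = 0}) ` {h. \<forall>a\<in>alg S. \<tau> (h * a) = 0})"
    by (rule set_eqI) (simp add: biorth_def)
  also have "closedin (weak_star_topology F) \<dots>"
  proof (rule closedin_Inter)
    have "0 \<in> {h. \<forall>a\<in>alg S. \<tau> (h * a) = 0}" by simp
    then show "(\<lambda>h. {c. \<tau> (h * c) = 0}) ` {h. \<forall>a\<in>alg S. \<tau> (h * a) = 0} \<noteq> {}" by blast
  qed (use closedin_kernel in blast)
  finally show "unital_star_subalgebra (biorth (alg S)) \<and> closedin (weak_star_topology F) (biorth (alg S))"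
    by (simp add: subalgebra_biorth subalgebra_alg)
qed

end

section \<open>Semicircular elements\<close>

text \<open>Everything is relative to the integral of \<open>f 0\<close>. Its value 1 is later read
  off from \<open>\<tau> 1 = 1\<close>, so the area under the semicircle is never computed.\<close>

lemma semicircle_integrals:
  fixes v :: real
  assumes v: "0 < v"
  defines "f \<equiv> \<lambda>n u. u ^ n * (sqrt (4 * v - u\<^sup>2) / (2 * pi * v))"
    and "I \<equiv> {- 2 * sqrt v .. 2 * sqrt v}"
  shows semicircle_first: "integral I (f 1) = 0"
    and semicircle_second: "integral I (f 2) = v * integral I (f 0)"
    and semicircle_even_le: "integral I (f (2 * m)) \<le> (2 * sqrt v) ^ (2 * m) * integral I (f 0)"
proof -
  have cont: "continuous_on J (f n)" for n J
    unfolding f_def using v by (intro continuous_intros) auto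
  have int: "f n integrable_on I" for n
    unfolding I_def by (intro integrable_continuous_real cont)
  have sq: "u\<^sup>2 \<le> 4 * v" if "u \<in> I" for u
  proof -
    have "\<bar>u\<bar> \<le> 2 * sqrt v" using that by (auto simp: I_def)
    then have "\<bar>u\<bar>\<^sup>2 \<le> (2 * sqrt v)\<^sup>2" by (intro power_mono) auto
    then show ?thesis using v by (simp add: power_mult_distrib)
  qed
  have "integral I (\<lambda>u. f 1 (- u)) = integral I (f 1)"
    using Henstock_Kurzweil_Integration.integral_reflect_real[of "2 * sqrt v" "- 2 * sqrt v" "f 1"]
    by (simp add: I_def)
  moreover have "(\<lambda>u. f 1 (- u)) = (\<lambda>u. - f 1 u)" by (auto simp: f_def)
  ultimately show "integral I (f 1) = 0" by simp
  show "integral I (f (2 * m)) \<le> (2 * sqrt v) ^ (2 * m) * integral I (f 0)"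
  proof -
    have "f (2 * m) u \<le> (2 * sqrt v) ^ (2 * m) * f 0 u" if "u \<in> I" for u
    proof -
      have "u ^ (2 * m) = \<bar>u\<bar> ^ (2 * m)" by (simp add: power_mult)
      also have "\<dots> \<le> (2 * sqrt v) ^ (2 * m)"
        using that by (intro power_mono) (auto simp: I_def)
      finally show ?thesis
        using sq[OF that] v by (auto simp: f_def intro!: divide_right_mono mult_right_mono)
    qed
    then have "integral I (f (2 * m)) \<le> integral I (\<lambda>u. (2 * sqrt v) ^ (2 * m) * f 0 u)"
      by (intro integral_le int integrable_on_mult_right) auto
    then show ?thesis by simp
  qed
  \<comment> \<open>A primitive of \<open>4 * v * f 0 - 4 * f 2\<close> that vanishes at both
    endpoints: \<open>u\<close> times the power 3/2 of \<open>4 * v - u\<^sup>2\<close>, up to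
    normalisation. This is the integration by parts behind the second moment.\<close>
  define G where "G u = u * ((4 * v - u\<^sup>2) * sqrt (4 * v - u\<^sup>2)) / (2 * pi * v)" for u :: real
  have "((\<lambda>u. 4 * v * f 0 u - 4 * f 2 u) has_integral G (2 * sqrt v) - G (- 2 * sqrt v)) I"
    unfolding I_def
  proof (rule fundamental_theorem_of_calculus_interior)
    show "- 2 * sqrt v \<le> 2 * sqrt v" using v by simp
    show "continuous_on {- 2 * sqrt v..2 * sqrt v} G"
      unfolding G_def using v by (intro continuous_intros) auto
    fix u assume "u \<in> {- 2 * sqrt v<..<2 * sqrt v}"
    then have "\<bar>u\<bar> < 2 * sqrt v" by auto
    then have "\<bar>u\<bar>\<^sup>2 < (2 * sqrt v)\<^sup>2" by (intro power_strict_mono) auto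
    then have pos: "0 < 4 * v - u\<^sup>2" using v by (simp add: power_mult_distrib)
    define q where "q = sqrt (4 * v - u\<^sup>2)"
    have q: "q > 0" "q * q = 4 * v - u\<^sup>2" using pos by (auto simp: q_def)
    have "(G has_real_derivative ((q * q * q + u * (- 2 * u * q + q * q * (- 2 * u / (2 * q)))) / (2 * pi * v))) (at u)"
    proof -
      have dq: "((\<lambda>u. sqrt (4 * v - u\<^sup>2)) has_real_derivative - 2 * u / (2 * q)) (at u)"
        unfolding q_def using pos by (auto intro!: derivative_eq_intros simp: field_simps)
      show ?thesis
        unfolding G_def using v q(1)
        by (auto intro!: derivative_eq_intros dq simp: q_def[symmetric] q(2)[symmetric])
          (simp add: field_simps)
    qed
    also have "(q * q * q + u * (- 2 * u * q + q * q * (- 2 * u / (2 * q)))) / (2 * pi * v)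
        = 4 * v * f 0 u - 4 * f 2 u"
    proof -
      have "q * q * q + u * (- 2 * u * q + q * q * (- 2 * u / (2 * q))) = (4 * v - u\<^sup>2) * q - 3 * u\<^sup>2 * q"
        unfolding q(2)[symmetric] using q(1) by (simp add: power2_eq_square field_simps)
      also have "\<dots> = (4 * v - 4 * u\<^sup>2) * q" by (simp add: algebra_simps)
      finally have E: "q * q * q + u * (- 2 * u * q + q * q * (- 2 * u / (2 * q))) = (4 * v - 4 * u\<^sup>2) * q" .
      show ?thesis unfolding E f_def q_def[symmetric] using v by (simp add: field_simps)
    qed
    finally show "(G has_vector_derivative 4 * v * f 0 u - 4 * f 2 u) (at u)"
      by (simp add: has_real_derivative_iff_has_vector_derivative)
  qed
  moreover have "G (2 * sqrt v) = 0" "G (- 2 * sqrt v) = 0"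
    using v by (auto simp: G_def power_mult_distrib)
  ultimately have "integral I (\<lambda>u. 4 * v * f 0 u - 4 * f 2 u) = 0"
    by (simp add: integral_unique)
  moreover have "integral I (\<lambda>u. 4 * v * f 0 u - 4 * f 2 u) = 4 * v * integral I (f 0) - 4 * integral I (f 2)"
    by (subst integral_diff) (auto intro!: int integrable_on_mult_right)
  ultimately show "integral I (f 2) = v * integral I (f 0)" by simp
qed

context tracial_state
begin

text \<open>Iterating Cauchy--Schwarz on the powers \<open>a ^ 2 ^ j\<close> shows that left multiplication by a
  self-adjoint element is bounded on \<open>L\<^sup>2\<close> by the growth rate of its moments.\<close>

lemma Lb_of_moments:
  assumes sa: "star a = a" and R: "0 < R"
    and moments: "\<And>m. Re (\<tau> (a ^ 2 ^ m)) \<le> R ^ 2 ^ m"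
  shows "Lb R a"
  unfolding Lb_def
proof (intro conjI allI)
  fix c
  define \<gamma> where "\<gamma> = L2 c"
  \<comment> \<open>An upper bound factor that does not depend on \<open>j\<close>; it disappears
    when roots of order \<open>2 ^ j\<close> are taken.\<close>
  define M where "M = L2 (c * star c)"
  define \<sigma> where "\<sigma> j = L2 (a ^ 2 ^ j * c)" for j :: nat
  have dbl: "a ^ 2 ^ j * a ^ 2 ^ j = a ^ 2 ^ Suc j" for j
    by (simp add: power_add[symmetric] mult_2)
  have sa': "star (a ^ m) = a ^ m" for m by (simp add: star_power sa)
  have \<sigma>_sq: "(\<sigma> j)\<^sup>2 = Re (\<tau> (star c * (a ^ 2 ^ Suc j * c)))" for j
    by (simp only: \<sigma>_def L2_sq star_mult sa' mult.assoc flip: dbl)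
  have step: "(\<sigma> j)\<^sup>2 \<le> \<gamma> * \<sigma> (Suc j)" for j
    unfolding \<sigma>_sq unfolding \<sigma>_def \<gamma>_def
    by (rule order_trans[OF complex_Re_le_cmod Cauchy_Schwarz_star])
  have bound: "(\<sigma> j)\<^sup>2 \<le> R ^ 2 ^ Suc j * M" for j
  proof -
    have "(R ^ 2 ^ Suc j)\<^sup>2 = R ^ 2 ^ Suc (Suc j)"
      by (simp add: power_mult[symmetric] mult.commute)
    then have "(L2 (a ^ 2 ^ Suc j))\<^sup>2 \<le> (R ^ 2 ^ Suc j)\<^sup>2"
      using moments[of "Suc (Suc j)"] by (simp only: L2_sq sa' dbl)
    then have "L2 (a ^ 2 ^ Suc j) \<le> R ^ 2 ^ Suc j"
      by (rule power2_le_imp_le) (use R in simp)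
    have "(\<sigma> j)\<^sup>2 = Re (\<tau> (a ^ 2 ^ Suc j * (c * star c)))"
      unfolding \<sigma>_sq by (subst tau_commute) (simp add: mult.assoc)
    also have "\<dots> \<le> L2 (a ^ 2 ^ Suc j) * M"
      unfolding M_def by (rule order_trans[OF complex_Re_le_cmod Cauchy_Schwarz])
    also have "\<dots> \<le> R ^ 2 ^ Suc j * M"
      using \<open>L2 (a ^ 2 ^ Suc j) \<le> R ^ 2 ^ Suc j\<close> by (intro mult_right_mono) (auto simp: M_def)
    finally show ?thesis .
  qed
  have \<sigma>0: "\<sigma> 0 = L2 (a * c)" by (simp add: \<sigma>_def)
  show "L2 (a * c) \<le> R * L2 c"
  proof (cases "\<gamma> = 0")
    case True
    then have "(\<sigma> 0)\<^sup>2 \<le> 0" using step[of 0] by simp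
    then show ?thesis using R by (simp add: \<sigma>0[symmetric])
  next
    case False
    then have \<gamma>: "\<gamma> > 0" using L2_nonneg[of c] unfolding \<gamma>_def by linarith
    define t where "t = \<sigma> 0 / \<gamma>"
    have t0: "0 \<le> t" using \<gamma> by (simp add: t_def \<sigma>_def)
    have "t ^ 2 ^ j \<le> \<sigma> j / \<gamma>" for j
    proof (induction j)
      case 0
      then show ?case by (simp add: t_def)
    next
      case (Suc j)
      have "t ^ 2 ^ Suc j = (t ^ 2 ^ j)\<^sup>2" by (simp add: power_mult[symmetric] mult.commute)
      also have "\<dots> \<le> (\<sigma> j / \<gamma>)\<^sup>2" using Suc t0 by (intro power_mono) auto
      also have "\<dots> \<le> \<sigma> (Suc j) / \<gamma>"
        using step[of j] \<gamma> by (simp add: power2_eq_square field_simps)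
      finally show ?case .
    qed
    then have "t ^ 2 ^ Suc j \<le> R ^ 2 ^ Suc j * (M / \<gamma>\<^sup>2)" for j
    proof -
      have "t ^ 2 ^ Suc j = (t ^ 2 ^ j)\<^sup>2" by (simp add: power_mult[symmetric] mult.commute)
      also have "\<dots> \<le> (\<sigma> j / \<gamma>)\<^sup>2"
        using \<open>\<And>j. t ^ 2 ^ j \<le> \<sigma> j / \<gamma>\<close> t0 by (intro power_mono) auto
      also have "\<dots> \<le> R ^ 2 ^ Suc j * (M / \<gamma>\<^sup>2)"
        using bound[of j] \<gamma> by (simp add: power_divide divide_right_mono)
      finally show ?thesis .
    qed
    then have le: "(t / R) ^ 2 ^ Suc j \<le> M / \<gamma>\<^sup>2" for j
      using R by (simp add: power_divide field_simps)
    have "t / R \<le> 1"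
    proof (rule ccontr)
      assume "\<not> t / R \<le> 1"
      then have gt: "1 < t / R" by simp
      then obtain n where "M / \<gamma>\<^sup>2 < (t / R) ^ n" using real_arch_pow by blast
      also have "\<dots> \<le> (t / R) ^ 2 ^ Suc n"
        using gt less_exp[of "Suc n"] by (intro power_increasing) linarith+
      finally show False using le[of n] by simp
    qed
    then have "\<sigma> 0 \<le> R * \<gamma>" using R \<gamma> by (simp add: t_def field_simps)
    then show ?thesis by (simp add: \<sigma>0 \<gamma>_def)
  qed
qed (use R in simp)

lemma
  assumes sc: "semicircular \<tau> v a" and v: "0 < v"
  shows semicircular_star: "star a = a"
    and semicircular_mean: "\<tau> a = 0"
    and semicircular_variance: "\<tau> (a * a) = complex_of_real v"
    and semicircular_Lb: "Lb (2 * sqrt v) a"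
proof -
  let ?I = "\<lambda>n. integral {- 2 * sqrt v .. 2 * sqrt v} (\<lambda>u. u ^ n * (sqrt (4 * v - u\<^sup>2) / (2 * pi * v)))"
  have moment: "\<tau> (a ^ n) = complex_of_real (?I n)" for n
    using sc by (simp add: semicircular_def)
  have I0: "?I 0 = 1"
  proof -
    have "complex_of_real (?I 0) = \<tau> (a ^ 0)" by (rule moment[symmetric])
    also have "\<tau> (a ^ 0) = complex_of_real 1" by (simp add: tau_one)
    finally show ?thesis by (simp only: of_real_eq_iff)
  qed
  show sa: "star a = a" using sc by (simp add: semicircular_def)
  show "\<tau> a = 0" using moment[of 1] semicircle_first[OF v] by simp
  show "\<tau> (a * a) = complex_of_real v"
  proof -
    have "\<tau> (a * a) = \<tau> (a ^ 2)" by (simp add: power2_eq_square)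
    also have "\<dots> = complex_of_real (?I 2)" by (rule moment)
    also have "?I 2 = v * ?I 0" by (rule semicircle_second[OF v])
    also have "\<dots> = v" by (simp only: I0)
    finally show ?thesis .
  qed
  show "Lb (2 * sqrt v) a"
  proof (rule Lb_of_moments[OF sa])
    show "0 < 2 * sqrt v" using v by simp
    fix m
    show "Re (\<tau> (a ^ 2 ^ m)) \<le> (2 * sqrt v) ^ 2 ^ m"
    proof (cases m)
      case 0
      then show ?thesis using moment[of 1] semicircle_first[OF v] v by simp
    next
      case (Suc j)
      have "Re (\<tau> (a ^ (2 * 2 ^ j))) = ?I (2 * 2 ^ j)" by (simp only: moment Re_complex_of_real)
      also have "\<dots> \<le> (2 * sqrt v) ^ (2 * 2 ^ j) * ?I 0" by (rule semicircle_even_le[OF v])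
      also have "\<dots> = (2 * sqrt v) ^ (2 * 2 ^ j)" by (simp only: I0 mult_1_right)
      finally show ?thesis by (simp only: Suc power_Suc)
    qed
  qed
qed

end

section \<open>The moments $\nu_n$\<close>

unbundle no vec_syntax
unbundle fps_syntax

text \<open>Lagrange-Buermann with the inverse series hidden: \<open>F\<close> is composed with
  \<open>\<phi> = z / G\<close>, so for \<open>F = H oo f\<close>, with \<open>f\<close> the
  compositional inverse of \<open>\<phi>\<close>, the right side is the familiar coefficient of
  \<open>H' * G ^ n\<close>.\<close>

lemma lagrange_inversion:
  fixes G F :: "real fps"
  assumes G0: "G $ 0 = 1" and n: "0 < n"
  shows "real n * F $ n = (fps_deriv (F oo (fps_X * inverse G)) * G ^ n) $ (n - 1)"
proof -
  define \<phi> where "\<phi> = fps_X * inverse G"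
  define B where "B = fps_deriv \<phi> * G ^ n"
  define H where "H = fps_deriv F"
  have \<phi>0: "\<phi> $ 0 = 0" by (simp add: \<phi>_def)
  have inv: "inverse G * G = 1" using inverse_mult_eq_1[of G] G0 by simp
  have d\<phi>: "fps_deriv \<phi> = (inverse G)\<^sup>2 * (G - fps_X * fps_deriv G)"
  proof -
    have "fps_deriv \<phi> = inverse G - fps_X * fps_deriv G * (inverse G)\<^sup>2"
      using G0 by (simp add: \<phi>_def fps_inverse_deriv algebra_simps)
    moreover have "(inverse G)\<^sup>2 * G = inverse G"
      using inv by (simp add: power2_eq_square mult.assoc)
    ultimately show ?thesis by (simp add: right_diff_distrib left_diff_distrib mult_ac)
  qed
  \<comment> \<open>Formally this is the residue of \<open>\<phi>'\<close> times
    \<open>\<phi>\<close> to the power \<open>k - n\<close>, which vanishes unless that power is -1.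
    It is written without negative powers, using that \<open>z ^ n / \<phi> ^ n\<close> is
    \<open>G ^ n\<close>.\<close>
  have coeff: "(\<phi> ^ k * B) $ (n - 1) = (if k = n - 1 then 1 else 0)" if k: "k \<le> n - 1" for k
  proof -
    define m where "m = n - 1 - k"
    have nk: "n = m + k + 1" using k n by (simp add: m_def)
    have ik: "inverse G ^ k * G ^ k = 1" for k by (simp add: inv flip: power_mult_distrib)
    have "\<phi> ^ k * B = fps_X ^ k * ((inverse G ^ k * G ^ k) * (inverse G)\<^sup>2 * G ^ (m + 1) * (G - fps_X * fps_deriv G))"
      unfolding B_def d\<phi> by (simp add: \<phi>_def power_mult_distrib nk power_add mult_ac)
    also have "\<dots> = fps_X ^ k * ((inverse G)\<^sup>2 * G ^ (m + 1) * (G - fps_X * fps_deriv G))"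
      by (simp add: ik)
    finally have 1: "(\<phi> ^ k * B) $ (n - 1) = ((inverse G)\<^sup>2 * G ^ (m + 1) * (G - fps_X * fps_deriv G)) $ m"
      by (simp add: fps_X_power_mult_nth nk)
    show ?thesis
    proof (cases m)
      case 0
      then show ?thesis using 1 k G0 n nk by (simp add: power2_eq_square)
    next
      case (Suc j)
      have "(inverse G)\<^sup>2 * G ^ (m + 1) = (inverse G ^ 2 * G ^ 2) * G ^ j"
        by (simp add: Suc power_add mult_ac power2_eq_square)
      then have "(inverse G)\<^sup>2 * G ^ (m + 1) = G ^ j" by (simp only: ik mult_1_left)
      then have "(\<phi> ^ k * B) $ (n - 1) = (G ^ j * (G - fps_X * fps_deriv G)) $ m"
        by (simp only: 1)
      also have "G ^ j * (G - fps_X * fps_deriv G) = G ^ m - fps_X * (fps_deriv G * G ^ j)"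
        by (simp add: Suc algebra_simps)
      finally have 2: "(\<phi> ^ k * B) $ (n - 1) = (G ^ m) $ m - (fps_deriv G * G ^ j) $ j"
        by (simp add: Suc)
      have "(fps_deriv (G ^ m)) $ j = real m * (fps_deriv G * G ^ j) $ j"
        unfolding fps_deriv_power by (simp add: Suc mult.assoc)
      moreover have "(fps_deriv (G ^ m)) $ j = real m * (G ^ m) $ m"
        by (simp only: fps_deriv_nth Suc) simp
      ultimately have "(fps_deriv G * G ^ j) $ j = (G ^ m) $ m" using Suc by simp
      then show ?thesis using 2 Suc k nk by simp
    qed
  qed
  have "fps_deriv (F oo \<phi>) * G ^ n = (H oo \<phi>) * B"
    by (simp add: fps_compose_deriv[OF \<phi>0] B_def H_def mult.assoc)
  then have "(fps_deriv (F oo \<phi>) * G ^ n) $ (n - 1)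
      = (\<Sum>i=0..n-1. (\<Sum>k=0..i. H $ k * (\<phi> ^ k) $ i) * B $ (n - 1 - i))"
    by (simp add: fps_mult_nth fps_compose_nth)
  also have "\<dots> = (\<Sum>i=0..n-1. \<Sum>k=0..n-1. H $ k * ((\<phi> ^ k) $ i * B $ (n - 1 - i)))"
  proof (intro sum.cong refl)
    fix i assume "i \<in> {0..n-1}"
    then have "(\<Sum>k=0..i. H $ k * (\<phi> ^ k) $ i) = (\<Sum>k=0..n-1. H $ k * (\<phi> ^ k) $ i)"
      using startsby_zero_power_prefix[OF \<phi>0] by (intro sum.mono_neutral_left) auto
    then show "(\<Sum>k=0..i. H $ k * (\<phi> ^ k) $ i) * B $ (n - 1 - i)
        = (\<Sum>k=0..n-1. H $ k * ((\<phi> ^ k) $ i * B $ (n - 1 - i)))"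
      by (simp add: sum_distrib_right mult.assoc)
  qed
  also have "\<dots> = (\<Sum>k=0..n-1. H $ k * (\<phi> ^ k * B) $ (n - 1))"
    by (subst sum.swap) (simp add: fps_mult_nth sum_distrib_left)
  also have "\<dots> = (\<Sum>k=0..n-1. if k = n - 1 then H $ k else 0)"
  proof (intro sum.cong refl)
    fix k assume "k \<in> {0..n-1}"
    then show "H $ k * (\<phi> ^ k * B) $ (n - 1) = (if k = n - 1 then H $ k else 0)"
      using coeff[of k] by auto
  qed
  also have "\<dots> = H $ (n - 1)" by simp
  also have "\<dots> = real n * F $ n" using n by (simp add: H_def)
  finally show ?thesis by (simp add: \<phi>_def)
qed

text \<open>The generating function \<open>f\<close> of the \<open>nu_poly n t\<close> below solves \<open>f = z * G(f)\<close> with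
  \<open>G = nu_fps t\<close>; the two coefficient formulas for \<open>f\<close> and \<open>f * f\<close> give the convolution identity
  behind the differential equation of \<open>nu\<close>.\<close>

definition nu_fps :: "real \<Rightarrow> real fps" where
  "nu_fps t = (1 + fps_X) * fps_exp (- t)"

lemma nu_fps_power_nth:
  "(nu_fps t ^ n) $ j = (\<Sum>k\<le>j. (- (real n * t)) ^ k / fact k * real (n choose (j - k)))"
proof -
  have "nu_fps t ^ n = fps_exp (- (real n * t)) * fps_binomial (real n)"
    by (simp add: nu_fps_def power_mult_distrib fps_exp_power_mult fps_binomial_of_nat mult.commute)
  then show ?thesis
    by (simp add: fps_mult_nth atLeast0AtMost binomial_gbinomial)
qed

definition nu_poly :: "nat \<Rightarrow> real \<Rightarrow> real" where
  "nu_poly n t = (\<Sum>k<n. (- (real n * t)) ^ k / fact k * real (n choose (k + 1))) / real n"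

lemma nu_poly_convolution:
  assumes "0 < n"
  shows "real n * (\<Sum>a=1..<n. nu_poly a t * nu_poly (n - a) t)
    = 2 * (\<Sum>k<n-1. (- (real n * t)) ^ k / fact k * real (n choose (k + 2)))"
proof -
  let ?G = "nu_fps t"
  let ?\<phi> = "fps_X * inverse ?G"
  \<comment> \<open>The compositional inverse of \<open>z / G\<close> is the generating function,
    that is, the solution of \<open>h = z * G(h)\<close>. Composing \<open>h * h\<close> with
    \<open>?\<phi>\<close> therefore gives \<open>z * z\<close>.\<close>
  define h where "h = fps_inv ?\<phi>"
  have G0: "?G $ 0 = 1" by (simp add: nu_fps_def)
  have h: "h oo ?\<phi> = fps_X"
    unfolding h_def using G0 by (intro fps_inv) simp_all
  have h0: "h $ 0 = 0" by (simp add: h_def fps_inv_def)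
  have hn: "h $ m = nu_poly m t" if m: "0 < m" for m
  proof -
    have "real m * h $ m = (?G ^ m) $ (m - 1)"
      using lagrange_inversion[OF G0 m, of h] by (simp add: h)
    also have "\<dots> = (\<Sum>k<m. (- (real m * t)) ^ k / fact k * real (m choose (k + 1)))"
      unfolding nu_fps_power_nth
    proof (rule sum.cong)
      show "{..m - 1} = {..<m}" using m by auto
      fix k assume "k \<in> {..<m}"
      then have "m choose (m - 1 - k) = m choose (k + 1)"
        by (subst binomial_symmetric) (auto intro: arg_cong2[where f = "(choose)"])
      then show "(- (real m * t)) ^ k / fact k * real (m choose (m - 1 - k))
          = (- (real m * t)) ^ k / fact k * real (m choose (k + 1))" by simp
    qed
    finally show ?thesis using m by (simp add: nu_poly_def field_simps)
  qed
  have "real n * (h * h) $ n = (fps_deriv ((h * h) oo ?\<phi>) * ?G ^ n) $ (n - 1)"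
    by (rule lagrange_inversion[OF G0 assms])
  also have "(h * h) oo ?\<phi> = fps_X * fps_X"
    by (subst fps_compose_mult_distrib) (simp_all add: h)
  also have "fps_deriv (fps_X * fps_X) * ?G ^ n = fps_const 2 * (fps_X * ?G ^ n)"
    by (simp add: numeral_fps_const[symmetric] algebra_simps)
  also have "(fps_const 2 * (fps_X * ?G ^ n)) $ (n - 1) = 2 * (if n = 1 then 0 else (?G ^ n) $ (n - 2))"
    using assms by (cases n) (auto simp: numeral_2_eq_2)
  also have "(if n = 1 then 0 else (?G ^ n) $ (n - 2))
      = (\<Sum>k<n-1. (- (real n * t)) ^ k / fact k * real (n choose (k + 2)))"
  proof (cases "n = 1")
    case False
    have "(\<Sum>k\<le>n-2. (- (real n * t)) ^ k / fact k * real (n choose (n - 2 - k)))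
        = (\<Sum>k<n-1. (- (real n * t)) ^ k / fact k * real (n choose (k + 2)))"
    proof (rule sum.cong)
      show "{..n - 2} = {..<n - 1}" using assms False by auto
      fix k assume "k \<in> {..<n - 1}"
      then have "n choose (n - 2 - k) = n choose (k + 2)"
        by (subst binomial_symmetric) (auto intro: arg_cong2[where f = "(choose)"])
      then show "(- (real n * t)) ^ k / fact k * real (n choose (n - 2 - k))
          = (- (real n * t)) ^ k / fact k * real (n choose (k + 2))" by simp
    qed
    then show ?thesis using False by (simp add: nu_fps_power_nth)
  qed simp
  also have "(h * h) $ n = (\<Sum>a=1..<n. nu_poly a t * nu_poly (n - a) t)"
  proof -
    have "(h * h) $ n = (\<Sum>a=0..n. h $ a * h $ (n - a))" by (simp add: fps_mult_nth)
    also have "\<dots> = (\<Sum>a=1..<n. h $ a * h $ (n - a))"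
      using h0 by (intro sum.mono_neutral_right) (auto simp: not_less Suc_le_eq)
    also have "\<dots> = (\<Sum>a=1..<n. nu_poly a t * nu_poly (n - a) t)"
      by (intro sum.cong refl) (simp add: hn)
    finally show ?thesis .
  qed
  finally show ?thesis .
qed

lemma nu_eq: "0 < n \<Longrightarrow> nu (int n) t = exp (- (real n / 2) * t) * nu_poly n t"
proof -
  assume n: "0 < n"
  have "(- t) ^ k / fact k * real n powi (int k - 1) * real (n choose (k + 1))
      = (- (real n * t)) ^ k / fact k * real (n choose (k + 1)) / real n" for k
  proof -
    have "real n powi (int k - 1) = real n ^ k / real n" using n by (simp add: power_int_diff)
    moreover have "(- (real n * t)) ^ k = (- t) ^ k * real n ^ k"
      by (simp add: power_mult_distrib[symmetric] mult.commute)
    ultimately show ?thesis by simp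
  qed
  then show ?thesis using n by (simp add: nu_def nu_poly_def sum_divide_distrib)
qed

unbundle no fps_syntax

lemma nu_0 [simp]: "nu 0 t = 1"
  by (simp add: nu_def)

lemma nu_at_0: "nu (int n) 0 = 1"
proof (cases "n = 0")
  case False
  have "(\<Sum>k<n. (- (real n * 0)) ^ k / fact k * real (n choose (k + 1)))
      = (\<Sum>k<n. if k = 0 then real n else 0)"
    by (intro sum.cong refl) (simp add: power_0_left)
  then show ?thesis using False by (simp add: nu_eq nu_poly_def)
qed simp

text \<open>Differentiating \<open>nu_poly n\<close> shifts \<open>k\<close> and turns the binomials
  \<open>n choose (k + 1)\<close> into \<open>n choose (k + 2)\<close>, which is the sum in the
  convolution identity. The exponential factors combine because the orders \<open>a\<close> and
  \<open>n - a\<close> add up to \<open>n\<close>.\<close>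

lemma has_derivative_nu:
  assumes n: "0 < n"
  shows "((\<lambda>t. nu (int n) t) has_real_derivative
    - (real n / 2) * nu (int n) t - real n / 2 * (\<Sum>a=1..<n. nu (int a) t * nu (int (n - a)) t)) (at t)"
proof -
  define D where "D = (\<Sum>k<n-1. (- (real n * t)) ^ k / fact k * real (n choose (k + 2)))"
  have "(nu_poly n has_real_derivative - D) (at t)"
  proof -
    obtain m where m: "n = Suc m" using n by (cases n) auto
    have "(nu_poly n has_real_derivative
        (\<Sum>k<n. real k * (- (real n * t)) ^ (k - 1) * (- real n) / fact k * real (n choose (k + 1))) / real n) (at t)"
      unfolding nu_poly_def[abs_def] using n
      by (auto intro!: derivative_eq_intros sum.cong simp: field_simps)
    also have "(\<Sum>k<n. real k * (- (real n * t)) ^ (k - 1) * (- real n) / fact k * real (n choose (k + 1))) / real n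
        = (\<Sum>k<n. - (real k * (- (real n * t)) ^ (k - 1) / fact k * real (n choose (k + 1))))"
      unfolding sum_divide_distrib using n by (intro sum.cong refl) simp
    also have "\<dots> = (\<Sum>k<m. - (real (Suc k) * (- (real n * t)) ^ k / fact (Suc k) * real (n choose (k + 2))))"
      unfolding m by (subst sum.lessThan_Suc_shift) simp
    also have "\<dots> = - D"
    proof -
      have "real (Suc k) * z / fact (Suc k) = z / fact k" for k and z :: real
        by (simp only: fact_Suc) (simp del: of_nat_Suc)
      then show ?thesis by (simp only: D_def m sum_negf diff_Suc_1)
    qed
    finally show ?thesis .
  qed
  then have "((\<lambda>t. exp (- (real n / 2) * t) * nu_poly n t) has_real_derivative
      - (real n / 2) * (exp (- (real n / 2) * t) * nu_poly n t) - exp (- (real n / 2) * t) * D) (at t)"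
    by (auto intro!: derivative_eq_intros simp: algebra_simps)
  moreover have "exp (- (real n / 2) * t) * D
      = real n / 2 * (\<Sum>a=1..<n. nu (int a) t * nu (int (n - a)) t)"
  proof -
    have "nu (int a) t * nu (int (n - a)) t = exp (- (real n / 2) * t) * (nu_poly a t * nu_poly (n - a) t)"
      if "a \<in> {1..<n}" for a
    proof -
      have "- (real n / 2) * t = - (real a / 2) * t + - (real (n - a) / 2) * t"
        using that by (simp add: field_simps)
      moreover have "nu (int a) t = exp (- (real a / 2) * t) * nu_poly a t"
        "nu (int (n - a)) t = exp (- (real (n - a) / 2) * t) * nu_poly (n - a) t"
        using that by (intro nu_eq; simp)+
      ultimately show ?thesis by (simp only: exp_add mult_ac)
    qed
    then have "(\<Sum>a=1..<n. nu (int a) t * nu (int (n - a)) t)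
        = exp (- (real n / 2) * t) * (\<Sum>a=1..<n. nu_poly a t * nu_poly (n - a) t)"
      by (simp add: sum_distrib_left)
    then show ?thesis using nu_poly_convolution[OF n, of t] by (simp add: D_def)
  qed
  ultimately show ?thesis unfolding nu_eq[OF n] by (simp only:)
qed

section \<open>The Euler scheme and its mean-square convergence\<close>

lemma is_partition_mono:
  assumes "is_partition a b m p" "i \<le> j" "j \<le> m"
  shows "p i \<le> p j"
  using assms(2,3)
proof (induction j rule: dec_induct)
  case (step j)
  then have "p j < p (Suc j)" using assms(1) by (auto simp: is_partition_def)
  then show ?case using step by simp
qed simp

lemma uniform_partition:
  assumes "0 < t" "0 < N"
  shows "is_partition 0 t N (\<lambda>i. real i * (t / real N))"
  unfolding is_partition_def using assms
  by (intro conjI allI impI mult_strict_right_mono divide_pos_pos) simp_all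

lemma uniform_partition_fine:
  assumes "0 \<le> t" "0 < d"
  obtains m p where "is_partition 0 t m p" "\<And>i. i < m \<Longrightarrow> p (Suc i) - p i < d"
proof (cases "t = 0")
  case True
  then show thesis by (intro that[of 0 "\<lambda>_. 0"]) (auto simp: is_partition_def)
next
  case False
  obtain N where N: "0 < N" "t / real N < d"
    using real_arch_invD[of "d / t"] reals_Archimedean2[of "t / d"] assms False
    by (metis divide_less_eq divide_pos_pos mult.commute of_nat_0_less_iff order_le_imp_less_or_eq
        order_less_trans pos_divide_less_eq)
  show thesis
  proof (rule that)
    show "is_partition 0 t N (\<lambda>i. real i * (t / real N))"
      using assms False N by (intro uniform_partition) auto
    show "real (Suc i) * (t / real N) - real i * (t / real N) < d" for i
      unfolding left_diff_distrib[symmetric] using N(2) by simp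
  qed
qed

lemma discrete_Gronwall:
  fixes a p :: "nat \<Rightarrow> real"
  assumes p: "p 0 = 0" "\<And>i. i < m \<Longrightarrow> p i \<le> p (Suc i)"
    and A: "0 \<le> A" "0 \<le> B"
    and le: "\<And>k. k \<le> m \<Longrightarrow> a k \<le> A + B * (\<Sum>i<k. a i * (p (Suc i) - p i))"
    and k: "k \<le> m"
  shows "a k \<le> A * exp (B * p k)"
proof -
  \<comment> \<open>The induction bounds the right-hand side of the hypothesis instead of
    \<open>a k\<close>: it dominates \<open>a k\<close> and grows by one summand per step.\<close>
  have "A + B * (\<Sum>i<k. a i * (p (Suc i) - p i)) \<le> A * exp (B * p k)" if "k \<le> m" for k
    using that
  proof (induction k)
    case 0
    then show ?case by (simp add: p)
  next
    case (Suc k)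
    have d: "0 \<le> p (Suc k) - p k" using p(2)[of k] Suc by simp
    have ak: "a k \<le> A * exp (B * p k)" using Suc le[of k] by simp
    have "A + B * (\<Sum>i<Suc k. a i * (p (Suc i) - p i))
        = (A + B * (\<Sum>i<k. a i * (p (Suc i) - p i))) + B * (p (Suc k) - p k) * a k"
      by (simp add: algebra_simps)
    also have "\<dots> \<le> A * exp (B * p k) + B * (p (Suc k) - p k) * (A * exp (B * p k))"
      using Suc ak A d by (intro add_mono mult_left_mono mult_nonneg_nonneg) auto
    also have "\<dots> = A * exp (B * p k) * (1 + B * (p (Suc k) - p k))"
      by (simp add: algebra_simps)
    also have "\<dots> \<le> A * exp (B * p k) * exp (B * (p (Suc k) - p k))"
      using A by (intro mult_left_mono exp_ge_add_one_self) auto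
    also have "\<dots> = A * exp (B * p (Suc k))"
      by (simp add: mult.assoc exp_add[symmetric] algebra_simps)
    finally show ?case .
  qed
  then show ?thesis using le[OF k] k by (meson order_trans)
qed

context tracial_state
begin

text \<open>As in the Saks--Henstock lemma: refining a fine partition on \<open>[0, p k]\<close> only changes the
  Riemann sum over \<open>[0, p k]\<close>, so partial sums are uniformly close to the indefinite integral.\<close>

lemma has_L2_integral_uniform:
  assumes int: "\<And>u. 0 \<le> u \<Longrightarrow> u \<le> t \<Longrightarrow> has_L2_integral \<tau> \<theta> z u (J u)"
    and t: "0 \<le> t" and e: "0 < e"
  obtains d where "0 < d" "\<And>m p k. is_partition 0 t m p \<Longrightarrow> (\<And>i. i < m \<Longrightarrow> p (Suc i) - p i < d) \<Longrightarrow>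
    k \<le> m \<Longrightarrow> L2 ((\<Sum>i<k. \<theta> (p i) * (z (p (Suc i)) - z (p i))) - J (p k)) < e"
proof -
  define S where "S p k = (\<Sum>i<k. \<theta> (p i) * (z (p (Suc i)) - z (p i)))" for p and k :: nat
  have approx: "\<exists>d>0. \<forall>m p. is_partition 0 u m p \<longrightarrow> (\<forall>i<m. p (Suc i) - p i < d) \<longrightarrow> L2 (S p m - I) < e"
    if "has_L2_integral \<tau> \<theta> z u I" "0 < e" for u I e
    using that unfolding has_L2_integral_def S_def imp_conjL by blast
  obtain d where d: "0 < d" "\<And>m p. is_partition 0 t m p \<Longrightarrow> (\<And>i. i < m \<Longrightarrow> p (Suc i) - p i < d) \<Longrightarrow>
      L2 (S p m - J t) < e / 3"
    using approx[OF int[OF t order_refl], of "e / 3"] e by auto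
  show thesis
  proof (rule that[OF d(1)])
    fix m p k
    assume p: "is_partition 0 t m p" and fine: "\<And>i. i < m \<Longrightarrow> p (Suc i) - p i < d" and k: "k \<le> m"
    have pk: "0 \<le> p k" "p k \<le> t"
      using is_partition_mono[OF p, of 0 k] is_partition_mono[OF p, of k m] p k
      by (auto simp: is_partition_def)
    obtain d' where d': "0 < d'" "\<And>m q. is_partition 0 (p k) m q \<Longrightarrow>
        (\<And>i. i < m \<Longrightarrow> q (Suc i) - q i < d') \<Longrightarrow> L2 (S q m - J (p k)) < e / 3"
      using approx[OF int[OF pk], of "e / 3"] e by auto
    obtain l q where q: "is_partition 0 (p k) l q" "\<And>i. i < l \<Longrightarrow> q (Suc i) - q i < min d d'"
      using uniform_partition_fine[OF pk(1), of "min d d'"] d(1) d'(1) by auto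
    define g where "g i = (if i \<le> l then q i else p (k + (i - l)))" for i
    have gl: "g (l + j) = p (k + j)" for j
      using q(1) by (cases j) (auto simp: g_def is_partition_def)
    have g1: "g i = q i" if "i \<le> l" for i using that by (simp add: g_def)
    have step: "g i < g (Suc i) \<and> g (Suc i) - g i < d" if "i < l + (m - k)" for i
    proof (cases "i < l")
      case True
      then show ?thesis using q by (auto simp: g1 is_partition_def)
    next
      case False
      define j where "j = i - l"
      have "i = l + j" "k + j < m" using False that k by (auto simp: j_def)
      then show ?thesis using gl[of j] gl[of "Suc j"] p fine[of "k + j"]
        by (simp add: is_partition_def)
    qed
    have g: "is_partition 0 t (l + (m - k)) g"
      unfolding is_partition_def using q(1) p k gl[of "m - k"] step
      by (auto simp: g1 is_partition_def)
    have Sg: "S g (l + j) = S q l + (S p (k + j) - S p k)" for j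
    proof (induction j)
      case 0
      have "S g l = S q l" unfolding S_def by (intro sum.cong refl) (simp add: g1)
      then show ?case by simp
    next
      case (Suc j)
      have "S g (l + Suc j) = S g (l + j) + \<theta> (p (k + j)) * (z (p (k + Suc j)) - z (p (k + j)))"
        using gl[of j] gl[of "Suc j"] by (simp add: S_def)
      then show ?case using Suc by (simp add: S_def)
    qed
    have 1: "L2 (S q l + (S p m - S p k) - J t) < e / 3"
      using d(2)[OF g] step Sg[of "m - k"] k by simp
    have 2: "L2 (S p m - J t) < e / 3" by (rule d(2)[OF p fine])
    have 3: "L2 (S q l - J (p k)) < e / 3"
      using q by (intro d'(2)) auto
    have "S p k - J (p k) = (S p m - J t) - (S q l + (S p m - S p k) - J t) + (S q l - J (p k))"
      by simp
    then have "L2 (S p k - J (p k)) \<le> L2 (S p m - J t) + L2 (S q l + (S p m - S p k) - J t) + L2 (S q l - J (p k))"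
      using L2_triangle[of "(S p m - J t) - (S q l + (S p m - S p k) - J t)" "S q l - J (p k)"]
        L2_triangle_diff[of "S p m - J t" "S q l + (S p m - S p k) - J t"] by simp
    then show "L2 ((\<Sum>i<k. \<theta> (p i) * (z (p (Suc i)) - z (p i))) - J (p k)) < e"
      using 1 2 3 by (simp add: S_def)
  qed
qed

end

locale free_mult_bm = faithful_tracial_wstar_space F \<tau>
  for F :: "('a::cstar_algebra \<Rightarrow> complex) set" and \<tau> +
  fixes x y b :: "real \<Rightarrow> 'a" and r s :: real
  assumes x_bm: "free_brownian_motion \<tau> x"
    and y_bm: "free_brownian_motion \<tau> y"
    and xy_free: "freely_independent \<tau> (UNIV :: bool set) (\<lambda>i. if i then x ` {0..} else y ` {0..})"
    and r: "0 \<le> r" and s: "0 \<le> s"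
    and b: "free_multiplicative_brownian_motion F \<tau> r s x y b"
begin

text \<open>No weak*-closure is taken: alternating words are factorised only for elements of this
  algebra, while \<open>b u\<close> is placed in \<open>biorth (past u)\<close>.\<close>

definition past :: "real \<Rightarrow> 'a set" where
  "past u = alg (x ` {0..u} \<union> y ` {0..u})"

definition future :: "real \<Rightarrow> real \<Rightarrow> 'a set" where
  "future u u' = alg {x u' - x u, y u' - y u}"

definition dw :: "real \<Rightarrow> real \<Rightarrow> 'a" where
  "dw u u' = w_noise r s x y u' - w_noise r s x y u"

lemma past_subalgebra: "unital_star_subalgebra (past u)"
  and future_subalgebra: "unital_star_subalgebra (future u u')"
  by (simp_all add: past_def future_def subalgebra_alg)

lemma biorth_past_subalgebra: "unital_star_subalgebra (biorth (past u))"
  by (intro subalgebra_biorth past_subalgebra)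

lemma past_mono: "u \<le> u' \<Longrightarrow> past u \<subseteq> past u'"
  unfolding past_def by (intro hull_mono) auto

lemma dw_eq: "dw u u' = (\<i> * complex_of_real (sqrt r)) *\<^sub>C (x u' - x u)
    + complex_of_real (sqrt s) *\<^sub>C (y u' - y u)"
  by (simp add: dw_def w_noise_def scaleC_diff_right algebra_simps)

lemma dw_in_future: "dw u u' \<in> future u u'"
  unfolding dw_eq
  by (intro subalgebra_add subalgebra_scaleC future_subalgebra) (simp_all add: future_def hull_inc)

lemma dw_in_past: "0 \<le> u \<Longrightarrow> u \<le> u' \<Longrightarrow> dw u u' \<in> past u'"
  unfolding dw_eq
  by (intro subalgebra_add subalgebra_diff subalgebra_scaleC past_subalgebra) (auto simp: past_def intro: hull_inc)

context
  fixes u u' :: real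
  assumes u: "0 \<le> u" "u < u'"
begin

lemma past_future_free:
  "freely_independent \<tau> (UNIV :: bool set)
    (\<lambda>k. if k then x ` {0..u} \<union> y ` {0..u} else {x u' - x u, y u' - y u})"
  by (rule past_free_increments[OF x_bm y_bm xy_free u])

lemma tau_past_future:
  "c \<in> biorth (past u) \<Longrightarrow> e \<in> future u u' \<Longrightarrow> \<tau> (c * e) = \<tau> c * \<tau> e"
  using free_tau_mult_biorth[OF past_future_free] by (simp add: past_def future_def)

lemma tau_past_future_alternating:
  "a \<in> past u \<Longrightarrow> a' \<in> past u \<Longrightarrow> e \<in> future u u' \<Longrightarrow> e' \<in> future u u' \<Longrightarrow> \<tau> e = 0 \<Longrightarrow> \<tau> e' = 0
    \<Longrightarrow> \<tau> (a * e * a' * e') = \<tau> a * \<tau> a' * \<tau> (e * e')"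
  using free_tau_alternating[OF past_future_free] by (simp add: past_def future_def)

text \<open>The factor \<open>\<i>\<close> in front of \<open>x\<close> gives \<open>- r\<close> in
  the square but \<open>+ r\<close> in the product with the adjoint. The cross terms vanish because
  \<open>x\<close> and \<open>y\<close> are free and centred.\<close>

lemma
  shows tau_dw: "\<tau> (dw u u') = 0"
    and tau_dw_dw: "\<tau> (dw u u' * dw u u') = complex_of_real ((s - r) * (u' - u))"
    and tau_dw_star: "\<tau> (dw u u' * star (dw u u')) = complex_of_real ((r + s) * (u' - u))"
    and Lb_dw: "Lb (2 * (sqrt r + sqrt s) * sqrt (u' - u)) (dw u u')"
proof -
  define X Y where "X = x u' - x u" and "Y = y u' - y u"
  have sc: "semicircular \<tau> (u' - u) X" "semicircular \<tau> (u' - u) Y"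
    using x_bm y_bm u by (auto simp: free_brownian_motion_def X_def Y_def)
  have pos: "0 < u' - u" using u by simp
  note X = semicircular_star[OF sc(1) pos] semicircular_mean[OF sc(1) pos]
    semicircular_variance[OF sc(1) pos] semicircular_Lb[OF sc(1) pos]
  note Y = semicircular_star[OF sc(2) pos] semicircular_mean[OF sc(2) pos]
    semicircular_variance[OF sc(2) pos] semicircular_Lb[OF sc(2) pos]
  have XY: "\<tau> (X * Y) = 0"
  proof -
    have "X \<in> alg (x ` {0..})" "Y \<in> alg (y ` {0..})"
      unfolding X_def Y_def using u
      by (auto intro!: subalgebra_diff[OF subalgebra_alg] intro: hull_inc)
    then show ?thesis using free_tau_mult[OF xy_free, of X X Y Y] X Y by simp
  qed
  then have YX: "\<tau> (Y * X) = 0" by (simp add: tau_commute)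
  have dw: "dw u u' = (\<i> * complex_of_real (sqrt r)) *\<^sub>C X + complex_of_real (sqrt s) *\<^sub>C Y"
    by (simp add: dw_eq X_def Y_def)
  have sq: "complex_of_real (sqrt r) * complex_of_real (sqrt r) = complex_of_real r"
    "complex_of_real (sqrt s) * complex_of_real (sqrt s) = complex_of_real s"
    using r s by (simp_all flip: of_real_mult)
  show "\<tau> (dw u u') = 0" by (simp add: dw tau_add tau_scaleC X Y)
  show "\<tau> (dw u u' * dw u u') = complex_of_real ((s - r) * (u' - u))"
    using sq by (simp add: dw ring_distribs tau_add scaleC_mult_left scaleC_mult_right scaleC_scaleC
        tau_scaleC X Y XY YX) (simp add: algebra_simps)
  show "\<tau> (dw u u' * star (dw u u')) = complex_of_real ((r + s) * (u' - u))"
    using sq by (simp add: dw ring_distribs tau_add scaleC_mult_left scaleC_mult_right scaleC_scaleC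
        star_add star_scaleC tau_scaleC X Y XY YX) (simp add: algebra_simps)
  have "Lb (cmod (\<i> * complex_of_real (sqrt r)) * (2 * sqrt (u' - u))
      + cmod (complex_of_real (sqrt s)) * (2 * sqrt (u' - u))) (dw u u')"
    unfolding dw by (intro Lb_add Lb_scaleC X Y)
  then show "Lb (2 * (sqrt r + sqrt s) * sqrt (u' - u)) (dw u u')"
    using r s by (simp add: norm_mult algebra_simps)
qed

end

definition euler :: "(nat \<Rightarrow> real) \<Rightarrow> nat \<Rightarrow> 'a" where
  "euler p = rec_nat 1 (\<lambda>i e. e * (1 + (dw (p i) (p (Suc i)) - ((r - s) / 2 * (p (Suc i) - p i)) *\<^sub>R 1)))"

lemma euler_0 [simp]: "euler p 0 = 1"
  and euler_Suc: "euler p (Suc i)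
    = euler p i * (1 + (dw (p i) (p (Suc i)) - ((r - s) / 2 * (p (Suc i) - p i)) *\<^sub>R 1))"
  by (simp_all add: euler_def)

lemma euler_in_past:
  assumes "is_partition 0 t m p" "k \<le> m"
  shows "euler p k \<in> past (p k)"
  using assms(2)
proof (induction k)
  case (Suc k)
  have p: "0 \<le> p k" "p k \<le> p (Suc k)"
    using is_partition_mono[OF assms(1), of 0 k] is_partition_mono[OF assms(1), of k "Suc k"] Suc assms(1)
    by (auto simp: is_partition_def)
  have "euler p k \<in> past (p (Suc k))" using Suc past_mono[OF p(2)] by auto
  then show ?case
    unfolding euler_Suc
    by (intro subalgebra_mult subalgebra_add subalgebra_one subalgebra_diff subalgebra_scaleR
        past_subalgebra dw_in_past p)
qed (simp add: subalgebra_one past_subalgebra)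

text \<open>The integrated form of the scheme, to be subtracted from the integral equation of
  \<open>b\<close> term by term.\<close>

lemma euler_sum: "euler p k = 1 + (\<Sum>i<k. euler p i * dw (p i) (p (Suc i)))
    - ((r - s) / 2) *\<^sub>R (\<Sum>i<k. (p (Suc i) - p i) *\<^sub>R euler p i)"
proof (induction k)
  case (Suc k)
  have "euler p (Suc k) = euler p k + euler p k * dw (p k) (p (Suc k))
      - ((r - s) / 2) *\<^sub>R ((p (Suc k) - p k) *\<^sub>R euler p k)"
    by (simp add: euler_Suc ring_distribs)
  then show ?case using Suc by (simp add: scaleR_add_right)
qed simp

lemma b_in_biorth: "0 \<le> u \<Longrightarrow> b u \<in> biorth (past u)"
  using b generated_wstar_subset_biorth
  unfolding free_multiplicative_brownian_motion_def filtration_def past_def by blast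

text \<open>Membership in \<open>biorth\<close> is the right condition on \<open>\<eta>\<close>
  because \<open>\<eta>\<close> will involve \<open>b\<close>. Cross terms end in a centred future
  factor and vanish; in the diagonal term traciality joins \<open>d\<close> and
  \<open>star d\<close>, which then factor off with trace \<open>(r + s)\<close> times the
  step.\<close>

lemma Ito_isometry:
  assumes p: "is_partition 0 t m p"
    and \<eta>: "\<And>i. i < k \<Longrightarrow> \<eta> i \<in> biorth (past (p i))" and k: "k \<le> m"
  shows "(L2 (\<Sum>i<k. \<eta> i * dw (p i) (p (Suc i))))\<^sup>2
    = (r + s) * (\<Sum>i<k. (L2 (\<eta> i))\<^sup>2 * (p (Suc i) - p i))"
  using \<eta> k
proof (induction k)
  case (Suc k)
  define S where "S = (\<Sum>i<k. \<eta> i * dw (p i) (p (Suc i)))"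
  define d where "d = dw (p k) (p (Suc k))"
  have pk: "0 \<le> p k" "p k < p (Suc k)"
    using is_partition_mono[OF p, of 0 k] Suc(3) p by (auto simp: is_partition_def)
  have S: "S \<in> biorth (past (p k))"
    unfolding S_def
  proof (intro subalgebra_sum subalgebra_mult biorth_past_subalgebra)
    fix i assume i: "i \<in> {..<k}"
    have le: "0 \<le> p i" "p i \<le> p (Suc i)" "p (Suc i) \<le> p k" "p i \<le> p k"
      using is_partition_mono[OF p, of 0 i] is_partition_mono[OF p, of i "Suc i"]
        is_partition_mono[OF p, of "Suc i" k] is_partition_mono[OF p, of i k] i Suc(3) p
      by (auto simp: is_partition_def)
    show "\<eta> i \<in> biorth (past (p k))"
      using Suc(2)[of i] i biorth_mono[OF past_mono[OF le(4)]] by auto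
    show "dw (p i) (p (Suc i)) \<in> biorth (past (p k))"
      using dw_in_past[OF le(1,2)] past_mono[OF le(3)] subset_biorth by blast
  qed
  have \<eta>k: "\<eta> k \<in> biorth (past (p k))" using Suc(2)[of k] by simp
  have d: "d \<in> future (p k) (p (Suc k))" "star d \<in> future (p k) (p (Suc k))"
    using dw_in_future by (auto simp: d_def intro: subalgebra_star future_subalgebra)
  have cross: "\<tau> (star S * (\<eta> k * d)) = 0"
  proof -
    have "\<tau> ((star S * \<eta> k) * d) = \<tau> (star S * \<eta> k) * \<tau> d"
      by (intro tau_past_future[OF pk] d subalgebra_mult subalgebra_star biorth_past_subalgebra S \<eta>k)
    then show ?thesis using tau_dw[OF pk] by (simp add: d_def mult.assoc)
  qed
  then have cross': "\<tau> (star (\<eta> k * d) * S) = 0"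
    by (metis complex_cnj_zero star_mult star_star tau_star)
  have diag: "\<tau> (star (\<eta> k * d) * (\<eta> k * d))
      = complex_of_real ((r + s) * ((L2 (\<eta> k))\<^sup>2 * (p (Suc k) - p k)))"
  proof -
    have "\<tau> (star (\<eta> k * d) * (\<eta> k * d)) = \<tau> ((star (\<eta> k) * \<eta> k) * (d * star d))"
      using tau_commute[of "star d" "star (\<eta> k) * \<eta> k * d"] by (simp add: star_mult mult.assoc)
    also have "\<dots> = \<tau> (star (\<eta> k) * \<eta> k) * \<tau> (d * star d)"
      by (intro tau_past_future[OF pk] subalgebra_mult d future_subalgebra subalgebra_star
          biorth_past_subalgebra \<eta>k)
    finally show ?thesis
      by (simp add: tau_star_mult_eq d_def tau_dw_star[OF pk])
  qed
  have "(L2 (S + \<eta> k * d))\<^sup>2 = (L2 S)\<^sup>2 + (r + s) * ((L2 (\<eta> k))\<^sup>2 * (p (Suc k) - p k))"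
    unfolding L2_sq[of "S + \<eta> k * d"] L2_sq[of S]
    using cross cross' diag by (simp add: star_add ring_distribs tau_add)
  then show ?case using Suc.IH Suc(2,3) by (simp add: S_def d_def algebra_simps)
qed simp

lemma euler_mean_square:
  assumes t: "0 \<le> t" and e: "0 < e"
  obtains d where "0 < d" "\<And>m p. is_partition 0 t m p \<Longrightarrow> (\<And>i. i < m \<Longrightarrow> p (Suc i) - p i < d) \<Longrightarrow>
    L2 (euler p m - b t) \<le> e"
proof -
  define c where "c = (r - s) / 2"
  have "\<forall>u. \<exists>J D. 0 \<le> u \<longrightarrow> has_L2_integral \<tau> b (w_noise r s x y) u J \<and>
      has_L2_integral \<tau> b of_real u D \<and> b u = 1 + J - c *\<^sub>R D"
    using b unfolding free_multiplicative_brownian_motion_def c_def by blast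
  then obtain J D where JD: "\<And>u. 0 \<le> u \<Longrightarrow> has_L2_integral \<tau> b (w_noise r s x y) u (J u)"
    "\<And>u. 0 \<le> u \<Longrightarrow> has_L2_integral \<tau> b of_real u (D u)"
    "\<And>u. 0 \<le> u \<Longrightarrow> b u = 1 + J u - c *\<^sub>R D u"
    by metis
  \<comment> \<open>The 3 comes from squaring a sum of three terms, \<open>r + s\<close> from the
    isometry, and \<open>c\<^sup>2 * t\<close> from Cauchy-Schwarz applied to the drift.\<close>
  define B where "B = 3 * (r + s + c\<^sup>2 * t)"
  have B: "0 \<le> B" using r s t by (simp add: B_def)
  \<comment> \<open>Makes
    \<open>(2 * (1 + \<bar>c\<bar>) * \<epsilon> * exp (B * t))\<^sup>2\<close> equal to
    \<open>e\<^sup>2\<close>; the Gronwall bound has the smaller constants 3 and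
    \<open>exp (B * t)\<close>.\<close>
  define \<epsilon> where "\<epsilon> = e / (2 * exp (B * t) * (1 + \<bar>c\<bar>))"
  have \<epsilon>: "0 < \<epsilon>" using e by (simp add: \<epsilon>_def add_pos_nonneg)
  obtain d1 where d1: "0 < d1" "\<And>m p k. is_partition 0 t m p \<Longrightarrow> (\<And>i. i < m \<Longrightarrow> p (Suc i) - p i < d1) \<Longrightarrow>
      k \<le> m \<Longrightarrow> L2 ((\<Sum>i<k. b (p i) * (w_noise r s x y (p (Suc i)) - w_noise r s x y (p i))) - J (p k)) < \<epsilon>"
    using has_L2_integral_uniform[OF JD(1) t \<epsilon>] by blast
  obtain d2 where d2: "0 < d2" "\<And>m p k. is_partition 0 t m p \<Longrightarrow> (\<And>i. i < m \<Longrightarrow> p (Suc i) - p i < d2) \<Longrightarrow>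
      k \<le> m \<Longrightarrow> L2 ((\<Sum>i<k. b (p i) * (of_real (p (Suc i)) - of_real (p i))) - D (p k)) < \<epsilon>"
    using has_L2_integral_uniform[OF JD(2) t \<epsilon>] by blast
  show thesis
  proof (rule that[of "min d1 d2"])
    show "0 < min d1 d2" using d1 d2 by simp
    fix m p assume p: "is_partition 0 t m p" and fine: "\<And>i. i < m \<Longrightarrow> p (Suc i) - p i < min d1 d2"
    have p0: "p 0 = 0" "p m = t" and inc: "\<And>i. i < m \<Longrightarrow> p i < p (Suc i)"
      using p by (auto simp: is_partition_def)
    have nn: "0 \<le> p i" if "i \<le> m" for i using is_partition_mono[OF p, of 0 i] that p0 by simp
    define \<eta> where "\<eta> i = euler p i - b (p i)" for i
    have \<eta>: "\<eta> i \<in> biorth (past (p i))" if "i \<le> m" for i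
      unfolding \<eta>_def using euler_in_past[OF p that] b_in_biorth[OF nn[OF that]] subset_biorth
      by (intro subalgebra_diff biorth_past_subalgebra) auto
    define \<Delta> where "\<Delta> i = p (Suc i) - p i" for i
    have \<Delta>: "0 \<le> \<Delta> i" if "i < m" for i using inc[OF that] by (simp add: \<Delta>_def)
    have main: "(L2 (\<eta> k))\<^sup>2 \<le> 3 * ((1 + \<bar>c\<bar>) * \<epsilon>)\<^sup>2 + B * (\<Sum>i<k. (L2 (\<eta> i))\<^sup>2 * \<Delta> i)" if k: "k \<le> m" for k
    proof -
      define Q where "Q = (\<Sum>i<k. (L2 (\<eta> i))\<^sup>2 * \<Delta> i)"
      define M where "M = (\<Sum>i<k. \<eta> i * dw (p i) (p (Suc i)))"
      define P where "P = (\<Sum>i<k. \<Delta> i *\<^sub>R \<eta> i)"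
      define R1 where "R1 = (\<Sum>i<k. b (p i) * dw (p i) (p (Suc i))) - J (p k)"
      define R2 where "R2 = (\<Sum>i<k. \<Delta> i *\<^sub>R b (p i)) - D (p k)"
      have R1: "L2 R1 < \<epsilon>" using d1(2)[OF p _ k] fine by (simp add: R1_def dw_def)
      have R2: "L2 R2 < \<epsilon>"
        using d2(2)[OF p _ k] fine by (simp add: R2_def \<Delta>_def of_real_def flip: scaleR_left_diff_distrib)
      \<comment> \<open>The error is the scheme applied to earlier errors, \<open>M\<close> and
        \<open>P\<close>, plus the quadrature errors \<open>R1\<close> and \<open>R2\<close>, which
        are small for all \<open>k\<close> at once.\<close>
      have dec: "\<eta> k = M - c *\<^sub>R P + (R1 - c *\<^sub>R R2)"
      proof -
        have "P = (\<Sum>i<k. \<Delta> i *\<^sub>R euler p i) - (\<Sum>i<k. \<Delta> i *\<^sub>R b (p i))"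
          by (simp add: P_def \<eta>_def scaleR_diff_right sum_subtractf)
        moreover have "M = (\<Sum>i<k. euler p i * dw (p i) (p (Suc i))) - (\<Sum>i<k. b (p i) * dw (p i) (p (Suc i)))"
          by (simp add: M_def \<eta>_def left_diff_distrib sum_subtractf)
        moreover have "\<eta> k = 1 + (\<Sum>i<k. euler p i * dw (p i) (p (Suc i)))
            - c *\<^sub>R (\<Sum>i<k. \<Delta> i *\<^sub>R euler p i) - (1 + J (p k) - c *\<^sub>R D (p k))"
          unfolding \<eta>_def euler_sum[of p k] JD(3)[OF nn[OF k]] \<Delta>_def c_def ..
        ultimately show ?thesis
          by (simp add: R1_def R2_def scaleR_diff_right)
      qed
      have M: "(L2 M)\<^sup>2 = (r + s) * Q"
        unfolding M_def Q_def \<Delta>_def using k \<eta> by (intro Ito_isometry[OF p]) auto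
      have P: "(L2 P)\<^sup>2 \<le> t * Q"
      proof -
        \<comment> \<open>The weight is split into two square roots so that Cauchy-Schwarz yields
          the elapsed time \<open>p k\<close> and \<open>Q\<close>.\<close>
        have "L2 P \<le> (\<Sum>i<k. sqrt (\<Delta> i) * (sqrt (\<Delta> i) * L2 (\<eta> i)))"
        proof -
          have "L2 P \<le> (\<Sum>i<k. L2 (\<Delta> i *\<^sub>R \<eta> i))"
            unfolding P_def using Lp_sum_le[of 0] by (simp add: Lp_0)
          also have "\<dots> = (\<Sum>i<k. sqrt (\<Delta> i) * (sqrt (\<Delta> i) * L2 (\<eta> i)))"
            using \<Delta> k by (intro sum.cong refl) (simp add: L2_scaleR mult.assoc[symmetric])
          finally show ?thesis .
        qed
        then have "(L2 P)\<^sup>2 \<le> (\<Sum>i<k. sqrt (\<Delta> i) * (sqrt (\<Delta> i) * L2 (\<eta> i)))\<^sup>2"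
          by (intro power_mono) auto
        also have "\<dots> \<le> (\<Sum>i<k. (sqrt (\<Delta> i))\<^sup>2) * (\<Sum>i<k. (sqrt (\<Delta> i) * L2 (\<eta> i))\<^sup>2)"
          by (rule Cauchy_Schwarz_ineq_sum)
        also have "(\<Sum>i<k. (sqrt (\<Delta> i))\<^sup>2) = p k"
        proof -
          have "(\<Sum>i<k. (sqrt (\<Delta> i))\<^sup>2) = (\<Sum>i<k. p (Suc i) - p i)"
            using \<Delta> k by (intro sum.cong refl) (simp add: \<Delta>_def)
          then show ?thesis by (simp add: sum_lessThan_telescope p0)
        qed
        also have "(\<Sum>i<k. (sqrt (\<Delta> i) * L2 (\<eta> i))\<^sup>2) = Q"
          unfolding Q_def using \<Delta> k by (intro sum.cong refl) (simp add: power_mult_distrib)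
        also have "p k * Q \<le> t * Q"
          using is_partition_mono[OF p k] p0 k \<Delta> unfolding Q_def
          by (intro mult_right_mono sum_nonneg) auto
        finally show ?thesis .
      qed
      have "L2 (\<eta> k) \<le> L2 M + \<bar>c\<bar> * L2 P + (1 + \<bar>c\<bar>) * \<epsilon>"
      proof -
        have "L2 (R1 - c *\<^sub>R R2) \<le> \<epsilon> + \<bar>c\<bar> * \<epsilon>"
          using L2_triangle_diff[of R1 "c *\<^sub>R R2"] R1 R2 mult_left_mono[of "L2 R2" \<epsilon> "\<bar>c\<bar>"]
          by (simp add: L2_scaleR)
        moreover have "L2 (M - c *\<^sub>R P) \<le> L2 M + \<bar>c\<bar> * L2 P"
          using L2_triangle_diff[of M "c *\<^sub>R P"] by (simp add: L2_scaleR)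
        ultimately show ?thesis
          using L2_triangle[of "M - c *\<^sub>R P" "R1 - c *\<^sub>R R2"] by (simp add: dec algebra_simps)
      qed
      then have "(L2 (\<eta> k))\<^sup>2 \<le> (L2 M + \<bar>c\<bar> * L2 P + (1 + \<bar>c\<bar>) * \<epsilon>)\<^sup>2"
        by (intro power_mono) auto
      also have "\<dots> \<le> 3 * ((L2 M)\<^sup>2 + (\<bar>c\<bar> * L2 P)\<^sup>2 + ((1 + \<bar>c\<bar>) * \<epsilon>)\<^sup>2)"
      proof -
        have "(a + b + c)\<^sup>2 \<le> 3 * (a\<^sup>2 + b\<^sup>2 + c\<^sup>2)" for a b c :: real
          using sum_squares_ge_zero[of "a - b" "b - c"] zero_le_power2[of "a - c"]
          by (simp add: power2_eq_square algebra_simps)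
        then show ?thesis .
      qed
      also have "\<dots> = 3 * ((1 + \<bar>c\<bar>) * \<epsilon>)\<^sup>2 + 3 * ((r + s) * Q + c\<^sup>2 * (L2 P)\<^sup>2)"
        by (simp add: M power_mult_distrib)
      also have "\<dots> \<le> 3 * ((1 + \<bar>c\<bar>) * \<epsilon>)\<^sup>2 + 3 * ((r + s) * Q + c\<^sup>2 * (t * Q))"
        using P by (intro add_left_mono mult_left_mono) auto
      also have "\<dots> = 3 * ((1 + \<bar>c\<bar>) * \<epsilon>)\<^sup>2 + B * Q" by (simp add: B_def algebra_simps)
      finally show ?thesis by (simp add: Q_def)
    qed
    have "(L2 (\<eta> m))\<^sup>2 \<le> 3 * ((1 + \<bar>c\<bar>) * \<epsilon>)\<^sup>2 * exp (B * p m)"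
      by (rule discrete_Gronwall[where m = m and B = B and a = "\<lambda>i. (L2 (\<eta> i))\<^sup>2"])
        (use p0 inc B main in \<open>auto simp: \<Delta>_def less_imp_le\<close>)
    also have "\<dots> \<le> 4 * ((1 + \<bar>c\<bar>) * \<epsilon>)\<^sup>2 * (exp (B * t))\<^sup>2"
    proof -
      have "exp (B * t) \<le> (exp (B * t))\<^sup>2" using B t by (simp add: power2_eq_square)
      then show ?thesis unfolding p0(2) by (intro mult_mono) auto
    qed
    also have "\<dots> = (2 * ((1 + \<bar>c\<bar>) * \<epsilon>) * exp (B * t))\<^sup>2"
      by (simp add: power_mult_distrib)
    also have "2 * ((1 + \<bar>c\<bar>) * \<epsilon>) * exp (B * t) = e"
    proof -
      have "1 + \<bar>c\<bar> \<noteq> 0" by linarith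
      then show ?thesis by (simp add: \<epsilon>_def)
    qed
    finally have "L2 (\<eta> m) \<le> e" by (rule power2_le_imp_le) (use e in simp)
    then show "L2 (euler p m - b t) \<le> e" by (simp add: \<eta>_def p0)
  qed
qed

end

section \<open>Uniform $L^p$ bounds for the Euler scheme\<close>

lemma power_remainder_bound:
  fixes K0 :: real
  assumes "0 \<le> K0"
  obtains C where "0 \<le> C" "\<And>K. 0 \<le> K \<Longrightarrow> K \<le> K0 \<Longrightarrow> (1 + K) ^ n - 1 - real n * K \<le> C * K\<^sup>2"
proof -
  \<comment> \<open>The first-order bound is carried along because the remainder for
    \<open>Suc n\<close> contains \<open>K * ((1 + K) ^ n - 1)\<close>.\<close>
  have "\<exists>C\<ge>0. \<exists>C'\<ge>0. \<forall>K. 0 \<le> K \<and> K \<le> K0 \<longrightarrow>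
      (1 + K) ^ n - 1 \<le> C' * K \<and> (1 + K) ^ n - 1 - real n * K \<le> C * K\<^sup>2"
  proof (induction n)
    case (Suc n)
    then obtain C C' where C: "0 \<le> C" "0 \<le> C'" and bnd: "\<And>K. 0 \<le> K \<Longrightarrow> K \<le> K0 \<Longrightarrow>
      (1 + K) ^ n - 1 \<le> C' * K \<and> (1 + K) ^ n - 1 - real n * K \<le> C * K\<^sup>2" by blast
    have "(1 + K) ^ Suc n - 1 \<le> (C' + C' * K0 + 1) * K \<and>
        (1 + K) ^ Suc n - 1 - real (Suc n) * K \<le> (C + C') * K\<^sup>2" if K: "0 \<le> K" "K \<le> K0" for K
    proof
      have 1: "K * ((1 + K) ^ n - 1) \<le> K * (C' * K)"
        using bnd[OF K] K by (intro mult_left_mono) auto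
      have 2: "K * (C' * K) \<le> K0 * (C' * K)"
        using K C by (intro mult_right_mono) auto
      have eq: "(1 + K) ^ Suc n - 1 = ((1 + K) ^ n - 1) + K * ((1 + K) ^ n - 1) + K"
        by (simp add: algebra_simps)
      show "(1 + K) ^ Suc n - 1 \<le> (C' + C' * K0 + 1) * K"
        unfolding eq using bnd[OF K] 1 2 by (simp add: algebra_simps)
      show "(1 + K) ^ Suc n - 1 - real (Suc n) * K \<le> (C + C') * K\<^sup>2"
        unfolding eq using bnd[OF K] 1 by (simp add: algebra_simps power2_eq_square)
    qed
    then show ?case using C assms
      by (intro exI[of _ "C + C'"] conjI exI[of _ "C' + C' * K0 + 1"]) auto
  qed (auto intro!: exI[of _ 0])
  then show thesis using that by blast
qed

section \<open>Traces of powers under a bounded perturbation\<close>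

context tracial_state
begin

context
  fixes E :: 'a and k :: nat
begin

private abbreviation "a \<equiv> star E * E"
private abbreviation "g \<equiv> Lp k E ^ 2 ^ Suc k"
private abbreviation "W ps \<equiv> prod_list (map (\<lambda>p. a * snd p) ps)"
private abbreviation "bnd ps \<equiv> prod_list (map fst (ps :: (real \<times> 'a) list))"

text \<open>Each factor \<open>a * snd p\<close> is split into \<open>star E\<close> and
  \<open>E * snd p\<close>, which gives the \<open>2 ^ (k + 1)\<close> factors for Hoelder; a
  bounded factor on the right of \<open>E\<close> costs only its bound.\<close>

lemma interspersed_bound:
  assumes "length ps = 2 ^ k" "\<forall>p\<in>set ps. Lb (fst p) (snd p)"
  shows "cmod (\<tau> (W ps)) \<le> g * bnd ps"
proof -
  define zs where "zs = concat (map (\<lambda>p. [star E, E * snd p]) ps)"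
  have len: "length zs = 2 * length ps" unfolding zs_def by (induction ps) auto
  have pr: "prod_list zs = W ps" unfolding zs_def by (induction ps) (auto simp: mult.assoc)
  have "cmod (\<tau> (prod_list zs)) \<le> prod_list (map (Lp k) zs)"
    by (rule Hoelder) (simp add: len assms)
  also have "\<dots> = prod_list (map (\<lambda>p. Lp k E * Lp k (E * snd p)) ps)"
    unfolding zs_def by (induction ps) (auto simp: mult.assoc)
  also have "\<dots> \<le> prod_list (map (\<lambda>p. Lp k E * (fst p * Lp k E)) ps)"
    using assms(2) by (intro prod_list_mono_real) (auto intro!: mult_left_mono Lp_Lb_right)
  also have "\<dots> = (Lp k E ^ 2) ^ length ps * bnd ps"
    by (induction ps) (auto simp: power2_eq_square mult_ac)
  also have "(Lp k E ^ 2) ^ length ps = g"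
    by (simp add: assms(1) power_mult)
  finally show ?thesis by (simp add: pr)
qed

private lemma W_replicate: "W (ps @ replicate q (1, 1)) = W ps * a ^ q"
  by (induction q) (simp_all add: power_commutes mult.assoc flip: replicate_append_same)

text \<open>The leftmost \<open>1 + \<eta>\<close> is expanded, which appends the letter 1 or
  \<open>\<eta>\<close> to the prefix. The bounds of the words reproduce the scalar expansion of
  \<open>(1 + K) ^ q\<close>, and those containing at least one \<open>\<eta>\<close> add up to
  \<open>(1 + K) ^ q - 1\<close>.\<close>

private lemma expansion_first_order:
  assumes \<eta>: "Lb K \<eta>" and "length ps + q = 2 ^ k" "\<forall>p\<in>set ps. Lb (fst p) (snd p)"
  shows "cmod (\<tau> (W ps * (a * (1 + \<eta>)) ^ q) - \<tau> (W ps * a ^ q)) \<le> g * bnd ps * ((1 + K) ^ q - 1)"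
  using assms(2,3)
proof (induction q arbitrary: ps)
  case (Suc q)
  have K: "0 \<le> K" by (rule Lb_nonneg[OF \<eta>])
  have 1: "cmod (\<tau> (W (ps @ [(1, 1)]) * (a * (1 + \<eta>)) ^ q) - \<tau> (W (ps @ [(1, 1)]) * a ^ q))
      \<le> g * bnd (ps @ [(1, 1)]) * ((1 + K) ^ q - 1)"
    using Suc.prems by (intro Suc.IH) (auto simp: Lb_one)
  have 2: "cmod (\<tau> (W (ps @ [(K, \<eta>)]) * (a * (1 + \<eta>)) ^ q) - \<tau> (W (ps @ [(K, \<eta>)]) * a ^ q))
      \<le> g * bnd (ps @ [(K, \<eta>)]) * ((1 + K) ^ q - 1)"
    using Suc.prems \<eta> by (intro Suc.IH) auto
  have 3: "cmod (\<tau> (W (ps @ [(K, \<eta>)]) * a ^ q)) \<le> g * bnd (ps @ [(K, \<eta>)])"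
  proof -
    have "\<forall>p\<in>set ((ps @ [(K, \<eta>)]) @ replicate q (1, 1)). Lb (fst p) (snd p)"
      using Suc.prems(2) \<eta> by (auto simp: Lb_one)
    from interspersed_bound[OF _ this] show ?thesis
      using Suc.prems(1) unfolding W_replicate by simp
  qed
  have eq: "W ps * (a * (1 + \<eta>)) ^ Suc q = W (ps @ [(1, 1)]) * (a * (1 + \<eta>)) ^ q
      + W (ps @ [(K, \<eta>)]) * (a * (1 + \<eta>)) ^ q"
    by (simp add: ring_distribs mult.assoc)
  have eq': "W ps * a ^ Suc q = W (ps @ [(1, 1)]) * a ^ q"
    by (simp add: mult.assoc)
  have "\<tau> (W ps * (a * (1 + \<eta>)) ^ Suc q) - \<tau> (W ps * a ^ Suc q)
     = (\<tau> (W (ps @ [(1, 1)]) * (a * (1 + \<eta>)) ^ q) - \<tau> (W (ps @ [(1, 1)]) * a ^ q))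
     + (\<tau> (W (ps @ [(K, \<eta>)]) * (a * (1 + \<eta>)) ^ q) - \<tau> (W (ps @ [(K, \<eta>)]) * a ^ q))
     + \<tau> (W (ps @ [(K, \<eta>)]) * a ^ q)"
    unfolding eq eq' tau_add by simp
  then have "cmod (\<tau> (W ps * (a * (1 + \<eta>)) ^ Suc q) - \<tau> (W ps * a ^ Suc q))
     \<le> g * bnd (ps @ [(1, 1)]) * ((1 + K) ^ q - 1) + g * bnd (ps @ [(K, \<eta>)]) * ((1 + K) ^ q - 1)
       + g * bnd (ps @ [(K, \<eta>)])"
    using 1 2 3 by (smt (verit) norm_triangle_ineq)
  also have "\<dots> = g * bnd ps * ((1 + K) ^ Suc q - 1)"
    by (simp add: algebra_simps)
  finally show ?case .
qed simp

text \<open>The same expansion, with the words containing exactly one \<open>\<eta>\<close> kept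
  explicitly; once an \<open>\<eta>\<close> has been chosen the first-order lemma takes
  over.\<close>

private lemma expansion_second_order:
  assumes \<eta>: "Lb K \<eta>" and "length ps + q = 2 ^ k" "\<forall>p\<in>set ps. Lb (fst p) (snd p)"
  shows "cmod (\<tau> (W ps * (a * (1 + \<eta>)) ^ q) - \<tau> (W ps * a ^ q)
      - (\<Sum>j<q. \<tau> (W ps * a ^ j * (a * \<eta>) * a ^ (q - 1 - j)))) \<le> g * bnd ps * ((1 + K) ^ q - 1 - real q * K)"
  using assms(2,3)
proof (induction q arbitrary: ps)
  case (Suc q)
  have 1: "cmod (\<tau> (W (ps @ [(1, 1)]) * (a * (1 + \<eta>)) ^ q) - \<tau> (W (ps @ [(1, 1)]) * a ^ q)
      - (\<Sum>j<q. \<tau> (W (ps @ [(1, 1)]) * a ^ j * (a * \<eta>) * a ^ (q - 1 - j))))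
      \<le> g * bnd (ps @ [(1, 1)]) * ((1 + K) ^ q - 1 - real q * K)"
    using Suc.prems by (intro Suc.IH) (auto simp: Lb_one)
  have 2: "cmod (\<tau> (W (ps @ [(K, \<eta>)]) * (a * (1 + \<eta>)) ^ q) - \<tau> (W (ps @ [(K, \<eta>)]) * a ^ q))
      \<le> g * bnd (ps @ [(K, \<eta>)]) * ((1 + K) ^ q - 1)"
    using Suc.prems \<eta> by (intro expansion_first_order[OF \<eta>]) auto
  have eq: "W ps * (a * (1 + \<eta>)) ^ Suc q = W (ps @ [(1, 1)]) * (a * (1 + \<eta>)) ^ q
      + W (ps @ [(K, \<eta>)]) * (a * (1 + \<eta>)) ^ q"
    by (simp add: ring_distribs mult.assoc)
  have eq': "W ps * a ^ Suc q = W (ps @ [(1, 1)]) * a ^ q"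
    by (simp add: mult.assoc)
  have eq'': "(\<Sum>j<Suc q. \<tau> (W ps * a ^ j * (a * \<eta>) * a ^ (Suc q - 1 - j)))
      = \<tau> (W (ps @ [(K, \<eta>)]) * a ^ q) + (\<Sum>j<q. \<tau> (W (ps @ [(1, 1)]) * a ^ j * (a * \<eta>) * a ^ (q - 1 - j)))"
    by (subst sum.lessThan_Suc_shift) (simp add: mult.assoc)
  have "\<tau> (W ps * (a * (1 + \<eta>)) ^ Suc q) - \<tau> (W ps * a ^ Suc q)
      - (\<Sum>j<Suc q. \<tau> (W ps * a ^ j * (a * \<eta>) * a ^ (Suc q - 1 - j)))
     = (\<tau> (W (ps @ [(1, 1)]) * (a * (1 + \<eta>)) ^ q) - \<tau> (W (ps @ [(1, 1)]) * a ^ q)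
      - (\<Sum>j<q. \<tau> (W (ps @ [(1, 1)]) * a ^ j * (a * \<eta>) * a ^ (q - 1 - j))))
     + (\<tau> (W (ps @ [(K, \<eta>)]) * (a * (1 + \<eta>)) ^ q) - \<tau> (W (ps @ [(K, \<eta>)]) * a ^ q))"
    unfolding eq eq' eq'' tau_add by simp
  then have "cmod (\<tau> (W ps * (a * (1 + \<eta>)) ^ Suc q) - \<tau> (W ps * a ^ Suc q)
      - (\<Sum>j<Suc q. \<tau> (W ps * a ^ j * (a * \<eta>) * a ^ (Suc q - 1 - j))))
     \<le> g * bnd (ps @ [(1, 1)]) * ((1 + K) ^ q - 1 - real q * K) + g * bnd (ps @ [(K, \<eta>)]) * ((1 + K) ^ q - 1)"
    using 1 2 by (smt (verit) norm_triangle_ineq)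
  also have "\<dots> = g * bnd ps * ((1 + K) ^ Suc q - 1 - real (Suc q) * K)"
    by (simp add: algebra_simps)
  finally show ?case .
qed simp

text \<open>By traciality all words with exactly one \<open>\<eta>\<close> have the same trace, so
  the linear term is a single trace with multiplicity \<open>2 ^ k\<close>.\<close>

lemma tau_power_expansion:
  assumes \<eta>: "Lb K \<eta>"
  shows "cmod (\<tau> ((a * (1 + \<eta>)) ^ 2 ^ k) - \<tau> (a ^ 2 ^ k) - of_nat (2 ^ k) * \<tau> (a ^ 2 ^ k * \<eta>))
    \<le> g * ((1 + K) ^ 2 ^ k - 1 - real (2 ^ k) * K)"
proof -
  have "\<tau> (a ^ j * (a * \<eta>) * a ^ (2 ^ k - 1 - j)) = \<tau> (a ^ 2 ^ k * \<eta>)" if "j < 2 ^ k" for j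
  proof -
    have "\<tau> (a ^ j * (a * \<eta>) * a ^ (2 ^ k - 1 - j)) = \<tau> (a ^ (2 ^ k - 1 - j) * (a ^ j * (a * \<eta>)))"
      by (rule tau_commute)
    also have "a ^ (2 ^ k - 1 - j) * (a ^ j * (a * \<eta>)) = a ^ ((2 ^ k - 1 - j) + j + 1) * \<eta>"
      by (simp only: power_add power_one_right mult.assoc)
    also have "(2 ^ k - 1 - j) + j + 1 = (2 ^ k :: nat)" using that by simp
    finally show ?thesis .
  qed
  then show ?thesis using expansion_second_order[OF \<eta>, of "[]" "2 ^ k"] by simp
qed

lemma tau_power_mult_bound:
  assumes h: "Lb R h"
  shows "cmod (\<tau> (a ^ 2 ^ k * h)) \<le> g * R"
proof -
  have "(2::nat) ^ k = (2 ^ k - 1) + 1" by simp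
  then have "a ^ 2 ^ k * h = a ^ (2 ^ k - 1) * (a * h)"
    by (metis mult.assoc power_add power_one_right)
  also have "\<dots> = W (replicate (2 ^ k - 1) (1, 1) @ [(R, h)])"
    using W_replicate[of "[]" "2 ^ k - 1"] by simp
  finally show ?thesis
    using interspersed_bound[of "replicate (2 ^ k - 1) (1, 1) @ [(R, h)]"] h
    by (auto simp: Lb_one)
qed

end

end

section \<open>The Euler scheme on the uniform grid\<close>

locale euler_scheme = free_mult_bm F \<tau> x y b r s
  for F :: "('a::cstar_algebra \<Rightarrow> complex) set" and \<tau> x y b r s +
  fixes t :: real
  assumes t: "0 < t"
begin

abbreviation c :: real where "c \<equiv> (r - s) / 2"

definition h :: "nat \<Rightarrow> real" where "h N = t / real N"

definition E :: "nat \<Rightarrow> nat \<Rightarrow> 'a" where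
  "E N = euler (\<lambda>i. real i * h N)"

definition d :: "nat \<Rightarrow> nat \<Rightarrow> 'a" where
  "d N i = dw (real i * h N) (real (Suc i) * h N)"

definition \<delta> :: "nat \<Rightarrow> nat \<Rightarrow> 'a" where
  "\<delta> N i = d N i - (c * h N) *\<^sub>R 1"

text \<open>Chosen so that
  \<open>(1 + \<delta>) * star (1 + \<delta>) = 1 + \<delta>2\<close>.\<close>

definition \<delta>2 :: "nat \<Rightarrow> nat \<Rightarrow> 'a" where
  "\<delta>2 N i = \<delta> N i + star (\<delta> N i) + \<delta> N i * star (\<delta> N i)"

lemma h_pos: "0 < N \<Longrightarrow> 0 < h N"
  using t by (simp add: h_def)

lemma h_le: "0 < N \<Longrightarrow> h N \<le> t"
  using t by (simp add: h_def field_simps)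

lemma step_pos: "0 < N \<Longrightarrow> 0 \<le> real i * h N \<and> real i * h N < real (Suc i) * h N"
  using h_pos[of N] by (simp add: algebra_simps)

lemma step_diff: "real (Suc i) * h N - real i * h N = h N"
  by (simp add: algebra_simps)

lemma E_0 [simp]: "E N 0 = 1"
  by (simp add: E_def)

lemma E_Suc: "E N (Suc i) = E N i * (1 + \<delta> N i)"
  unfolding E_def euler_Suc step_diff \<delta>_def d_def by simp

lemma E_in_past: "0 < N \<Longrightarrow> E N i \<in> past (real i * h N)"
  unfolding E_def
  \<comment> \<open>The index \<open>i\<close> may exceed \<open>N\<close>, so the partition is
    taken to end at \<open>i * h N\<close> and not at \<open>t\<close>.\<close>
  by (rule euler_in_past[where t = "real i * h N" and m = i])
    (auto simp: is_partition_def algebra_simps dest: h_pos)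

lemma
  assumes "0 < N"
  shows d_mean: "\<tau> (d N i) = 0"
    and d_d: "\<tau> (d N i * d N i) = complex_of_real ((s - r) * h N)"
    and d_star: "\<tau> (d N i * star (d N i)) = complex_of_real ((r + s) * h N)"
    and d_Lb: "Lb (2 * (sqrt r + sqrt s) * sqrt (h N)) (d N i)"
  using tau_dw[OF conjunct1[OF step_pos[OF assms]] conjunct2[OF step_pos[OF assms]]]
    tau_dw_dw[OF conjunct1[OF step_pos[OF assms]] conjunct2[OF step_pos[OF assms]]]
    tau_dw_star[OF conjunct1[OF step_pos[OF assms]] conjunct2[OF step_pos[OF assms]]]
    Lb_dw[OF conjunct1[OF step_pos[OF assms]] conjunct2[OF step_pos[OF assms]]]
  unfolding d_def step_diff by blast+

lemma d_in_future: "d N i \<in> future (real i * h N) (real (Suc i) * h N)"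
  by (simp add: d_def dw_in_future)

lemma tau_adapted_future:
  assumes "0 < N" "a \<in> past (real i * h N)" "e \<in> future (real i * h N) (real (Suc i) * h N)"
  shows "\<tau> (a * e) = \<tau> a * \<tau> e"
proof -
  have "a \<in> biorth (past (real i * h N))" using assms(2) subset_biorth by blast
  then show ?thesis
    using tau_past_future[OF conjunct1[OF step_pos[OF assms(1)]] conjunct2[OF step_pos[OF assms(1)]]] assms(3)
    by blast
qed

lemma sqrt_h: "0 < N \<Longrightarrow> sqrt (h N) * sqrt (h N) = h N" "0 < N \<Longrightarrow> sqrt (h N) \<le> sqrt t"
  using h_pos[of N] h_le[of N] by auto

lemma \<delta>_Lb:
  obtains C where "0 \<le> C" "\<And>N i. 0 < N \<Longrightarrow> Lb (C * sqrt (h N)) (\<delta> N i)"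
proof (rule that)
  \<comment> \<open>The drift \<open>c * h\<close> is absorbed into order \<open>sqrt h\<close> by
    means of \<open>h \<le> t\<close>.\<close>
  let ?C = "2 * (sqrt r + sqrt s) + \<bar>c\<bar> * sqrt t"
  show "0 \<le> ?C" using r s t by simp
  fix N i :: nat assume N: "0 < N"
  have "Lb (2 * (sqrt r + sqrt s) * sqrt (h N) + \<bar>- (c * h N)\<bar> * 1) (d N i + (- (c * h N)) *\<^sub>R 1)"
    by (intro Lb_add Lb_scaleR Lb_one d_Lb N)
  moreover have "\<bar>- (c * h N)\<bar> \<le> \<bar>c\<bar> * sqrt t * sqrt (h N)"
  proof -
    have "\<bar>- (c * h N)\<bar> = \<bar>c\<bar> * (sqrt (h N) * sqrt (h N))"
      using h_pos[OF N] sqrt_h(1)[OF N] by (simp add: abs_mult)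
    also have "\<dots> \<le> \<bar>c\<bar> * (sqrt t * sqrt (h N))"
      using sqrt_h(2)[OF N] h_pos[OF N] by (intro mult_left_mono mult_right_mono) auto
    finally show ?thesis by (simp add: mult.assoc)
  qed
  moreover have "d N i + (- (c * h N)) *\<^sub>R 1 = \<delta> N i" by (simp add: \<delta>_def)
  ultimately show "Lb (?C * sqrt (h N)) (\<delta> N i)"
    using Lb_mono[of _ "\<delta> N i" "?C * sqrt (h N)"] by (simp add: distrib_right)
qed

text \<open>The terms of first order in the noise vanish by freeness and those of second order are
  \<open>O(h)\<close>, so each step multiplies the moment by at most \<open>1 + M * h\<close>.\<close>

lemma E_Lp_bounded:
  obtains C where "0 \<le> C" "\<And>N i. 0 < N \<Longrightarrow> i \<le> N \<Longrightarrow> Lp k (E N i) \<le> C"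
proof -
  define n :: nat where "n = 2 ^ k"
  obtain K1 where K1: "0 \<le> K1" "\<And>N i. 0 < N \<Longrightarrow> Lb (K1 * sqrt (h N)) (\<delta> N i)"
    using \<delta>_Lb by blast
  define K2 where "K2 = 2 * K1 + K1 * K1 * sqrt t"
  have K2: "0 \<le> K2" using K1(1) t by (simp add: K2_def)
  obtain C where C: "0 \<le> C" "\<And>K. 0 \<le> K \<Longrightarrow> K \<le> K2 * sqrt t \<Longrightarrow> (1 + K) ^ n - 1 - real n * K \<le> C * K\<^sup>2"
    using power_remainder_bound[of "K2 * sqrt t" n] K2 t by auto
  define R where "R = 2 * \<bar>c\<bar> + K1 * K1"
  have R: "0 \<le> R" using K1(1) by (simp add: R_def)
  \<comment> \<open>\<open>R * h\<close> bounds the part of \<open>\<delta>2\<close> that survives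
    in the linear term; \<open>C * K2\<^sup>2 * h\<close> bounds all words with two or more factors
    \<open>\<delta>2\<close>.\<close>
  define M where "M = real n * R + C * K2\<^sup>2"
  have M: "0 \<le> M" using R C(1) by (simp add: M_def)
  have step: "Lp k (E N (Suc i)) ^ 2 ^ Suc k \<le> Lp k (E N i) ^ 2 ^ Suc k * (1 + M * h N)"
    if N: "0 < N" for N i
  proof -
    define a where "a = star (E N i) * E N i"
    define g where "g = Lp k (E N i) ^ 2 ^ Suc k"
    define v where "v = 1 + \<delta> N i"
    \<comment> \<open>What remains of \<open>\<delta>2\<close> without its centred linear noise
      \<open>d + star d\<close>.\<close>
    define q where "q = (- (2 * c * h N)) *\<^sub>R 1 + \<delta> N i * star (\<delta> N i)"
    have g: "0 \<le> g" by (simp add: g_def)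
    have vv: "v * star v = 1 + \<delta>2 N i"
      by (simp add: v_def \<delta>2_def star_add ring_distribs add_ac)
    have \<delta>2: "\<delta>2 N i = d N i + star (d N i) + q"
      by (simp add: \<delta>2_def q_def \<delta>_def star_diff star_scaleR scaleR_left.add[symmetric] algebra_simps flip: scaleR_2)
    have dd: "Lb (K1 * sqrt (h N) * (K1 * sqrt (h N))) (\<delta> N i * star (\<delta> N i))"
      by (intro Lb_mult Lb_star K1 N)
    have "Lb (\<bar>- (2 * c * h N)\<bar> * 1 + K1 * sqrt (h N) * (K1 * sqrt (h N))) q"
      unfolding q_def by (intro Lb_add Lb_scaleR Lb_one dd)
    moreover have "\<bar>- (2 * c * h N)\<bar> * 1 + K1 * sqrt (h N) * (K1 * sqrt (h N)) = R * h N"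
    proof -
      have "\<bar>- (2 * c * h N)\<bar> = 2 * \<bar>c\<bar> * h N" using h_pos[OF N] by (simp only: abs_minus_cancel abs_mult)
      moreover have "K1 * sqrt (h N) * (K1 * sqrt (h N)) = K1 * K1 * h N"
        using sqrt_h(1)[OF N] by (metis mult.assoc mult.left_commute)
      ultimately show ?thesis by (simp add: R_def algebra_simps)
    qed
    ultimately have q: "Lb (R * h N) q" by simp
    have "Lb (K1 * sqrt (h N) + K1 * sqrt (h N) + K1 * sqrt (h N) * (K1 * sqrt (h N))) (\<delta>2 N i)"
      unfolding \<delta>2_def by (intro Lb_add Lb_star K1 N dd)
    moreover have "K1 * sqrt (h N) + K1 * sqrt (h N) + K1 * sqrt (h N) * (K1 * sqrt (h N)) \<le> K2 * sqrt (h N)"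
    proof -
      have "K1 * sqrt (h N) * (K1 * sqrt (h N)) \<le> K1 * sqrt t * (K1 * sqrt (h N))"
        using K1(1) sqrt_h(2)[OF N] h_pos[OF N] by (intro mult_right_mono mult_left_mono) auto
      then show ?thesis by (simp add: K2_def algebra_simps)
    qed
    ultimately have \<delta>2_Lb: "Lb (K2 * sqrt (h N)) (\<delta>2 N i)" by (rule Lb_mono)
    have a_past: "a ^ n \<in> past (real i * h N)"
      unfolding a_def by (intro subalgebra_power subalgebra_mult subalgebra_star past_subalgebra E_in_past N)
    have "\<tau> (a ^ n * d N i) = 0"
      using tau_adapted_future[OF N a_past d_in_future] d_mean[OF N] by simp
    moreover have "\<tau> (a ^ n * star (d N i)) = 0"
      using tau_adapted_future[OF N a_past subalgebra_star[OF future_subalgebra d_in_future]] d_mean[OF N]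
      by (simp add: tau_star)
    ultimately have lin: "\<tau> (a ^ n * \<delta>2 N i) = \<tau> (a ^ n * q)"
      by (simp add: \<delta>2 ring_distribs tau_add)
    have "Lp k (E N (Suc i)) ^ 2 ^ Suc k = cmod (\<tau> ((star v * (a * v)) ^ n))"
      by (simp add: Lp_pow_tau E_Suc v_def a_def n_def star_mult mult.assoc del: power_Suc)
    also have "\<tau> ((star v * (a * v)) ^ n) = \<tau> ((a * (1 + \<delta>2 N i)) ^ n)"
      by (subst tau_power_commute) (simp add: vv mult.assoc)
    also have "cmod \<dots> \<le> cmod (\<tau> (a ^ n)) + real n * cmod (\<tau> (a ^ n * q))
        + g * ((1 + K2 * sqrt (h N)) ^ n - 1 - real n * (K2 * sqrt (h N)))"
    proof -
      have 1: "cmod (\<tau> ((a * (1 + \<delta>2 N i)) ^ n) - \<tau> (a ^ n) - of_nat n * \<tau> (a ^ n * q))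
          \<le> g * ((1 + K2 * sqrt (h N)) ^ n - 1 - real n * (K2 * sqrt (h N)))"
        using tau_power_expansion[OF \<delta>2_Lb, of "E N i" k] lin
        unfolding a_def[symmetric] n_def[symmetric] g_def[symmetric] by simp
      have tri: "cmod z \<le> cmod w + m * cmod w' + B" if "cmod (z - w - of_nat n * w') \<le> B" "m = real n"
        for z w w' B m
        using that norm_triangle_ineq[of "z - w - of_nat n * w'" "w + of_nat n * w'"]
          norm_triangle_ineq[of w "of_nat n * w'"] by (simp add: norm_mult)
      show ?thesis by (rule tri[OF 1 refl])
    qed
    also have "\<dots> \<le> g + real n * (g * (R * h N)) + g * (C * (K2 * sqrt (h N))\<^sup>2)"
    proof (intro add_mono mult_left_mono g)
      show "cmod (\<tau> (a ^ n)) \<le> g" by (simp add: g_def a_def n_def Lp_pow_tau del: power_Suc)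
      show "cmod (\<tau> (a ^ n * q)) \<le> g * (R * h N)"
        unfolding a_def n_def g_def by (rule tau_power_mult_bound[OF q])
      show "(1 + K2 * sqrt (h N)) ^ n - 1 - real n * (K2 * sqrt (h N)) \<le> C * (K2 * sqrt (h N))\<^sup>2"
        using K2 h_pos[OF N] sqrt_h(2)[OF N] by (intro C(2) mult_left_mono mult_nonneg_nonneg) auto
    qed simp
    also have "\<dots> = g * (1 + M * h N)"
      using h_pos[OF N] by (simp add: M_def power_mult_distrib algebra_simps)
    finally show ?thesis by (simp add: g_def)
  qed
  have bound: "Lp k (E N i) ^ 2 ^ Suc k \<le> exp (M * (real i * h N))" if N: "0 < N" for N i
  proof (induction i)
    case (Suc i)
    have "Lp k (E N (Suc i)) ^ 2 ^ Suc k \<le> Lp k (E N i) ^ 2 ^ Suc k * (1 + M * h N)"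
      by (rule step[OF N])
    also have "\<dots> \<le> exp (M * (real i * h N)) * exp (M * h N)"
      using M h_pos[OF N] by (intro mult_mono Suc.IH exp_ge_add_one_self) auto
    also have "\<dots> = exp (M * (real (Suc i) * h N))" by (simp add: exp_add[symmetric] algebra_simps)
    finally show ?case .
  qed simp
  show thesis
  proof (rule that)
    show "0 \<le> exp (M * t)" by simp
    fix N i :: nat assume N: "0 < N" and i: "i \<le> N"
    have "real i * h N \<le> t" using t N i by (simp add: h_def field_simps)
    then have "exp (M * (real i * h N)) \<le> exp (M * t)" using M by (simp add: mult_left_mono)
    then have le: "Lp k (E N i) ^ 2 ^ Suc k \<le> exp (M * t)" using bound[OF N, of i] by linarith
    \<comment> \<open>The bound obtained is for a power of the norm. For a norm below 1 that power
      says nothing directly, but then the bound \<open>exp (M * t) \<ge> 1\<close> is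
      enough.\<close>
    show "Lp k (E N i) \<le> exp (M * t)"
    proof (cases "1 \<le> Lp k (E N i)")
      case True
      then have "Lp k (E N i) ^ 1 \<le> Lp k (E N i) ^ 2 ^ Suc k" by (intro power_increasing) auto
      then show ?thesis using le by simp
    next
      case False
      moreover have "1 \<le> exp (M * t)" using M t by simp
      ultimately show ?thesis by linarith
    qed
  qed
qed

end

section \<open>Uniform convergence of one-step schemes\<close>

text \<open>Uniform in the grid index, so that limits already obtained can serve on all of
  \<open>[0, t]\<close> as source terms of the next equation.\<close>

definition ulim :: "real \<Rightarrow> (nat \<Rightarrow> nat \<Rightarrow> complex) \<Rightarrow> (real \<Rightarrow> complex) \<Rightarrow> bool" where
  "ulim t m y \<longleftrightarrow> (\<forall>\<epsilon>>0. \<forall>\<^sub>F N in sequentially. \<forall>i\<le>N. cmod (m N i - y (real i * (t / real N))) \<le> \<epsilon>)"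

lemma ulimD: "ulim t m y \<Longrightarrow> 0 < \<epsilon> \<Longrightarrow>
    \<forall>\<^sub>F N in sequentially. \<forall>i\<le>N. cmod (m N i - y (real i * (t / real N))) \<le> \<epsilon>"
  by (simp add: ulim_def)

lemma grid_in_interval: "0 \<le> t \<Longrightarrow> 0 < N \<Longrightarrow> i \<le> N \<Longrightarrow> real i * (t / real N) \<in> {0..t}"
  by (simp add: field_simps mult_left_mono)

lemma ulim_const: "ulim t (\<lambda>N i. c) (\<lambda>u. c)"
  by (simp add: ulim_def)

lemma ulim_add:
  assumes "ulim t m y" "ulim t m' y'"
  shows "ulim t (\<lambda>N i. m N i + m' N i) (\<lambda>u. y u + y' u)"
  unfolding ulim_def
proof (intro allI impI)
  fix \<epsilon> :: real assume "0 < \<epsilon>"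
  then have "0 < \<epsilon> / 2" by simp
  from ulimD[OF assms(1) this] ulimD[OF assms(2) this]
  show "\<forall>\<^sub>F N in sequentially. \<forall>i\<le>N.
      cmod (m N i + m' N i - (y (real i * (t / real N)) + y' (real i * (t / real N)))) \<le> \<epsilon>"
  proof eventually_elim
    case (elim N)
    show ?case
    proof (intro allI impI)
      fix i assume "i \<le> N"
      then show "cmod (m N i + m' N i - (y (real i * (t / real N)) + y' (real i * (t / real N)))) \<le> \<epsilon>"
        using elim norm_triangle_ineq[of "m N i - y (real i * (t / real N))" "m' N i - y' (real i * (t / real N))"]
        by (fastforce simp: algebra_simps)
    qed
  qed
qed

lemma ulim_sum:
  "(\<And>j. j \<in> J \<Longrightarrow> ulim t (m j) (y j)) \<Longrightarrow> ulim t (\<lambda>N i. \<Sum>j\<in>J. m j N i) (\<lambda>u. \<Sum>j\<in>J. y j u)"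
  by (induction J rule: infinite_finite_induct) (auto intro: ulim_const ulim_add)

lemma ulim_mult:
  assumes t: "0 \<le> t" and m: "ulim t m y" "ulim t m' y'"
    and cont: "continuous_on {0..t} y" "continuous_on {0..t} y'"
  shows "ulim t (\<lambda>N i. m N i * m' N i) (\<lambda>u. y u * y' u)"
  unfolding ulim_def
proof (intro allI impI)
  fix \<epsilon> :: real assume \<epsilon>: "0 < \<epsilon>"
  have "bounded (y ` {0..t})" "bounded (y' ` {0..t})"
    using cont by (auto intro!: compact_imp_bounded compact_continuous_image)
  then obtain B B' where B: "0 < B" "\<And>u. u \<in> {0..t} \<Longrightarrow> cmod (y u) \<le> B"
      "0 < B'" "\<And>u. u \<in> {0..t} \<Longrightarrow> cmod (y' u) \<le> B'"
    unfolding bounded_pos by (metis image_eqI)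
  define e where "e = min 1 (\<epsilon> / (B + B' + 1))"
  have "e \<le> \<epsilon> / (B + B' + 1)" by (simp add: e_def)
  then have "e * (B + B' + 1) \<le> \<epsilon>" using B by (simp add: pos_le_divide_eq)
  moreover have "0 < e" "e \<le> 1" using \<epsilon> B by (simp_all add: e_def)
  ultimately have e: "0 < e" "e \<le> 1" "e * (B + B' + 1) \<le> \<epsilon>" by simp_all
  have "\<forall>\<^sub>F N in sequentially. 0 < N" by (rule eventually_gt_at_top)
  with ulimD[OF m(1) e(1)] ulimD[OF m(2) e(1)]
  show "\<forall>\<^sub>F N in sequentially. \<forall>i\<le>N.
      cmod (m N i * m' N i - y (real i * (t / real N)) * y' (real i * (t / real N))) \<le> \<epsilon>"
  proof eventually_elim
    case (elim N)
    show ?case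
    proof (intro allI impI)
      fix i assume i: "i \<le> N"
      let ?u = "real i * (t / real N)"
      have u: "?u \<in> {0..t}" using grid_in_interval[OF t elim(3) i] .
      have 1: "cmod (m N i - y ?u) \<le> e" "cmod (m' N i - y' ?u) \<le> e" using elim i by auto
      have "m N i * m' N i - y ?u * y' ?u = (m N i - y ?u) * (m' N i - y' ?u)
          + (m N i - y ?u) * y' ?u + y ?u * (m' N i - y' ?u)" by (simp add: algebra_simps)
      then have "cmod (m N i * m' N i - y ?u * y' ?u) \<le> cmod (m N i - y ?u) * cmod (m' N i - y' ?u)
          + cmod (m N i - y ?u) * cmod (y' ?u) + cmod (y ?u) * cmod (m' N i - y' ?u)"
        by (metis (no_types, opaque_lifting) norm_mult norm_triangle_ineq norm_triangle_le add_mono order_refl)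
      also have "\<dots> \<le> e * 1 + e * B' + B * e"
        using 1 e B(2)[OF u] B(4)[OF u] B(1) by (intro add_mono mult_mono) auto
      also have "\<dots> \<le> \<epsilon>" using e(3) by (simp add: algebra_simps)
      finally show "cmod (m N i * m' N i - y ?u * y' ?u) \<le> \<epsilon>" .
    qed
  qed
qed

text \<open>A local error of order \<open>h powr (3 / 2)\<close> is enough, since the
  \<open>t / h\<close> steps accumulate only order \<open>sqrt h\<close>. The source
  \<open>G\<close> may be a mere approximation of \<open>g\<close>, as the induction over moments
  requires.\<close>

lemma ulim_ODE:
  fixes m G :: "nat \<Rightarrow> nat \<Rightarrow> complex" and y g :: "real \<Rightarrow> complex"
  assumes t: "0 < t" and init: "\<And>N. m N 0 = y 0"
    and der: "\<And>u. (y has_vector_derivative (\<alpha> * y u + g u)) (at u)"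
    and cont: "continuous_on {0..t} g" and G: "ulim t G g"
    and C: "0 \<le> C"
    and step: "\<And>N i. 0 < N \<Longrightarrow> i < N \<Longrightarrow> cmod (m N (Suc i) - m N i
        - complex_of_real (t / real N) * (\<alpha> * m N i + G N i)) \<le> C * sqrt (t / real N) ^ 3"
  shows "ulim t m y"
  unfolding ulim_def
proof (intro allI impI)
  fix \<epsilon> :: real assume \<epsilon>: "0 < \<epsilon>"
  define A where "A = cmod \<alpha>"
  have A: "0 \<le> A" by (simp add: A_def)
  \<comment> \<open>Every step adds three errors of size at most \<open>h * e\<close>; they are
    summed over total time \<open>t\<close> and amplified by at most
    \<open>exp (A * t)\<close>.\<close>
  define e where "e = \<epsilon> / (3 * t * exp (A * t))"
  have e: "0 < e" using \<epsilon> t by (simp add: e_def)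
  define y' where "y' u = \<alpha> * y u + g u" for u
  have "continuous_on {0..t} y"
    using der by (intro continuous_at_imp_continuous_on ballI has_vector_derivative_continuous)
  then have "continuous_on {0..t} y'"
    unfolding y'_def by (intro continuous_intros cont)
  then have "uniformly_continuous_on {0..t} y'"
    by (intro compact_uniformly_continuous) auto
  then obtain \<rho> where \<rho>: "0 < \<rho>"
    "\<And>u v. u \<in> {0..t} \<Longrightarrow> v \<in> {0..t} \<Longrightarrow> dist v u < \<rho> \<Longrightarrow> dist (y' v) (y' u) < e"
    using e unfolding uniformly_continuous_on_def by metis
  have lim: "(\<lambda>N. t / real N) \<longlonglongrightarrow> 0" by (rule lim_const_over_n)
  have "(\<lambda>N. C * sqrt (t / real N)) \<longlonglongrightarrow> C * sqrt 0" by (intro tendsto_intros lim)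
  then have "\<forall>\<^sub>F N in sequentially. C * sqrt (t / real N) < e"
    using e by (intro order_tendstoD) auto
  moreover have "\<forall>\<^sub>F N in sequentially. t / real N < \<rho>"
    using lim \<rho> by (intro order_tendstoD) auto
  moreover have "\<forall>\<^sub>F N in sequentially. 0 < N" by (rule eventually_gt_at_top)
  ultimately show "\<forall>\<^sub>F N in sequentially. \<forall>i\<le>N. cmod (m N i - y (real i * (t / real N))) \<le> \<epsilon>"
    using ulimD[OF G e]
  proof eventually_elim
    case (elim N)
    define h where "h = t / real N"
    have h: "0 < h" using t elim by (simp add: h_def)
    define u where "u i = real i * h" for i
    have uS: "u (Suc i) = u i + h" for i by (simp add: u_def algebra_simps)
    have u: "u i \<in> {0..t}" if "i \<le> N" for i
      unfolding u_def h_def using grid_in_interval[OF less_imp_le[OF t] elim(3) that] .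
    have main: "cmod (m N i - y (u i)) \<le> u i * (3 * e) * exp (A * u i)" if "i \<le> N" for i
      using that
    proof (induction i)
      case 0
      then show ?case by (simp add: u_def init)
    next
      case (Suc i)
      define err where "err = m N i - y (u i)"
      have IH: "cmod err \<le> u i * (3 * e) * exp (A * u i)" using Suc by (simp add: err_def)
      have i: "i < N" "i \<le> N" using Suc.prems by auto
      have ui: "u i \<in> {0..t}" "u (Suc i) \<in> {0..t}" using u i Suc.prems by auto
      have 1: "cmod (m N (Suc i) - m N i - h * (\<alpha> * m N i + G N i)) \<le> h * e"
      proof -
        have "cmod (m N (Suc i) - m N i - h * (\<alpha> * m N i + G N i)) \<le> C * sqrt h ^ 3"
          using step[OF elim(3) i(1)] by (simp add: h_def)
        also have "C * sqrt h ^ 3 = h * (C * sqrt h)"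
          using h by (simp add: power3_eq_cube)
        also have "\<dots> \<le> h * e" using elim(1) h by (intro mult_left_mono) (auto simp: h_def)
        finally show ?thesis .
      qed
      have 2: "cmod (h * (G N i - g (u i))) \<le> h * e"
      proof -
        have "cmod (G N i - g (u i)) \<le> e" using elim(4) i by (simp add: u_def h_def)
        then show ?thesis using h by (simp add: norm_mult)
      qed
      have 3: "cmod (y (u (Suc i)) - y (u i) - h * y' (u i)) \<le> h * e"
      proof -
        have "norm (y (u (Suc i)) - y (u i) - (u (Suc i) - u i) *\<^sub>R y' (u i)) \<le> norm (u (Suc i) - u i) * e"
        proof (rule vector_differentiable_bound_linearization[where S = "{u i..u (Suc i)}"])
          show "(y has_vector_derivative y' v) (at v within {u i..u (Suc i)})" for v
            using der[of v] unfolding y'_def by (rule has_vector_derivative_at_within)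
          show "closed_segment (u i) (u (Suc i)) \<subseteq> {u i..u (Suc i)}"
            using h by (simp add: closed_segment_eq_real_ivl uS)
          show "norm (y' v - y' (u i)) \<le> e" if "v \<in> {u i..u (Suc i)}" for v
          proof -
            have "dist v (u i) < \<rho>" using that elim(2) by (auto simp: dist_real_def uS h_def)
            moreover have "v \<in> {0..t}" using that ui by auto
            ultimately show ?thesis using \<rho>(2)[OF ui(1)] by (simp add: dist_norm less_imp_le)
          qed
          show "u i \<in> {u i..u (Suc i)}" using h by (simp add: uS)
        qed
        then show ?thesis using h by (simp add: uS scaleR_conv_of_real mult.commute)
      qed
      have "m N (Suc i) - y (u (Suc i)) = (m N (Suc i) - m N i - h * (\<alpha> * m N i + G N i))
          + h * (G N i - g (u i)) - (y (u (Suc i)) - y (u i) - h * y' (u i)) + (err + h * \<alpha> * err)"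
        by (simp add: err_def y'_def algebra_simps)
      also have "cmod \<dots> \<le> h * e + h * e + h * e + (cmod err + h * A * cmod err)"
      proof -
        have "cmod (err + h * \<alpha> * err) \<le> cmod err + h * A * cmod err"
          using norm_triangle_ineq[of err "h * \<alpha> * err"] h by (simp add: norm_mult A_def)
        moreover have "cmod (p + q - v + w) \<le> cmod p + cmod q + cmod v + cmod w" for p q v w :: complex
          using norm_triangle_ineq[of "p + q - v" w] norm_triangle_ineq4[of "p + q" v]
            norm_triangle_ineq[of p q] by linarith
        ultimately show ?thesis
          using 1 2 3 by (meson add_mono order_trans)
      qed
      also have "\<dots> = (1 + A * h) * cmod err + 3 * e * h" by (simp add: algebra_simps)
      also have "\<dots> \<le> exp (A * h) * (u i * (3 * e) * exp (A * u i)) + 3 * e * h * exp (A * u (Suc i))"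
      proof (rule add_mono)
        show "(1 + A * h) * cmod err \<le> exp (A * h) * (u i * (3 * e) * exp (A * u i))"
          by (intro mult_mono IH exp_ge_add_one_self) auto
        show "3 * e * h \<le> 3 * e * h * exp (A * u (Suc i))"
          using e h A ui by simp
      qed
      also have "\<dots> = u (Suc i) * (3 * e) * exp (A * u (Suc i))"
        by (simp add: uS exp_add algebra_simps)
      finally show ?case .
    qed
    show ?case
    proof (intro allI impI)
      fix i assume i: "i \<le> N"
      have "cmod (m N i - y (u i)) \<le> u i * (3 * e) * exp (A * u i)" by (rule main[OF i])
      also have "\<dots> \<le> t * (3 * e) * exp (A * t)"
        using u[OF i] e A by (intro mult_mono) (auto intro: mult_left_mono)
      also have "\<dots> = \<epsilon>" using t by (simp add: e_def)
      finally show "cmod (m N i - y (real i * (t / real N))) \<le> \<epsilon>" by (simp add: u_def h_def)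
    qed
  qed
qed

section \<open>Moment recursions\<close>

text \<open>Counts pairs of noise positions in a word of length \<open>n\<close> by their distance:
  distance \<open>m\<close> occurs \<open>n - m\<close> times, and the symmetry between
  \<open>m\<close> and \<open>n - m\<close> averages this weight to \<open>n / 2\<close>.\<close>

lemma double_sum_symmetric:
  fixes f :: "nat \<Rightarrow> complex"
  assumes "\<And>m. 0 < m \<Longrightarrow> m < n \<Longrightarrow> f (n - m) = f m"
  shows "2 * (\<Sum>l<n. \<Sum>j<l. f (l - j)) = of_nat n * (\<Sum>m=1..<n. f m)"
proof -
  have inner: "(\<Sum>j<l. f (l - j)) = (\<Sum>m=1..l. f m)" for l
    by (rule sum.reindex_bij_witness[of _ "\<lambda>m. l - m" "\<lambda>j. l - j"]) auto
  have "(\<Sum>l<n. \<Sum>m=1..l. f m) = (\<Sum>m=1..<n. of_nat (n - m) * f m)"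
  proof (induction n)
    case (Suc n)
    have "(\<Sum>m=1..<Suc n. of_nat (Suc n - m) * f m) = (\<Sum>m=1..<Suc n. of_nat (n - m) * f m + f m)"
      by (intro sum.cong refl) (simp add: Suc_diff_le algebra_simps)
    also have "\<dots> = (\<Sum>m=1..<n. of_nat (n - m) * f m) + (\<Sum>m=1..n. f m)"
      by (cases "n = 0") (simp_all add: sum.distrib atLeastLessThanSuc_atLeastAtMost[symmetric])
    finally show ?case using Suc by simp
  qed simp
  then have S: "(\<Sum>l<n. \<Sum>j<l. f (l - j)) = (\<Sum>m=1..<n. of_nat (n - m) * f m)"
    by (simp add: inner)
  also have "\<dots> = (\<Sum>m=1..<n. of_nat m * f m)"
    by (rule sum.reindex_bij_witness[of _ "\<lambda>m. n - m" "\<lambda>m. n - m"]) (auto simp: assms)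
  finally have "2 * (\<Sum>l<n. \<Sum>j<l. f (l - j)) = (\<Sum>m=1..<n. of_nat (n - m) * f m) + (\<Sum>m=1..<n. of_nat m * f m)"
    using S by simp
  also have "\<dots> = (\<Sum>m=1..<n. of_nat n * f m)"
    unfolding sum.distrib[symmetric] by (intro sum.cong refl) (simp flip: distrib_right of_nat_add)
  finally show ?thesis by (simp add: sum_distrib_left)
qed

section \<open>Orders in the step size, adapted families and noise\<close>

context euler_scheme
begin

text \<open>Orders are counted in powers of \<open>sqrt h\<close>, the size of the noise. All levels
  are bounded together because \<open>Lp_mult\<close> uses up one level per product.\<close>

definition bigO :: "nat \<Rightarrow> (nat \<Rightarrow> nat \<Rightarrow> 'a) \<Rightarrow> bool" where
  "bigO p z \<longleftrightarrow> (\<forall>k. \<exists>C\<ge>0. \<forall>N>0. \<forall>i\<le>N. Lp k (z N i) \<le> C * sqrt (h N) ^ p)"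

text \<open>The local error that \<open>ulim_ODE\<close> tolerates.\<close>

definition negl :: "(nat \<Rightarrow> nat \<Rightarrow> complex) \<Rightarrow> bool" where
  "negl f \<longleftrightarrow> (\<exists>C\<ge>0. \<forall>N>0. \<forall>i\<le>N. cmod (f N i) \<le> C * sqrt (h N) ^ 3)"

lemma bigOE:
  assumes "bigO p z"
  obtains C where "0 \<le> C" "\<And>N i. 0 < N \<Longrightarrow> i \<le> N \<Longrightarrow> Lp k (z N i) \<le> C * sqrt (h N) ^ p"
  using assms unfolding bigO_def by meson

lemma bigOI:
  assumes "\<And>k. \<exists>C\<ge>0. \<forall>N>0. \<forall>i\<le>N. Lp k (z N i) \<le> C * sqrt (h N) ^ p"
  shows "bigO p z"
  using assms by (simp add: bigO_def)

lemma bigO_cong: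
  assumes "bigO p z" "\<And>N i. 0 < N \<Longrightarrow> z' N i = z N i"
  shows "bigO p z'"
  using assms by (simp add: bigO_def)

lemma sqrt_h_nonneg: "0 < N \<Longrightarrow> 0 \<le> sqrt (h N)"
  using h_pos[of N] by simp

lemma bigO_mono:
  assumes z: "bigO p z" and pq: "q \<le> p"
  shows "bigO q z"
proof (rule bigOI)
  fix k
  obtain C where C: "0 \<le> C" "\<And>N i. 0 < N \<Longrightarrow> i \<le> N \<Longrightarrow> Lp k (z N i) \<le> C * sqrt (h N) ^ p"
    using bigOE[OF z] by blast
  have "Lp k (z N i) \<le> (C * sqrt t ^ (p - q)) * sqrt (h N) ^ q" if "0 < N" "i \<le> N" for N i
  proof -
    have "sqrt (h N) ^ p = sqrt (h N) ^ (p - q) * sqrt (h N) ^ q"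
      using pq by (simp flip: power_add)
    also have "\<dots> \<le> sqrt t ^ (p - q) * sqrt (h N) ^ q"
      using sqrt_h_nonneg[OF that(1)] sqrt_h(2)[OF that(1)] by (intro mult_right_mono power_mono) auto
    finally have "C * sqrt (h N) ^ p \<le> C * (sqrt t ^ (p - q) * sqrt (h N) ^ q)"
      using C(1) by (rule mult_left_mono)
    then show ?thesis using C(2)[OF that] by (simp add: mult.assoc)
  qed
  then show "\<exists>C\<ge>0. \<forall>N>0. \<forall>i\<le>N. Lp k (z N i) \<le> C * sqrt (h N) ^ q"
    using C(1) t by (intro exI[of _ "C * sqrt t ^ (p - q)"]) auto
qed

lemma bigO_add:
  assumes "bigO p z" "bigO p z'"
  shows "bigO p (\<lambda>N i. z N i + z' N i)"
proof (rule bigOI)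
  fix k
  obtain C where C: "0 \<le> C" "\<And>N i. 0 < N \<Longrightarrow> i \<le> N \<Longrightarrow> Lp k (z N i) \<le> C * sqrt (h N) ^ p"
    using bigOE[OF assms(1)] by blast
  obtain C' where C': "0 \<le> C'" "\<And>N i. 0 < N \<Longrightarrow> i \<le> N \<Longrightarrow> Lp k (z' N i) \<le> C' * sqrt (h N) ^ p"
    using bigOE[OF assms(2)] by blast
  have "Lp k (z N i + z' N i) \<le> (C + C') * sqrt (h N) ^ p" if "0 < N" "i \<le> N" for N i
    using Lp_triangle[of k "z N i" "z' N i"] C(2)[OF that] C'(2)[OF that] by (simp add: distrib_right)
  then show "\<exists>C\<ge>0. \<forall>N>0. \<forall>i\<le>N. Lp k (z N i + z' N i) \<le> C * sqrt (h N) ^ p"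
    using C(1) C'(1) by (intro exI[of _ "C + C'"]) auto
qed

lemma bigO_minus: "bigO p z \<Longrightarrow> bigO p (\<lambda>N i. - z N i)"
  by (simp add: bigO_def)

lemma bigO_diff: "bigO p z \<Longrightarrow> bigO p z' \<Longrightarrow> bigO p (\<lambda>N i. z N i - z' N i)"
  using bigO_add[OF _ bigO_minus, of p z z'] by simp

lemma bigO_zero: "bigO p (\<lambda>N i. 0)"
  by (auto simp: bigO_def intro!: exI[of _ 0])

lemma bigO_sum:
  "(\<And>j. j \<in> J \<Longrightarrow> bigO p (z j)) \<Longrightarrow> bigO p (\<lambda>N i. \<Sum>j\<in>J. z j N i)"
  by (induction J rule: infinite_finite_induct) (auto intro: bigO_zero bigO_add)

lemma bigO_star: "bigO p z \<Longrightarrow> bigO p (\<lambda>N i. star (z N i))"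
  by (simp add: bigO_def)

lemma bigO_mult:
  assumes "bigO p z" "bigO q z'"
  shows "bigO (p + q) (\<lambda>N i. z N i * z' N i)"
proof (rule bigOI)
  fix k
  obtain C where C: "0 \<le> C" "\<And>N i. 0 < N \<Longrightarrow> i \<le> N \<Longrightarrow> Lp (Suc k) (z N i) \<le> C * sqrt (h N) ^ p"
    using bigOE[OF assms(1)] by blast
  obtain C' where C': "0 \<le> C'" "\<And>N i. 0 < N \<Longrightarrow> i \<le> N \<Longrightarrow> Lp (Suc k) (z' N i) \<le> C' * sqrt (h N) ^ q"
    using bigOE[OF assms(2)] by blast
  have "Lp k (z N i * z' N i) \<le> (C * C') * sqrt (h N) ^ (p + q)" if N: "0 < N" "i \<le> N" for N i
  proof -
    have "Lp k (z N i * z' N i) \<le> Lp (Suc k) (z N i) * Lp (Suc k) (z' N i)" by (rule Lp_mult)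
    also have "\<dots> \<le> (C * sqrt (h N) ^ p) * (C' * sqrt (h N) ^ q)"
      using C(2)[OF N] C'(2)[OF N] C(1) sqrt_h_nonneg[OF N(1)]
      by (intro mult_mono mult_nonneg_nonneg zero_le_power) auto
    finally show ?thesis by (simp add: power_add mult_ac)
  qed
  then show "\<exists>C\<ge>0. \<forall>N>0. \<forall>i\<le>N. Lp k (z N i * z' N i) \<le> C * sqrt (h N) ^ (p + q)"
    using C(1) C'(1) by (intro exI[of _ "C * C'"]) auto
qed

lemma bigO_const: "bigO 0 (\<lambda>N i. z)"
  by (rule bigOI) (auto intro: exI[of _ "Lp _ z"])

lemma bigO_power: "bigO 0 z \<Longrightarrow> bigO 0 (\<lambda>N i. z N i ^ n)"
  by (induction n) (use bigO_const bigO_mult[of 0 z 0] in auto)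

lemma bigO_Lb:
  assumes "0 \<le> C" "\<And>N i. 0 < N \<Longrightarrow> Lb (C * sqrt (h N) ^ p) (z N i)"
  shows "bigO p z"
  by (rule bigOI) (use assms in \<open>auto intro!: exI[of _ C] Lp_Lb\<close>)

lemma bigO_h: "bigO 2 (\<lambda>N i. (w * h N) *\<^sub>R 1)"
proof (rule bigOI)
  fix k
  have "Lp k ((w * h N) *\<^sub>R 1) \<le> \<bar>w\<bar> * sqrt (h N) ^ 2" if "0 < N" for N
    using h_pos[OF that] by (simp add: Lp_scaleR abs_mult)
  then show "\<exists>C\<ge>0. \<forall>N>0. \<forall>i\<le>N. Lp k ((w * h N) *\<^sub>R 1) \<le> C * sqrt (h N) ^ 2"
    by (intro exI[of _ "\<bar>w\<bar>"]) auto
qed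

lemma bigO_E: "bigO 0 E"
proof (rule bigOI)
  fix k
  obtain C where "0 \<le> C" "\<And>N i. 0 < N \<Longrightarrow> i \<le> N \<Longrightarrow> Lp k (E N i) \<le> C"
    using E_Lp_bounded by blast
  then show "\<exists>C\<ge>0. \<forall>N>0. \<forall>i\<le>N. Lp k (E N i) \<le> C * sqrt (h N) ^ 0"
    by (intro exI[of _ C]) simp
qed

lemma bigO_d: "bigO 1 d"
  by (rule bigO_Lb[where C = "2 * (sqrt r + sqrt s)"]) (use r s d_Lb in auto)

lemma negl_cong: "negl g \<Longrightarrow> (\<And>N i. 0 < N \<Longrightarrow> f N i = g N i) \<Longrightarrow> negl f"
  by (simp add: negl_def)

lemma negl_tau: assumes "bigO 3 z" shows "negl (\<lambda>N i. \<tau> (z N i))"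
proof -
  obtain C where C: "0 \<le> C" "\<And>N i. 0 < N \<Longrightarrow> i \<le> N \<Longrightarrow> Lp 0 (z N i) \<le> C * sqrt (h N) ^ 3"
    using bigOE[OF assms] by blast
  then show ?thesis
    unfolding negl_def by (intro exI[of _ C]) (auto intro: order_trans[OF cmod_tau_le_Lp])
qed

lemma negl_zero: "negl (\<lambda>N i. 0)"
  by (auto simp: negl_def intro!: exI[of _ 0])

lemma negl_add:
  assumes "negl f" "negl g"
  shows "negl (\<lambda>N i. f N i + g N i)"
proof -
  obtain C C' where C: "0 \<le> C" "\<And>N i. 0 < N \<Longrightarrow> i \<le> N \<Longrightarrow> cmod (f N i) \<le> C * sqrt (h N) ^ 3"
    "0 \<le> C'" "\<And>N i. 0 < N \<Longrightarrow> i \<le> N \<Longrightarrow> cmod (g N i) \<le> C' * sqrt (h N) ^ 3"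
    using assms unfolding negl_def by meson
  have "cmod (f N i + g N i) \<le> (C + C') * sqrt (h N) ^ 3" if "0 < N" "i \<le> N" for N i
    using norm_triangle_ineq[of "f N i" "g N i"] C(2)[OF that] C(4)[OF that] by (simp add: distrib_right)
  then show ?thesis unfolding negl_def using C by (intro exI[of _ "C + C'"]) auto
qed

lemma negl_cmult: "negl f \<Longrightarrow> negl (\<lambda>N i. w * f N i)"
proof -
  assume "negl f"
  then obtain C where C: "0 \<le> C" "\<And>N i. 0 < N \<Longrightarrow> i \<le> N \<Longrightarrow> cmod (f N i) \<le> C * sqrt (h N) ^ 3"
    unfolding negl_def by meson
  then show ?thesis unfolding negl_def
    by (intro exI[of _ "cmod w * C"]) (auto simp: norm_mult mult.assoc intro: mult_left_mono)
qed

lemma negl_sum: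
  "(\<And>j. j \<in> J \<Longrightarrow> negl (f j)) \<Longrightarrow> negl (\<lambda>N i. \<Sum>j\<in>J. f j N i)"
  by (induction J rule: infinite_finite_induct) (auto intro: negl_zero negl_add)

definition adapted :: "(nat \<Rightarrow> nat \<Rightarrow> 'a) \<Rightarrow> bool" where
  "adapted a \<longleftrightarrow> bigO 0 a \<and> (\<forall>N>0. \<forall>i. a N i \<in> past (real i * h N))"

lemma adapted_E: "adapted E"
  by (simp add: adapted_def bigO_E E_in_past)

lemma adapted_mult: "adapted a \<Longrightarrow> adapted a' \<Longrightarrow> adapted (\<lambda>N i. a N i * a' N i)"
  using bigO_mult[of 0 a 0 a'] by (auto simp: adapted_def intro: subalgebra_mult past_subalgebra)

lemma adapted_star: "adapted a \<Longrightarrow> adapted (\<lambda>N i. star (a N i))"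
  by (auto simp: adapted_def intro: subalgebra_star past_subalgebra bigO_star)

lemma adapted_power: "adapted a \<Longrightarrow> adapted (\<lambda>N i. a N i ^ n)"
  by (auto simp: adapted_def intro: subalgebra_power past_subalgebra bigO_power)

definition noise :: "(nat \<Rightarrow> nat \<Rightarrow> 'a) \<Rightarrow> bool" where
  "noise e \<longleftrightarrow> bigO 1 e \<and>
     (\<forall>N>0. \<forall>i. e N i \<in> future (real i * h N) (real (Suc i) * h N) \<and> \<tau> (e N i) = 0)"

lemma noise_d: "noise d"
  unfolding noise_def using bigO_d d_in_future d_mean by blast

lemma noise_star: "noise e \<Longrightarrow> noise (\<lambda>N i. star (e N i))"
  by (auto simp: noise_def tau_star intro: bigO_star subalgebra_star future_subalgebra)

lemma noise_add: "noise e \<Longrightarrow> noise e' \<Longrightarrow> noise (\<lambda>N i. e N i + e' N i)"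
  by (auto simp: noise_def tau_add intro: bigO_add subalgebra_add future_subalgebra)

text \<open>\<open>increment \<delta>' e \<kappa>\<close>: up to negligible terms, \<open>\<delta>'\<close> is the martingale increment \<open>e\<close> plus the
  drift \<open>\<kappa> h\<close>.\<close>

definition increment :: "(nat \<Rightarrow> nat \<Rightarrow> 'a) \<Rightarrow> (nat \<Rightarrow> nat \<Rightarrow> 'a) \<Rightarrow> real \<Rightarrow> bool" where
  "increment \<delta>' e \<kappa> \<longleftrightarrow> noise e \<and> bigO 2 (\<lambda>N i. \<delta>' N i - e N i) \<and>
     (\<forall>a. adapted a \<longrightarrow> negl (\<lambda>N i. \<tau> (a N i * \<delta>' N i) - complex_of_real (\<kappa> * h N) * \<tau> (a N i)))"

lemma increment_bigO: assumes "increment \<delta>' e \<kappa>" shows "bigO 1 \<delta>'"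
proof -
  have "bigO 2 (\<lambda>N i. \<delta>' N i - e N i)" and e: "bigO 1 e"
    using assms unfolding increment_def noise_def by blast+
  then have "bigO 1 (\<lambda>N i. \<delta>' N i - e N i)" by (elim bigO_mono) simp
  from bigO_add[OF this e] show ?thesis by simp
qed

lemma tau_adapted_noise:
  "adapted a \<Longrightarrow> noise e \<Longrightarrow> 0 < N \<Longrightarrow> \<tau> (a N i * e N i) = 0"
  using tau_adapted_future[of N "a N i" i "e N i"] by (simp add: adapted_def noise_def)

text \<open>Replacing first \<open>\<delta>'\<close> and then \<open>\<delta>''\<close> by its noise
  part costs terms of order 2 + 1 and 1 + 2 in \<open>sqrt h\<close>. The alternating word that
  remains is evaluated exactly by freeness.\<close>

lemma increment_pair:
  assumes a: "adapted a" "adapted a'" and \<delta>: "increment \<delta>' e \<kappa>" "increment \<delta>'' e' \<kappa>'"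
    and cov: "\<And>N i. 0 < N \<Longrightarrow> \<tau> (e N i * e' N i) = complex_of_real (\<rho> * h N)"
  shows "negl (\<lambda>N i. \<tau> (a N i * \<delta>' N i * a' N i * \<delta>'' N i)
    - complex_of_real (\<rho> * h N) * (\<tau> (a N i) * \<tau> (a' N i)))"
proof -
  have e: "noise e" "noise e'" using \<delta> by (auto simp: increment_def)
  have O: "bigO 0 a" "bigO 0 a'" "bigO 1 \<delta>''" "bigO 1 e" "bigO 2 (\<lambda>N i. \<delta>' N i - e N i)"
    "bigO 2 (\<lambda>N i. \<delta>'' N i - e' N i)"
    using a \<delta> e increment_bigO[OF \<delta>(2)] by (auto simp: adapted_def noise_def increment_def)
  have "bigO (0 + 2 + 0 + 1) (\<lambda>N i. a N i * (\<delta>' N i - e N i) * a' N i * \<delta>'' N i)"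
    by (intro bigO_mult O)
  moreover have "bigO (0 + 1 + 0 + 2) (\<lambda>N i. a N i * e N i * a' N i * (\<delta>'' N i - e' N i))"
    by (intro bigO_mult O)
  ultimately have "bigO 3 (\<lambda>N i. a N i * (\<delta>' N i - e N i) * a' N i * \<delta>'' N i
      + a N i * e N i * a' N i * (\<delta>'' N i - e' N i))"
    by (intro bigO_add) (simp_all add: numeral_3_eq_3)
  then have "negl (\<lambda>N i. \<tau> (a N i * (\<delta>' N i - e N i) * a' N i * \<delta>'' N i
      + a N i * e N i * a' N i * (\<delta>'' N i - e' N i)))"
    by (rule negl_tau)
  then show ?thesis
  proof (rule negl_cong)
    fix N i :: nat assume N: "0 < N"
    have "\<tau> (a N i * e N i * a' N i * e' N i) = \<tau> (a N i) * \<tau> (a' N i) * \<tau> (e N i * e' N i)"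
      by (rule tau_past_future_alternating[OF conjunct1[OF step_pos[OF N]] conjunct2[OF step_pos[OF N]]])
        (use a e N in \<open>auto simp: adapted_def noise_def\<close>)
    then show "\<tau> (a N i * \<delta>' N i * a' N i * \<delta>'' N i)
      - complex_of_real (\<rho> * h N) * (\<tau> (a N i) * \<tau> (a' N i))
      = \<tau> (a N i * (\<delta>' N i - e N i) * a' N i * \<delta>'' N i
      + a N i * e N i * a' N i * (\<delta>'' N i - e' N i))"
      by (simp add: cov[OF N] tau_add tau_diff ring_distribs mult_ac)
  qed
qed

lemma increment_\<delta>: "increment \<delta> d (- c)"
  unfolding increment_def
proof (intro conjI allI impI)
  show "noise d" by (rule noise_d)
  show "bigO 2 (\<lambda>N i. \<delta> N i - d N i)"
    using bigO_h[of "- c"] by (simp add: \<delta>_def)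
  fix a assume a: "adapted a"
  show "negl (\<lambda>N i. \<tau> (a N i * \<delta> N i) - complex_of_real (- c * h N) * \<tau> (a N i))"
    by (rule negl_cong[OF negl_zero])
      (simp add: \<delta>_def right_diff_distrib tau_diff tau_scaleR tau_adapted_noise[OF a noise_d])
qed

lemma increment_\<delta>_star: "increment (\<lambda>N i. star (\<delta> N i)) (\<lambda>N i. star (d N i)) (- c)"
  unfolding increment_def
proof (intro conjI allI impI)
  show "noise (\<lambda>N i. star (d N i))" by (rule noise_star[OF noise_d])
  show "bigO 2 (\<lambda>N i. star (\<delta> N i) - star (d N i))"
    using bigO_h[of "- c"] by (simp add: \<delta>_def star_diff star_scaleR)
  fix a assume a: "adapted a"
  show "negl (\<lambda>N i. \<tau> (a N i * star (\<delta> N i)) - complex_of_real (- c * h N) * \<tau> (a N i))"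
    by (rule negl_cong[OF negl_zero])
      (simp add: \<delta>_def star_diff star_scaleR right_diff_distrib tau_diff tau_scaleR
        tau_adapted_noise[OF a noise_star[OF noise_d]])
qed

text \<open>The drift is \<open>- 2 * c = s - r\<close> from the two linear terms plus the variance
  \<open>r + s\<close> from \<open>\<delta> * star \<delta>\<close>, in total
  \<open>2 * s\<close>.\<close>

lemma increment_\<delta>2: "increment \<delta>2 (\<lambda>N i. d N i + star (d N i)) (2 * s)"
  unfolding increment_def
proof (intro conjI allI impI)
  show "noise (\<lambda>N i. d N i + star (d N i))" by (intro noise_add noise_star noise_d)
  have O: "bigO 1 \<delta>" "bigO 2 (\<lambda>N i. \<delta> N i - d N i)"
    using increment_\<delta> increment_bigO[OF increment_\<delta>] unfolding increment_def by blast+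
  have O2: "bigO 2 (\<lambda>N i. \<delta> N i * star (\<delta> N i))"
    using bigO_mult[OF O(1) bigO_star[OF O(1)]] by (simp add: numeral_2_eq_2)
  have "bigO 2 (\<lambda>N i. (\<delta> N i - d N i) + star (\<delta> N i - d N i) + \<delta> N i * star (\<delta> N i))"
    by (intro bigO_add bigO_star O O2)
  then show "bigO 2 (\<lambda>N i. \<delta>2 N i - (d N i + star (d N i)))"
    by (rule bigO_cong) (simp add: \<delta>2_def star_diff)
  fix a assume a: "adapted a"
  then have aO: "bigO 0 a" by (simp add: adapted_def)
  have "bigO (0 + (2 + 1)) (\<lambda>N i. a N i * ((\<delta> N i - d N i) * star (\<delta> N i)))"
    by (intro bigO_mult bigO_star O aO)
  moreover have "bigO (0 + (1 + 2)) (\<lambda>N i. a N i * (d N i * star (\<delta> N i - d N i)))"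
    by (intro bigO_mult bigO_star O aO bigO_d)
  ultimately have "bigO 3 (\<lambda>N i. a N i * ((\<delta> N i - d N i) * star (\<delta> N i))
      + a N i * (d N i * star (\<delta> N i - d N i)))"
    by (intro bigO_add) (simp_all add: numeral_3_eq_3)
  then have "negl (\<lambda>N i. \<tau> (a N i * ((\<delta> N i - d N i) * star (\<delta> N i))
      + a N i * (d N i * star (\<delta> N i - d N i))))"
    by (rule negl_tau)
  with increment_\<delta> increment_\<delta>_star a
  have "negl (\<lambda>N i. (\<tau> (a N i * \<delta> N i) - complex_of_real (- c * h N) * \<tau> (a N i))
      + (\<tau> (a N i * star (\<delta> N i)) - complex_of_real (- c * h N) * \<tau> (a N i))
      + \<tau> (a N i * ((\<delta> N i - d N i) * star (\<delta> N i))
      + a N i * (d N i * star (\<delta> N i - d N i))))"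
    unfolding increment_def by (intro negl_add) blast+
  then show "negl (\<lambda>N i. \<tau> (a N i * \<delta>2 N i) - complex_of_real (2 * s * h N) * \<tau> (a N i))"
  proof (rule negl_cong)
    fix N i :: nat assume N: "0 < N"
    have "d N i * star (d N i) \<in> future (real i * h N) (real (Suc i) * h N)"
      by (intro subalgebra_mult subalgebra_star future_subalgebra d_in_future)
    then have "\<tau> (a N i * (d N i * star (d N i))) = \<tau> (a N i) * \<tau> (d N i * star (d N i))"
      using a N unfolding adapted_def by (intro tau_adapted_future) blast+
    then have "\<tau> (a N i * (d N i * star (d N i))) = \<tau> (a N i) * complex_of_real ((r + s) * h N)"
      by (simp only: d_star[OF N])
    moreover have "2 * s * h N = - c * h N + - c * h N + (r + s) * h N"
      by (simp add: field_simps)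
    then have "complex_of_real (2 * s * h N) = complex_of_real (- c * h N) + complex_of_real (- c * h N)
        + complex_of_real ((r + s) * h N)" by (simp only: of_real_add)
    ultimately show "\<tau> (a N i * \<delta>2 N i) - complex_of_real (2 * s * h N) * \<tau> (a N i)
      = (\<tau> (a N i * \<delta> N i) - complex_of_real (- c * h N) * \<tau> (a N i))
      + (\<tau> (a N i * star (\<delta> N i)) - complex_of_real (- c * h N) * \<tau> (a N i))
      + \<tau> (a N i * ((\<delta> N i - d N i) * star (\<delta> N i))
      + a N i * (d N i * star (\<delta> N i - d N i)))"
      by (simp only: \<delta>2_def star_diff ring_distribs tau_add tau_diff) (simp only: algebra_simps)
  qed
qed

lemma
  assumes N: "0 < N"
  shows star_d_d: "\<tau> (star (d N i) * d N i) = complex_of_real ((r + s) * h N)"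
    and star_d_star_d: "\<tau> (star (d N i) * star (d N i)) = complex_of_real ((s - r) * h N)"
proof -
  show "\<tau> (star (d N i) * d N i) = complex_of_real ((r + s) * h N)"
    using d_star[OF N] by (simp add: tau_commute)
  have "\<tau> (star (d N i) * star (d N i)) = cnj (\<tau> (d N i * d N i))"
    by (simp add: star_mult flip: tau_star)
  then show "\<tau> (star (d N i) * star (d N i)) = complex_of_real ((s - r) * h N)"
    by (simp only: d_d[OF N] complex_cnj_complex_of_real)
qed

end

lemma of_real_has_vector_derivative:
  "(f has_vector_derivative D) F \<Longrightarrow>
    ((\<lambda>u. complex_of_real (f u)) has_vector_derivative complex_of_real D) F"
  by (rule bounded_linear.has_vector_derivative[OF bounded_linear_of_real])

section \<open>Limits of the moments along the scheme\<close>

context euler_scheme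
begin

text \<open>Second-order expansion: \<open>B n\<close> and \<open>Q n\<close> collect the words with one and with two factors
  \<open>\<delta>'\<close>; all longer words are negligible.\<close>

lemma power_recursion:
  assumes a: "adapted a" and inc: "increment \<delta>' e \<kappa>"
    and cov: "\<And>N i. 0 < N \<Longrightarrow> \<tau> (e N i * e N i) = complex_of_real (2 * \<kappa> * h N)"
  shows "negl (\<lambda>N i. \<tau> ((a N i * (1 + \<delta>' N i)) ^ n) - \<tau> (a N i ^ n)
    - complex_of_real (\<kappa> * h N) * (of_nat n * \<tau> (a N i ^ n)
      + of_nat n * (\<Sum>p=1..<n. \<tau> (a N i ^ p) * \<tau> (a N i ^ (n - p)))))"
proof -
  define B where "B n N i = (\<Sum>j<n. a N i ^ (j + 1) * \<delta>' N i * a N i ^ (n - 1 - j))" for n N i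
  define Q where "Q n N i = (\<Sum>l<n. B l N i * a N i * \<delta>' N i * a N i ^ (n - 1 - l))" for n N i
  define R where "R n N i = (a N i * (1 + \<delta>' N i)) ^ n - a N i ^ n - B n N i - Q n N i" for n N i
  have aO: "bigO 0 a" using a by (simp add: adapted_def)
  have \<delta>O: "bigO 1 \<delta>'" by (rule increment_bigO[OF inc])
  have \<delta>O0: "bigO 0 (\<lambda>N i. 1 + \<delta>' N i)"
    by (intro bigO_add bigO_const bigO_mono[OF \<delta>O]) simp
  have BO: "bigO 1 (B n)" for n
    unfolding B_def
  proof (intro bigO_sum)
    fix j
    show "bigO 1 (\<lambda>N i. a N i ^ (j + 1) * \<delta>' N i * a N i ^ (n - 1 - j))"
      using bigO_mult[OF bigO_mult[OF bigO_power[OF aO, of "j + 1"] \<delta>O] bigO_power[OF aO, of "n - 1 - j"]]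
      by (simp only: add_0_left add_0_right)
  qed
  have QO: "bigO 2 (Q n)" for n
    unfolding Q_def
    using bigO_mult[OF bigO_mult[OF bigO_mult[OF BO aO] \<delta>O] bigO_power[OF aO]]
    by (intro bigO_sum) (simp add: numeral_2_eq_2)
  have BS: "B (Suc n) N i = B n N i * a N i + a N i ^ Suc n * \<delta>' N i" for n N i
  proof -
    have "a N i ^ (n - j) = a N i ^ (n - 1 - j) * a N i" if "j < n" for j
      using that by (simp add: power_Suc2[symmetric] Suc_diff_Suc del: power_Suc)
    then show ?thesis unfolding B_def by (simp add: sum_distrib_right mult.assoc)
  qed
  have QS: "Q (Suc n) N i = Q n N i * a N i + B n N i * a N i * \<delta>' N i" for n N i
  proof -
    have "a N i ^ (n - j) = a N i ^ (n - 1 - j) * a N i" if "j < n" for j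
      using that by (simp add: power_Suc2[symmetric] Suc_diff_Suc del: power_Suc)
    then show ?thesis unfolding Q_def by (simp add: sum_distrib_right mult.assoc)
  qed
  have RO: "bigO 3 (R n)" for n
  proof (induction n)
    case 0
    have "R 0 = (\<lambda>N i. 0)" by (simp add: R_def B_def Q_def fun_eq_iff)
    then show ?case by (simp add: bigO_zero)
  next
    case (Suc n)
    \<comment> \<open>One more factor sends words of lower order back into \<open>B\<close> and
      \<open>Q\<close>; new third-order words arise only from \<open>Q\<close> times another
      \<open>\<delta>'\<close>.\<close>
    have "R (Suc n) N i = R n N i * (a N i * (1 + \<delta>' N i)) + Q n N i * a N i * \<delta>' N i" for N i
      unfolding R_def BS QS power_Suc2 by (simp add: algebra_simps)
    then have "R (Suc n) = (\<lambda>N i. R n N i * (a N i * (1 + \<delta>' N i)) + Q n N i * a N i * \<delta>' N i)"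
      by (intro ext)
    moreover have "bigO (3 + (0 + 0)) (\<lambda>N i. R n N i * (a N i * (1 + \<delta>' N i)))"
      by (intro bigO_mult Suc aO \<delta>O0)
    moreover have "bigO (2 + 0 + 1) (\<lambda>N i. Q n N i * a N i * \<delta>' N i)"
      by (intro bigO_mult QO aO \<delta>O)
    ultimately show ?case by (simp add: bigO_add numeral_3_eq_3)
  qed
  have tB: "\<tau> (B n N i) = of_nat n * \<tau> (a N i ^ n * \<delta>' N i)" for N i
  proof -
    have "\<tau> (a N i ^ (j + 1) * \<delta>' N i * a N i ^ (n - 1 - j)) = \<tau> (a N i ^ n * \<delta>' N i)" if "j < n" for j
    proof -
      have "\<tau> (a N i ^ (j + 1) * \<delta>' N i * a N i ^ (n - 1 - j))
          = \<tau> (a N i ^ (n - 1 - j) * (a N i ^ (j + 1) * \<delta>' N i))" by (rule tau_commute)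
      also have "\<dots> = \<tau> (a N i ^ ((n - 1 - j) + (j + 1)) * \<delta>' N i)"
        by (simp only: power_add mult.assoc)
      also have "(n - 1 - j) + (j + 1) = n" using that by simp
      finally show ?thesis .
    qed
    then show ?thesis by (simp add: B_def tau_sum)
  qed
  \<comment> \<open>Rotating the tail to the front leaves the two noise factors separated by
    \<open>l - j\<close> and \<open>n - (l - j)\<close> letters, so only the cyclic distance
    matters.\<close>
  have tQ: "\<tau> (Q n N i) = (\<Sum>l<n. \<Sum>j<l. \<tau> (a N i ^ (n - (l - j)) * \<delta>' N i * a N i ^ (l - j) * \<delta>' N i))" for N i
  proof -
    have "\<tau> (a N i ^ (j + 1) * \<delta>' N i * a N i ^ (l - 1 - j) * a N i * \<delta>' N i * a N i ^ (n - 1 - l))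
        = \<tau> (a N i ^ (n - (l - j)) * \<delta>' N i * a N i ^ (l - j) * \<delta>' N i)" if "l < n" "j < l" for l j
    proof -
      have "\<tau> (a N i ^ (j + 1) * \<delta>' N i * a N i ^ (l - 1 - j) * a N i * \<delta>' N i * a N i ^ (n - 1 - l))
          = \<tau> (a N i ^ (n - 1 - l) * (a N i ^ (j + 1) * \<delta>' N i * a N i ^ (l - 1 - j) * a N i * \<delta>' N i))"
        by (rule tau_commute)
      also have "\<dots> = \<tau> (a N i ^ ((n - 1 - l) + (j + 1)) * \<delta>' N i * a N i ^ ((l - 1 - j) + 1) * \<delta>' N i)"
        by (simp only: power_add power_one_right mult.assoc)
      also have "(n - 1 - l) + (j + 1) = n - (l - j)" using that by simp
      also have "(l - 1 - j) + 1 = l - j" using that by simp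
      finally show ?thesis .
    qed
    then show ?thesis by (simp add: Q_def B_def tau_sum sum_distrib_right)
  qed
  define f where "f N i p = \<tau> (a N i ^ (n - p)) * \<tau> (a N i ^ p)" for N i p
  let ?T = "\<lambda>N i. \<tau> (R n N i)
      + of_nat n * (\<tau> (a N i ^ n * \<delta>' N i) - complex_of_real (\<kappa> * h N) * \<tau> (a N i ^ n))
      + (\<Sum>l<n. \<Sum>j<l. \<tau> (a N i ^ (n - (l - j)) * \<delta>' N i * a N i ^ (l - j) * \<delta>' N i)
        - complex_of_real (2 * \<kappa> * h N) * f N i (l - j))"
  have "negl ?T"
    unfolding f_def
    using inc adapted_power[OF a]
    by (intro negl_add negl_cmult negl_sum negl_tau RO increment_pair[OF _ _ inc inc cov])
      (auto simp: increment_def)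
  then show ?thesis
  proof (rule negl_cong)
    fix N i :: nat assume N: "0 < N"
    have P: "(a N i * (1 + \<delta>' N i)) ^ n = R n N i + a N i ^ n + B n N i + Q n N i"
      by (simp add: R_def)
    have sym: "2 * (\<Sum>l<n. \<Sum>j<l. f N i (l - j)) = of_nat n * (\<Sum>p=1..<n. f N i p)"
      by (rule double_sum_symmetric) (simp add: f_def)
    have "(\<Sum>p=1..<n. f N i p) = (\<Sum>p=1..<n. \<tau> (a N i ^ p) * \<tau> (a N i ^ (n - p)))"
      by (simp add: f_def mult.commute)
    with sym have sym': "of_nat n * (\<Sum>p=1..<n. \<tau> (a N i ^ p) * \<tau> (a N i ^ (n - p)))
        = 2 * (\<Sum>l<n. \<Sum>j<l. f N i (l - j))" by simp
    show "\<tau> ((a N i * (1 + \<delta>' N i)) ^ n) - \<tau> (a N i ^ n)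
      - complex_of_real (\<kappa> * h N) * (of_nat n * \<tau> (a N i ^ n)
        + of_nat n * (\<Sum>p=1..<n. \<tau> (a N i ^ p) * \<tau> (a N i ^ (n - p))))
      = ?T N i"
      unfolding sym' P tau_add tB tQ sum_subtractf sum_distrib_left[symmetric]
      by (simp add: algebra_simps)
  qed
qed

lemma negl_ulim_ODE:
  assumes init: "\<And>N. m N 0 = Y 0"
    and der: "\<And>u. (Y has_vector_derivative (complex_of_real \<alpha> * Y u + g u)) (at u)"
    and cont: "continuous_on {0..t} g" and G: "ulim t G g"
    and step: "negl (\<lambda>N i. m N (Suc i) - m N i
        - complex_of_real (h N) * (complex_of_real \<alpha> * m N i + G N i))"
  shows "ulim t m Y"
proof -
  obtain C where "0 \<le> C" "\<And>N i. 0 < N \<Longrightarrow> i \<le> N \<Longrightarrow> cmod (m N (Suc i) - m N i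
        - complex_of_real (h N) * (complex_of_real \<alpha> * m N i + G N i)) \<le> C * sqrt (h N) ^ 3"
    using step unfolding negl_def by meson
  note C = this
  show ?thesis
  proof (rule ulim_ODE[where m = m and y = Y and C = C and g = g and G = G and \<alpha> = "complex_of_real \<alpha>"])
    show "cmod (m N (Suc i) - m N i - complex_of_real (t / real N) * (complex_of_real \<alpha> * m N i + G N i))
        \<le> C * sqrt (t / real N) ^ 3" if "0 < N" "i < N" for N i
      using C(2)[of N i] that by (simp add: h_def)
  qed (rule t init der cont G C)+
qed

text \<open>The time change by \<open>- 2 * \<kappa>\<close> turns the factor \<open>- n / 2\<close>
  in the equation of \<open>nu\<close> into \<open>\<kappa> * n\<close>.\<close>

lemma nu_vector_derivative:
  assumes "0 < n"
  shows "((\<lambda>u. complex_of_real (nu (int n) (- 2 * \<kappa> * u))) has_vector_derivative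
    (complex_of_real (\<kappa> * real n) * complex_of_real (nu (int n) (- 2 * \<kappa> * u))
      + complex_of_real (\<kappa> * real n) * (\<Sum>p=1..<n. complex_of_real (nu (int p) (- 2 * \<kappa> * u))
        * complex_of_real (nu (int (n - p)) (- 2 * \<kappa> * u))))) (at u)"
proof -
  define S where "S = (\<Sum>p=1..<n. nu (int p) (- 2 * \<kappa> * u) * nu (int (n - p)) (- 2 * \<kappa> * u))"
  have "((\<lambda>u. nu (int n) (- 2 * \<kappa> * u)) has_real_derivative
      (- (real n / 2) * nu (int n) (- 2 * \<kappa> * u) - real n / 2 * S) * (- 2 * \<kappa>)) (at u)"
    unfolding S_def
    by (rule DERIV_chain2[OF has_derivative_nu[OF assms]]) (auto intro!: derivative_eq_intros)
  also have "(- (real n / 2) * nu (int n) (- 2 * \<kappa> * u) - real n / 2 * S) * (- 2 * \<kappa>)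
      = \<kappa> * real n * nu (int n) (- 2 * \<kappa> * u) + \<kappa> * real n * S"
    by (simp add: algebra_simps)
  finally have "((\<lambda>u. nu (int n) (- 2 * \<kappa> * u)) has_vector_derivative
      \<kappa> * real n * nu (int n) (- 2 * \<kappa> * u) + \<kappa> * real n * S) (at u)"
    by (simp add: has_real_derivative_iff_has_vector_derivative)
  from of_real_has_vector_derivative[OF this]
  show ?thesis by (simp add: S_def)
qed

lemma nu_continuous: "continuous_on A (\<lambda>u. complex_of_real (nu (int n) (- 2 * \<kappa> * u)))"
proof (cases "n = 0")
  case False
  then show ?thesis
    using nu_vector_derivative[of n \<kappa>]
    by (intro continuous_at_imp_continuous_on ballI has_vector_derivative_continuous) auto
qed simp

text \<open>Strong induction on \<open>n\<close>: the quadratic sum involves only moments of order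
  below \<open>n\<close>, so the equation for order \<open>n\<close> is linear with a known source.
  The covariance \<open>2 * \<kappa> * h\<close> is what gives the quadratic sum the same factor
  \<open>\<kappa> * n\<close> as the linear term.\<close>

lemma moments_limit:
  assumes a: "adapted a" and a0: "\<And>N. a N 0 = 1" and inc: "increment \<delta>' e \<kappa>"
    and cov: "\<And>N i. 0 < N \<Longrightarrow> \<tau> (e N i * e N i) = complex_of_real (2 * \<kappa> * h N)"
    and step: "\<And>N i n. 0 < N \<Longrightarrow> \<tau> (a N (Suc i) ^ n) = \<tau> ((a N i * (1 + \<delta>' N i)) ^ n)"
  shows "ulim t (\<lambda>N i. \<tau> (a N i ^ n)) (\<lambda>u. complex_of_real (nu (int n) (- 2 * \<kappa> * u)))"
proof (induction n rule: less_induct)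
  case (less n)
  show ?case
  proof (cases "n = 0")
    case True
    then show ?thesis by (simp add: tau_one ulim_const)
  next
    case False
    let ?G = "\<lambda>N i. complex_of_real (\<kappa> * real n) * (\<Sum>p=1..<n. \<tau> (a N i ^ p) * \<tau> (a N i ^ (n - p)))"
    let ?g = "\<lambda>u. complex_of_real (\<kappa> * real n) * (\<Sum>p=1..<n. complex_of_real (nu (int p) (- 2 * \<kappa> * u))
        * complex_of_real (nu (int (n - p)) (- 2 * \<kappa> * u)))"
    have cont: "continuous_on {0..t} (\<lambda>u. \<Sum>p=1..<n. complex_of_real (nu (int p) (- 2 * \<kappa> * u))
        * complex_of_real (nu (int (n - p)) (- 2 * \<kappa> * u)))"
      by (intro continuous_on_sum continuous_on_mult nu_continuous)
    show ?thesis
    proof (rule negl_ulim_ODE)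
      show "\<tau> (a N 0 ^ n) = complex_of_real (nu (int n) (- 2 * \<kappa> * 0))" for N
        using nu_at_0[of n] by (simp add: a0 tau_one)
      show "((\<lambda>u. complex_of_real (nu (int n) (- 2 * \<kappa> * u))) has_vector_derivative
          complex_of_real (\<kappa> * real n) * complex_of_real (nu (int n) (- 2 * \<kappa> * u)) + ?g u) (at u)" for u
        using nu_vector_derivative False by simp
      show "continuous_on {0..t} ?g" by (intro continuous_on_mult continuous_on_const cont)
      show "ulim t ?G ?g"
        using t False
        by (intro ulim_mult ulim_const ulim_sum less.IH continuous_on_const cont nu_continuous) auto
      show "negl (\<lambda>N i. \<tau> (a N (Suc i) ^ n) - \<tau> (a N i ^ n)
          - complex_of_real (h N) * (complex_of_real (\<kappa> * real n) * \<tau> (a N i ^ n) + ?G N i))"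
        by (rule negl_cong[OF power_recursion[OF a inc cov, of n]]) (simp_all add: step algebra_simps)
    qed
  qed
qed

lemma v_star_v: "(1 + \<delta> N i) * star (1 + \<delta> N i) = 1 + \<delta>2 N i"
  by (simp add: \<delta>2_def star_add ring_distribs add_ac)

lemma E_moments_limit:
  "ulim t (\<lambda>N i. \<tau> (E N i ^ n)) (\<lambda>u. complex_of_real (nu (int n) ((r - s) * u)))"
proof -
  have "ulim t (\<lambda>N i. \<tau> (E N i ^ n)) (\<lambda>u. complex_of_real (nu (int n) (- 2 * (- c) * u)))"
  proof (rule moments_limit[OF adapted_E _ increment_\<delta>])
    show "\<tau> (d N i * d N i) = complex_of_real (2 * - c * h N)" if "0 < N" for N i
    proof -
      have "2 * - c * h N = (s - r) * h N" by (simp add: field_simps)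
      then show ?thesis by (simp only: d_d[OF that])
    qed
  qed (simp_all add: E_Suc)
  moreover have "- 2 * (- c) * u = (r - s) * u" for u by (simp add: field_simps)
  ultimately show ?thesis by (simp only:)
qed

lemma E_star_E_moments_limit:
  "ulim t (\<lambda>N i. \<tau> ((star (E N i) * E N i) ^ n)) (\<lambda>u. complex_of_real (nu (int n) (- 4 * s * u)))"
proof -
  have "ulim t (\<lambda>N i. \<tau> ((star (E N i) * E N i) ^ n)) (\<lambda>u. complex_of_real (nu (int n) (- 2 * (2 * s) * u)))"
  proof (rule moments_limit[OF _ _ increment_\<delta>2])
    show "adapted (\<lambda>N i. star (E N i) * E N i)"
      by (intro adapted_mult adapted_star adapted_E)
    fix N i n :: nat assume N: "0 < N"
    show "\<tau> ((d N i + star (d N i)) * (d N i + star (d N i))) = complex_of_real (2 * (2 * s) * h N)"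
      by (simp add: ring_distribs tau_add d_d[OF N] d_star[OF N] star_d_d[OF N] star_d_star_d[OF N])
    let ?a = "star (E N i) * E N i" and ?v = "1 + \<delta> N i"
    have "\<tau> ((star (E N (Suc i)) * E N (Suc i)) ^ n) = \<tau> ((star ?v * (?a * ?v)) ^ n)"
      by (simp add: E_Suc star_mult mult.assoc)
    also have "\<dots> = \<tau> ((?a * (?v * star ?v)) ^ n)"
      by (subst tau_power_commute) (simp add: mult.assoc)
    finally show "\<tau> ((star (E N (Suc i)) * E N (Suc i)) ^ n) = \<tau> ((?a * (1 + \<delta>2 N i)) ^ n)"
      by (simp only: v_star_v)
  qed simp
  then show ?thesis by simp
qed

lemma cov_d_g: "0 < N \<Longrightarrow> \<tau> (d N i * (d N i + star (d N i))) = complex_of_real (2 * s * h N)"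
  and cov_g_star_d: "0 < N \<Longrightarrow> \<tau> ((d N i + star (d N i)) * star (d N i)) = complex_of_real (2 * s * h N)"
  by (simp_all add: ring_distribs tau_add d_d d_star star_d_d star_d_star_d)

lemma E_limit: "ulim t (\<lambda>N i. \<tau> (E N i)) (\<lambda>u. complex_of_real (exp (- c * u)))"
  and E_star_E_limit: "ulim t (\<lambda>N i. \<tau> (star (E N i) * E N i)) (\<lambda>u. complex_of_real (exp (2 * s * u)))"
proof -
  have "nu 1 v = exp (- v / 2)" for v
    using nu_eq[of 1 v] by (simp add: nu_poly_def)
  then show "ulim t (\<lambda>N i. \<tau> (E N i)) (\<lambda>u. complex_of_real (exp (- c * u)))"
    and "ulim t (\<lambda>N i. \<tau> (star (E N i) * E N i)) (\<lambda>u. complex_of_real (exp (2 * s * u)))"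
    using E_moments_limit[of 1] E_star_E_moments_limit[of 1] by (simp_all add: algebra_simps)
qed

lemma ulim_cnj: "ulim t m Y \<Longrightarrow> ulim t (\<lambda>N i. cnj (m N i)) (\<lambda>u. cnj (Y u))"
  unfolding ulim_def by (simp flip: complex_cnj_diff)

lemma E_star_limit: "ulim t (\<lambda>N i. \<tau> (star (E N i))) (\<lambda>u. complex_of_real (exp (- c * u)))"
  using ulim_cnj[OF E_limit] by (simp add: tau_star)

text \<open>A source term for the fourth-order moment. Rotation makes the outer factors meet as
  \<open>1 + \<delta>2\<close>, leaving one inner \<open>1 + \<delta>\<close>: the drifts add up to
  \<open>2 * s - c\<close>, and the single pair has covariance \<open>2 * s\<close>.\<close>

lemma E2_star_E_limit:
  "ulim t (\<lambda>N i. \<tau> (star (E N i) * E N i * E N i))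
    (\<lambda>u. complex_of_real (exp ((2 * s - c) * u) * (1 + 2 * s * u)))"
proof (rule negl_ulim_ODE)
  let ?G = "\<lambda>N i. complex_of_real (2 * s) * (\<tau> (star (E N i) * E N i) * \<tau> (E N i))"
  let ?g = "\<lambda>u. complex_of_real (2 * s) * (complex_of_real (exp (2 * s * u)) * complex_of_real (exp (- c * u)))"
  show "\<tau> (star (E N 0) * E N 0 * E N 0) = complex_of_real (exp ((2 * s - c) * 0) * (1 + 2 * s * 0))" for N
    by (simp add: tau_one)
  show "((\<lambda>u. complex_of_real (exp ((2 * s - c) * u) * (1 + 2 * s * u))) has_vector_derivative
      (complex_of_real (2 * s - c) * complex_of_real (exp ((2 * s - c) * u) * (1 + 2 * s * u)) + ?g u)) (at u)" for u
  proof -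
    have "((\<lambda>u. exp (\<alpha> * u) * (1 + \<beta> * u)) has_real_derivative
        \<alpha> * (exp (\<alpha> * u) * (1 + \<beta> * u)) + \<beta> * exp (\<alpha> * u)) (at u)" for \<alpha> \<beta> :: real
      by (auto intro!: derivative_eq_intros simp: algebra_simps)
    from this[of "2 * s - c" "2 * s"] have "((\<lambda>u. exp ((2 * s - c) * u) * (1 + 2 * s * u)) has_vector_derivative
        (2 * s - c) * (exp ((2 * s - c) * u) * (1 + 2 * s * u)) + 2 * s * (exp (2 * s * u) * exp (- c * u))) (at u)"
      unfolding exp_add[symmetric] distrib_right[symmetric] has_real_derivative_iff_has_vector_derivative
      by simp
    from of_real_has_vector_derivative[OF this]
    show ?thesis by simp
  qed
  show "continuous_on {0..t} ?g" by (intro continuous_intros)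
  show "ulim t ?G ?g"
    using t by (intro ulim_mult ulim_const E_limit E_star_E_limit continuous_intros) auto
  have A: "adapted E" "adapted (\<lambda>N i. star (E N i) * E N i)" "adapted (\<lambda>N i. E N i * star (E N i) * E N i)"
    "adapted (\<lambda>N i. star (E N i) * E N i * E N i)"
    by (intro adapted_mult adapted_star adapted_E)+
  let ?L = "\<lambda>N i. \<tau> (star (E N (Suc i)) * E N (Suc i) * E N (Suc i)) - \<tau> (star (E N i) * E N i * E N i)
      - complex_of_real (h N) * (complex_of_real (2 * s - c) * \<tau> (star (E N i) * E N i * E N i) + ?G N i)"
  let ?T = "\<lambda>N i. (\<tau> ((E N i * star (E N i) * E N i) * \<delta> N i)
        - complex_of_real (- c * h N) * \<tau> (E N i * star (E N i) * E N i))
      + (\<tau> ((star (E N i) * E N i * E N i) * \<delta>2 N i)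
        - complex_of_real (2 * s * h N) * \<tau> (star (E N i) * E N i * E N i))
      + (\<tau> ((star (E N i) * E N i) * \<delta> N i * E N i * \<delta>2 N i)
        - complex_of_real (2 * s * h N) * (\<tau> (star (E N i) * E N i) * \<tau> (E N i)))"
  have "negl ?T"
    using increment_\<delta> increment_\<delta>2 A
    by (intro negl_add increment_pair[OF A(2,1) increment_\<delta> increment_\<delta>2 cov_d_g])
      (auto simp: increment_def)
  then show "negl ?L"
  proof (rule negl_cong)
    fix N i :: nat assume N: "0 < N"
    define e where "e = E N i"
    define p where "p = \<delta> N i"
    define q where "q = \<delta>2 N i"
    have "\<tau> (star (E N (Suc i)) * E N (Suc i) * E N (Suc i)) = \<tau> (star (1 + p) * (star e * e * (1 + p) * e * (1 + p)))"
      by (simp add: E_Suc e_def p_def star_mult mult.assoc)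
    also have "\<dots> = \<tau> (star e * e * (1 + p) * e * ((1 + p) * star (1 + p)))"
      by (subst tau_commute) (simp add: mult.assoc)
    also have "\<dots> = \<tau> (star e * e * (1 + p) * e * (1 + q))"
      by (simp only: v_star_v p_def q_def)
    also have "\<dots> = \<tau> (star e * e * e) + \<tau> (star e * e * p * e) + \<tau> (star e * e * e * q)
        + \<tau> (star e * e * p * e * q)"
      by (simp add: ring_distribs tau_add)
    also have "\<tau> (star e * e * p * e) = \<tau> (e * star e * e * p)"
      using tau_commute[of e "star e * e * p"] by (simp add: mult.assoc)
    finally have 1: "\<tau> (star (E N (Suc i)) * E N (Suc i) * E N (Suc i)) = \<tau> (star e * e * e)
        + \<tau> (e * star e * e * p) + \<tau> (star e * e * e * q) + \<tau> (star e * e * p * e * q)" .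
    have 2: "\<tau> (e * star e * e) = \<tau> (star e * e * e)"
      using tau_commute[of e "star e * e"] by (simp add: mult.assoc)
    show "?L N i = ?T N i"
    proof -
      define S where "S = complex_of_real s"
      define C where "C = complex_of_real c"
      define H where "H = complex_of_real (h N)"
      have casts: "complex_of_real (- c * h N) = - C * H" "complex_of_real (2 * s * h N) = 2 * S * H"
        "complex_of_real (2 * s - c) = 2 * S - C" "complex_of_real (2 * s) = 2 * S"
        by (simp_all add: S_def C_def H_def)
      show ?thesis
        unfolding 1 e_def[symmetric] p_def[symmetric] q_def[symmetric] 2 casts H_def[symmetric]
        by (simp add: algebra_simps)
    qed
  qed
qed

text \<open>The two factors meeting in the middle combine to \<open>1 + \<delta>2\<close>, with
  \<open>1 + \<delta>\<close> on its left and the adjoint on its right. The drifts add up to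
  \<open>2 * s - 2 * c = 3 * s - r\<close>; the three pairs have covariances \<open>2 * s\<close>,
  \<open>2 * s\<close> and \<open>r + s\<close>; the word with all three noises is of third
  order.\<close>

lemma E2_star_E2_limit:
  "ulim t (\<lambda>N i. \<tau> (E N i * E N i * star (E N i) * star (E N i)))
    (\<lambda>u. complex_of_real (exp (4 * s * u) + 4 * s * u * (1 + s * u) * exp ((3 * s - r) * u)))"
proof (rule negl_ulim_ODE)
  let ?Y = "\<lambda>u. exp (4 * s * u) + 4 * s * u * (1 + s * u) * exp ((3 * s - r) * u)"
  let ?l = "\<lambda>u. exp ((2 * s - c) * u) * (1 + 2 * s * u)"
  let ?G = "\<lambda>N i. complex_of_real (2 * s) * (\<tau> (star (E N i) * star (E N i) * E N i) * \<tau> (E N i))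
      + complex_of_real (2 * s) * (\<tau> (star (E N i) * E N i * E N i) * \<tau> (star (E N i)))
      + complex_of_real (r + s) * (\<tau> (star (E N i) * E N i) * \<tau> (E N i * star (E N i)))"
  let ?g = "\<lambda>u. complex_of_real (2 * s) * (complex_of_real (?l u) * complex_of_real (exp (- c * u)))
      + complex_of_real (2 * s) * (complex_of_real (?l u) * complex_of_real (exp (- c * u)))
      + complex_of_real (r + s) * (complex_of_real (exp (2 * s * u)) * complex_of_real (exp (2 * s * u)))"
  show "\<tau> (E N 0 * E N 0 * star (E N 0) * star (E N 0)) = complex_of_real (?Y 0)" for N
    by (simp add: tau_one)
  show "((\<lambda>u. complex_of_real (?Y u)) has_vector_derivative
      (complex_of_real (3 * s - r) * complex_of_real (?Y u) + ?g u)) (at u)" for u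
  proof -
    have "(?Y has_real_derivative
        4 * s * exp (4 * s * u) + (4 * s + 8 * s * s * u) * exp ((3 * s - r) * u)
          + 4 * s * u * (1 + s * u) * ((3 * s - r) * exp ((3 * s - r) * u))) (at u)"
      by (auto intro!: derivative_eq_intros simp: algebra_simps)
    also have "4 * s * exp (4 * s * u) + (4 * s + 8 * s * s * u) * exp ((3 * s - r) * u)
          + 4 * s * u * (1 + s * u) * ((3 * s - r) * exp ((3 * s - r) * u))
        = (3 * s - r) * ?Y u + (2 * s * (?l u * exp (- c * u)) + 2 * s * (?l u * exp (- c * u))
          + (r + s) * (exp (2 * s * u) * exp (2 * s * u)))"
    proof -
      have "exp (2 * s * u) * exp (2 * s * u) = exp (4 * s * u)"
        by (simp add: exp_add[symmetric])
      moreover have "?l u * exp (- c * u) = (1 + 2 * s * u) * exp ((3 * s - r) * u)"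
      proof -
        have "(2 * s - c) * u + - c * u = (3 * s - r) * u" by (simp add: field_simps)
        then have "exp ((2 * s - c) * u) * exp (- c * u) = exp ((3 * s - r) * u)"
          by (simp only: exp_add[symmetric])
        moreover have "x * p * z = p * (x * z)" for x p z :: real by simp
        ultimately show ?thesis by (simp only:)
      qed
      ultimately show ?thesis by (simp only:) (simp add: algebra_simps)
    qed
    finally have "(?Y has_vector_derivative (3 * s - r) * ?Y u
          + (2 * s * (?l u * exp (- c * u)) + 2 * s * (?l u * exp (- c * u))
          + (r + s) * (exp (2 * s * u) * exp (2 * s * u)))) (at u)"
      by (simp only: has_real_derivative_iff_has_vector_derivative)
    from of_real_has_vector_derivative[OF this]
    show ?thesis by (simp only: of_real_add of_real_mult)
  qed
  show "continuous_on {0..t} ?g" by (intro continuous_intros)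
  have l': "ulim t (\<lambda>N i. \<tau> (star (E N i) * star (E N i) * E N i)) (\<lambda>u. complex_of_real (?l u))"
    using ulim_cnj[OF E2_star_E_limit]
    by (simp add: star_mult star_star mult.assoc flip: tau_star)
  have h': "ulim t (\<lambda>N i. \<tau> (E N i * star (E N i))) (\<lambda>u. complex_of_real (exp (2 * s * u)))"
    using E_star_E_limit by (subst tau_commute)
  show "ulim t ?G ?g"
    using t by (intro ulim_add ulim_mult ulim_const E_limit E_star_limit E_star_E_limit
        E2_star_E_limit l' h' continuous_intros) auto
  have A: "adapted E" "adapted (\<lambda>N i. star (E N i))" "adapted (\<lambda>N i. star (E N i) * E N i)"
    "adapted (\<lambda>N i. E N i * star (E N i))"
    "adapted (\<lambda>N i. star (E N i) * star (E N i) * E N i)"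
    "adapted (\<lambda>N i. star (E N i) * E N i * E N i)"
    "adapted (\<lambda>N i. E N i * star (E N i) * star (E N i) * E N i)"
    "adapted (\<lambda>N i. star (E N i) * star (E N i) * E N i * E N i)"
    "adapted (\<lambda>N i. star (E N i) * E N i * E N i * star (E N i))"
    by (intro adapted_mult adapted_star adapted_E)+
  have O: "bigO 0 E" "bigO 0 (\<lambda>N i. star (E N i))" "bigO 1 \<delta>" "bigO 1 \<delta>2" "bigO 1 (\<lambda>N i. star (\<delta> N i))"
    using bigO_E bigO_star[OF bigO_E] increment_bigO[OF increment_\<delta>] increment_bigO[OF increment_\<delta>2]
      increment_bigO[OF increment_\<delta>_star] by blast+
  have "bigO (0 + 1 + 0 + 1 + 0 + 1 + 0) (\<lambda>N i. E N i * \<delta> N i * E N i * \<delta>2 N i * star (E N i) * star (\<delta> N i) * star (E N i))"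
    by (intro bigO_mult O)
  then have O3: "bigO 3 (\<lambda>N i. E N i * \<delta> N i * E N i * \<delta>2 N i * star (E N i) * star (\<delta> N i) * star (E N i))"
    by (simp add: numeral_3_eq_3)
  let ?L = "\<lambda>N i. \<tau> (E N (Suc i) * E N (Suc i) * star (E N (Suc i)) * star (E N (Suc i)))
      - \<tau> (E N i * E N i * star (E N i) * star (E N i))
      - complex_of_real (h N) * (complex_of_real (3 * s - r) * \<tau> (E N i * E N i * star (E N i) * star (E N i)) + ?G N i)"
  let ?T = "\<lambda>N i. (\<tau> ((E N i * star (E N i) * star (E N i) * E N i) * \<delta> N i)
        - complex_of_real (- c * h N) * \<tau> (E N i * star (E N i) * star (E N i) * E N i))
      + (\<tau> ((star (E N i) * star (E N i) * E N i * E N i) * \<delta>2 N i)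
        - complex_of_real (2 * s * h N) * \<tau> (star (E N i) * star (E N i) * E N i * E N i))
      + (\<tau> ((star (E N i) * E N i * E N i * star (E N i)) * star (\<delta> N i))
        - complex_of_real (- c * h N) * \<tau> (star (E N i) * E N i * E N i * star (E N i)))
      + (\<tau> ((star (E N i) * star (E N i) * E N i) * \<delta> N i * E N i * \<delta>2 N i)
        - complex_of_real (2 * s * h N) * (\<tau> (star (E N i) * star (E N i) * E N i) * \<tau> (E N i)))
      + (\<tau> ((star (E N i) * E N i * E N i) * \<delta>2 N i * star (E N i) * star (\<delta> N i))
        - complex_of_real (2 * s * h N) * (\<tau> (star (E N i) * E N i * E N i) * \<tau> (star (E N i))))
      + (\<tau> ((star (E N i) * E N i) * \<delta> N i * (E N i * star (E N i)) * star (\<delta> N i))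
        - complex_of_real ((r + s) * h N) * (\<tau> (star (E N i) * E N i) * \<tau> (E N i * star (E N i))))
      + \<tau> (E N i * \<delta> N i * E N i * \<delta>2 N i * star (E N i) * star (\<delta> N i) * star (E N i))"
  have "negl ?T"
    using increment_\<delta> increment_\<delta>2 increment_\<delta>_star A
    by (intro negl_add negl_tau[OF O3] increment_pair[OF A(5,1) increment_\<delta> increment_\<delta>2 cov_d_g]
        increment_pair[OF A(6,2) increment_\<delta>2 increment_\<delta>_star cov_g_star_d]
        increment_pair[OF A(3,4) increment_\<delta> increment_\<delta>_star d_star])
      (auto simp: increment_def)
  then show "negl ?L"
  proof (rule negl_cong)
    fix N i :: nat assume N: "0 < N"
    define e where "e = E N i"
    define f where "f = star e"
    define p where "p = \<delta> N i"
    define q where "q = \<delta>2 N i"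
    define z where "z = star p"
    define k where "k = \<tau> (e * e * f * f)"
    have "E N (Suc i) * E N (Suc i) * star (E N (Suc i)) * star (E N (Suc i))
        = e * (1 + p) * e * ((1 + p) * star (1 + p)) * f * (1 + z) * f"
      by (simp add: E_Suc e_def f_def p_def z_def star_mult star_add mult.assoc)
    also have "\<dots> = e * (1 + p) * e * (1 + q) * f * (1 + z) * f"
      by (simp only: v_star_v p_def q_def)
    also have "\<tau> \<dots> = k + \<tau> (e * p * e * f * f) + \<tau> (e * e * q * f * f) + \<tau> (e * e * f * z * f)
        + \<tau> (e * p * e * q * f * f) + \<tau> (e * e * q * f * z * f) + \<tau> (e * p * e * f * z * f)
        + \<tau> (e * p * e * q * f * z * f)"
      by (simp add: ring_distribs tau_add k_def)
    also have "\<tau> (e * p * e * f * f) = \<tau> (e * f * f * e * p)"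
      using tau_commute[of "e * p" "e * f * f"] by (simp add: mult.assoc)
    also have "\<tau> (e * e * q * f * f) = \<tau> (f * f * e * e * q)"
      using tau_commute[of "e * e * q" "f * f"] by (simp add: mult.assoc)
    also have "\<tau> (e * e * f * z * f) = \<tau> (f * e * e * f * z)"
      using tau_commute[of "e * e * f * z" f] by (simp add: mult.assoc)
    also have "\<tau> (e * p * e * q * f * f) = \<tau> (f * f * e * p * e * q)"
      using tau_commute[of "e * p * e * q" "f * f"] by (simp add: mult.assoc)
    also have "\<tau> (e * e * q * f * z * f) = \<tau> (f * e * e * q * f * z)"
      using tau_commute[of "e * e * q * f * z" f] by (simp add: mult.assoc)
    also have "\<tau> (e * p * e * f * z * f) = \<tau> (f * e * p * (e * f) * z)"
      using tau_commute[of "e * p * e * f * z" f] by (simp add: mult.assoc)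
    finally have 1: "\<tau> (E N (Suc i) * E N (Suc i) * star (E N (Suc i)) * star (E N (Suc i)))
        = k + \<tau> (e * f * f * e * p) + \<tau> (f * f * e * e * q) + \<tau> (f * e * e * f * z)
        + \<tau> (f * f * e * p * e * q) + \<tau> (f * e * e * q * f * z) + \<tau> (f * e * p * (e * f) * z)
        + \<tau> (e * p * e * q * f * z * f)" .
    have 2: "\<tau> (e * f * f * e) = k" "\<tau> (f * f * e * e) = k" "\<tau> (f * e * e * f) = k"
      using tau_commute[of e "e * f * f"] tau_commute[of "e * e" "f * f"] tau_commute[of "e * e * f" f]
      by (simp_all add: k_def mult.assoc)
    show "?L N i = ?T N i"
    proof -
      define S where "S = complex_of_real s"
      define C where "C = complex_of_real c"
      define H where "H = complex_of_real (h N)"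
      define V where "V = complex_of_real (r + s)"
      have casts: "complex_of_real (- c * h N) = - C * H" "complex_of_real (2 * s * h N) = 2 * S * H"
        "complex_of_real ((r + s) * h N) = V * H" "complex_of_real (2 * s) = 2 * S"
        by (simp_all add: S_def C_def H_def V_def)
      have "3 * s - r = 2 * s - 2 * c" by (simp add: field_simps)
      then have drift: "complex_of_real (3 * s - r) = 2 * S - 2 * C"
        by (simp only: S_def C_def of_real_diff of_real_mult of_real_numeral)
      show ?thesis
        unfolding 1 e_def[symmetric] f_def[symmetric] p_def[symmetric] q_def[symmetric] z_def[symmetric]
          2 k_def[symmetric] casts drift H_def[symmetric] V_def[symmetric]
        by (simp add: algebra_simps)
    qed
  qed
qed

section \<open>Passage to the limit\<close>

text \<open>All levels together, since the limit of a product at one level needs its factors at the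
  next.\<close>

definition Lp_lim :: "(nat \<Rightarrow> 'a) \<Rightarrow> 'a \<Rightarrow> bool" where
  "Lp_lim Z U \<longleftrightarrow> (\<forall>k. (\<lambda>N. Lp k (Z N - U)) \<longlonglongrightarrow> 0)"

lemma Lp_lim_const: "Lp_lim (\<lambda>N. U) U"
  by (simp add: Lp_lim_def)

lemma Lp_lim_star: "Lp_lim Z U \<Longrightarrow> Lp_lim (\<lambda>N. star (Z N)) (star U)"
  by (simp add: Lp_lim_def star_diff[symmetric])

lemma Lp_lim_mult:
  assumes "Lp_lim Z U" "Lp_lim Z' U'"
  shows "Lp_lim (\<lambda>N. Z N * Z' N) (U * U')"
  unfolding Lp_lim_def
proof
  fix k
  let ?a = "\<lambda>N. Lp (Suc k) (Z N - U)" and ?a' = "\<lambda>N. Lp (Suc k) (Z' N - U')"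
  have lim: "?a \<longlonglongrightarrow> 0" "?a' \<longlonglongrightarrow> 0" using assms by (auto simp: Lp_lim_def)
  have le: "Lp k (Z N * Z' N - U * U') \<le> ?a N * (?a' N + Lp (Suc k) U') + Lp (Suc k) U * ?a' N" for N
  proof -
    have eq: "Z N * Z' N - U * U' = (Z N - U) * ((Z' N - U') + U') + U * (Z' N - U')"
      by (simp add: algebra_simps)
    have "Lp k ((Z N - U) * ((Z' N - U') + U')) \<le> ?a N * (?a' N + Lp (Suc k) U')"
      by (rule order_trans[OF Lp_mult]) (intro mult_left_mono Lp_triangle Lp_nonneg)
    then show ?thesis
      unfolding eq using Lp_triangle[of k "(Z N - U) * ((Z' N - U') + U')" "U * (Z' N - U')"]
        Lp_mult[of k U "Z' N - U'"] by linarith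
  qed
  have "(\<lambda>N. ?a N * (?a' N + Lp (Suc k) U') + Lp (Suc k) U * ?a' N)
      \<longlonglongrightarrow> 0 * (0 + Lp (Suc k) U') + Lp (Suc k) U * 0"
    by (intro tendsto_intros lim)
  then have lim0: "(\<lambda>N. ?a N * (?a' N + Lp (Suc k) U') + Lp (Suc k) U * ?a' N) \<longlonglongrightarrow> 0" by simp
  show "(\<lambda>N. Lp k (Z N * Z' N - U * U')) \<longlonglongrightarrow> 0"
    by (rule tendsto_sandwich[OF _ _ tendsto_const lim0]) (auto simp: le)
qed

lemma Lp_lim_power: "Lp_lim Z U \<Longrightarrow> Lp_lim (\<lambda>N. Z N ^ n) (U ^ n)"
  by (induction n) (auto intro: Lp_lim_const Lp_lim_mult)

lemma Lp_lim_tau: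
  assumes "Lp_lim Z U"
  shows "(\<lambda>N. \<tau> (Z N)) \<longlonglongrightarrow> \<tau> U"
proof -
  have "(\<lambda>N. Lp 0 (Z N - U)) \<longlonglongrightarrow> 0" using assms by (simp add: Lp_lim_def)
  then have "(\<lambda>N. \<tau> (Z N - U)) \<longlonglongrightarrow> 0"
    by (rule Lim_null_comparison[rotated]) (simp add: cmod_tau_le_Lp)
  then show ?thesis by (simp add: tau_diff LIM_zero_iff)
qed

lemma E_Lp_lim: "Lp_lim (\<lambda>N. E N N) (b t)"
  unfolding Lp_lim_def
proof
  fix k
  define z where "z N = E N N - b t" for N
  have L2: "(\<lambda>N. L2 (z N)) \<longlonglongrightarrow> 0"
  proof (rule LIMSEQ_I)
    fix \<epsilon> :: real assume \<epsilon>: "0 < \<epsilon>"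
    then have "0 < \<epsilon> / 2" by simp
    from euler_mean_square[OF less_imp_le[OF t] this]
    obtain \<rho> where \<rho>: "0 < \<rho>" "\<And>m p. is_partition 0 t m p \<Longrightarrow> (\<And>i. i < m \<Longrightarrow> p (Suc i) - p i < \<rho>) \<Longrightarrow>
        L2 (euler p m - b t) \<le> \<epsilon> / 2" by blast
    have "(\<lambda>N. t / real N) \<longlonglongrightarrow> 0" by (rule lim_const_over_n)
    then have "\<forall>\<^sub>F N in sequentially. t / real N < \<rho>" using \<rho>(1) by (intro order_tendstoD) auto
    then obtain N0 where N0: "\<And>N. N0 \<le> N \<Longrightarrow> t / real N < \<rho>"
      unfolding eventually_sequentially by blast
    have "norm (L2 (z N) - 0) < \<epsilon>" if N: "max 1 N0 \<le> N" for N
    proof -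
      have "L2 (euler (\<lambda>i. real i * h N) N - b t) \<le> \<epsilon> / 2"
      proof (rule \<rho>(2))
        show "is_partition 0 t N (\<lambda>i. real i * h N)"
          unfolding h_def using t N by (intro uniform_partition) auto
        show "real (Suc i) * h N - real i * h N < \<rho>" for i
          unfolding step_diff using N0[of N] N by (simp add: h_def)
      qed
      then show ?thesis using \<epsilon> by (simp add: z_def E_def)
    qed
    then show "\<exists>no. \<forall>N\<ge>no. norm (L2 (z N) - 0) < \<epsilon>" by blast
  qed
  have zO: "bigO 0 (\<lambda>N i. z N)"
  proof -
    \<comment> \<open>The sequence in \<open>N\<close> is viewed as a family constant in
      \<open>i\<close>, so that the calculus of orders applies to it.\<close>
    have "bigO 0 (\<lambda>N i. E N N)"
    proof (rule bigOI)
      fix k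
      obtain C where "0 \<le> C" "\<And>N i. 0 < N \<Longrightarrow> i \<le> N \<Longrightarrow> Lp k (E N i) \<le> C"
        using E_Lp_bounded by blast
      then show "\<exists>C\<ge>0. \<forall>N>0. \<forall>i\<le>N. Lp k (E N N) \<le> C * sqrt (h N) ^ 0"
        by (intro exI[of _ C]) simp
    qed
    then show ?thesis unfolding z_def by (intro bigO_diff bigO_const)
  qed
  have wO: "bigO 0 (\<lambda>N i. z N * (star (z N) * z N) ^ (2 ^ k - 1))"
    using bigO_mult[OF zO bigO_power[OF bigO_mult[OF bigO_star[OF zO] zO, simplified]]] by simp
  obtain C where "0 \<le> C" "\<And>N i. 0 < N \<Longrightarrow> i \<le> N \<Longrightarrow>
      Lp 0 (z N * (star (z N) * z N) ^ (2 ^ k - 1)) \<le> C * sqrt (h N) ^ 0"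
    using wO[unfolded bigO_def, rule_format, of 0] by blast
  then have C: "L2 (z N * (star (z N) * z N) ^ (2 ^ k - 1)) \<le> C" if "0 < N" for N
    using that le0[of N] by (simp only: Lp_0 power_0 mult_1_right)
  have "(\<lambda>N. L2 (z N) * C) \<longlonglongrightarrow> 0 * C" by (intro tendsto_intros L2)
  then have lim: "(\<lambda>N. L2 (z N) * C) \<longlonglongrightarrow> 0" by simp
  have ev: "\<forall>\<^sub>F N in sequentially. norm (Lp k (z N) ^ 2 ^ Suc k) \<le> L2 (z N) * C"
    using eventually_gt_at_top[of 0]
  proof eventually_elim
    case (elim N)
    have "Lp k (z N) ^ 2 ^ Suc k \<le> L2 (z N) * L2 (z N * (star (z N) * z N) ^ (2 ^ k - 1))"
      by (rule Lp_interpolation)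
    also have "\<dots> \<le> L2 (z N) * C" by (intro mult_left_mono C elim) simp
    finally show ?case by simp
  qed
  have "(\<lambda>N. Lp k (z N) ^ 2 ^ Suc k) \<longlonglongrightarrow> 0"
    by (rule Lim_null_comparison[OF ev lim])
  then have "(\<lambda>N. root (2 ^ Suc k) (Lp k (z N) ^ 2 ^ Suc k)) \<longlonglongrightarrow> root (2 ^ Suc k) 0"
    by (intro tendsto_real_root)
  then show "(\<lambda>N. Lp k (E N N - b t)) \<longlonglongrightarrow> 0"
    by (simp add: real_root_power_cancel z_def del: power_Suc)
qed

lemma ulim_endpoint:
  assumes m: "ulim t m Y" and lim: "(\<lambda>N. m N N) \<longlonglongrightarrow> L"
  shows "L = Y t"
proof (rule LIMSEQ_unique[OF lim])
  show "(\<lambda>N. m N N) \<longlonglongrightarrow> Y t"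
  proof (rule LIMSEQ_I)
    fix \<epsilon> :: real assume "0 < \<epsilon>"
    then have "0 < \<epsilon> / 2" by simp
    from ulimD[OF m this] obtain N0
      where N0: "\<And>N. N0 \<le> N \<Longrightarrow> cmod (m N N - Y (real N * (t / real N))) \<le> \<epsilon> / 2"
      unfolding eventually_sequentially by blast
    have "norm (m N N - Y t) < \<epsilon>" if "max 1 N0 \<le> N" for N
      using N0[of N] that \<open>0 < \<epsilon>\<close> by simp
    then show "\<exists>no. \<forall>N\<ge>no. norm (m N N - Y t) < \<epsilon>" by blast
  qed
qed

lemma moments_at_t:
  shows "\<tau> (b t ^ n) = complex_of_real (nu (int n) ((r - s) * t))"
    and "\<tau> ((b t * star (b t)) ^ n) = complex_of_real (nu (int n) (- 4 * s * t))"
    and "\<tau> (b t ^ 2 * star (b t) ^ 2)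
      = complex_of_real (exp (4 * s * t) + 4 * s * t * (1 + s * t) * exp ((3 * s - r) * t))"
proof -
  note lim = E_Lp_lim Lp_lim_star[OF E_Lp_lim]
  show "\<tau> (b t ^ n) = complex_of_real (nu (int n) ((r - s) * t))"
    by (rule ulim_endpoint[OF E_moments_limit]) (intro Lp_lim_tau Lp_lim_power lim)
  have "\<tau> ((star (b t) * b t) ^ n) = complex_of_real (nu (int n) (- 4 * s * t))"
    by (rule ulim_endpoint[OF E_star_E_moments_limit]) (intro Lp_lim_tau Lp_lim_power Lp_lim_mult lim)
  then show "\<tau> ((b t * star (b t)) ^ n) = complex_of_real (nu (int n) (- 4 * s * t))"
    by (simp only: tau_power_commute[of "b t"])
  have "\<tau> (b t * b t * star (b t) * star (b t))
      = complex_of_real (exp (4 * s * t) + 4 * s * t * (1 + s * t) * exp ((3 * s - r) * t))"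
    by (rule ulim_endpoint[OF E2_star_E2_limit]) (intro Lp_lim_tau Lp_lim_mult lim)
  then show "\<tau> (b t ^ 2 * star (b t) ^ 2)
      = complex_of_real (exp (4 * s * t) + 4 * s * t * (1 + s * t) * exp ((3 * s - r) * t))"
    by (simp add: power2_eq_square mult.assoc)
qed

end

theorem theorem1p9:
  fixes F :: "('a::cstar_algebra \<Rightarrow> complex) set"
    and \<tau> :: "'a \<Rightarrow> complex"
    and x y b :: "real \<Rightarrow> 'a"
    and r s t :: real
    and n :: nat
  assumes "faithful_tracial_wstar_space F \<tau>"
    and "free_brownian_motion \<tau> x"
    and "free_brownian_motion \<tau> y"
    and "freely_independent \<tau> (UNIV :: bool set) (\<lambda>i. if i then x ` {0..} else y ` {0..})"
    and "r \<ge> 0" and "s \<ge> 0" and "t \<ge> 0"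
    and "free_multiplicative_brownian_motion F \<tau> r s x y b"
  shows "\<tau> (b t ^ n) = complex_of_real (nu (int n) ((r - s) * t)) \<and>
         \<tau> (star (b t) ^ n) = complex_of_real (nu (int n) ((r - s) * t)) \<and>
         \<tau> ((b t * star (b t)) ^ n) = complex_of_real (nu (int n) (- 4 * s * t)) \<and>
         \<tau> (b t ^ 2 * star (b t) ^ 2) =
           complex_of_real (exp (4 * s * t) + 4 * s * t * (1 + s * t) * exp ((3 * s - r) * t))"
proof -
  interpret faithful_tracial_wstar_space F \<tau> by (rule assms(1))
  have "\<tau> (b t ^ n) = complex_of_real (nu (int n) ((r - s) * t)) \<and>
      \<tau> ((b t * star (b t)) ^ n) = complex_of_real (nu (int n) (- 4 * s * t)) \<and>
      \<tau> (b t ^ 2 * star (b t) ^ 2) =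
        complex_of_real (exp (4 * s * t) + 4 * s * t * (1 + s * t) * exp ((3 * s - r) * t))"
  \<comment> \<open>The scheme needs a positive step, so the initial time is checked
    directly.\<close>
  proof (cases "t = 0")
    case True
    moreover have "b 0 = 1"
      using assms(8) by (simp add: free_multiplicative_brownian_motion_def)
    ultimately show ?thesis by (simp add: tau_one nu_at_0)
  next
    case False
    then interpret euler_scheme F \<tau> x y b r s t
      using assms by unfold_locales auto
    show ?thesis using moments_at_t(1,2)[of n] moments_at_t(3) by blast
  qed
  \<comment> \<open>These moments are conjugates of the first family, which is real.\<close>
  moreover from this have "\<tau> (star (b t) ^ n) = complex_of_real (nu (int n) ((r - s) * t))"
    by (metis star_power tau_star complex_cnj_complex_of_real)
  ultimately show ?thesis by blast
qed

end
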